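(* Let $n$ and $r$ be integers with $r \geq \lfloor (n-1)/2 \rfloor$. Let $\mathcal{H}$ be an $n$-vertex $r$-uniform hypergraph that has a hamiltonian Berge cycle $C$. Define $c_r = 6$ if $r = \lfloor (n-1)/2 \rfloor$ and $c_r = 1$ if $r \geq n/2$. If there exists a vertex $v$ contained in at least $c_r$ edges of $E(\mathcal{H}) \setminus E(C)$, then $\mathcal{H}$ is pancyclic.
   Context: A hypergraph $\mathcal{H}$ has a vertex set $V(\mathcal{H})$ and an edge set $E(\mathcal{H})$ of subsets of $V(\mathcal{H})$; it is $r$-uniform if every edge has exactly $r$ vertices. A Berge cycle of length $k$ consists of $k$ distinct vertices $v_0,\dots,v_{k-1}$ and $k$ distinct edges $e_0,\dots,e_{k-1}$ such that $\{v_i,v_{i+1}\}\subseteq e_i$ for all $i$ (indices modulo $k$); $E(C)$ denotes the set of edges $e_0,\dots,e_{k-1}$ of the Berge cycle $C$. A hamiltonian Berge cycle in an $n$-vertex hypergraph is a Berge cycle of length $n$. An $n$-vertex hypergraph is pancyclic if it contains Berge cycles of every length from $2$ to $n$.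
   Formalization: The case n = 4, r = 2 is excluded, because the claim fails there: a 4-cycle plus a diagonal has c_r = 1 and an extra edge at a vertex, but no Berge cycle of length 2. *)

theory Defs
  imports Complex_Main
begin

text \<open>
  A hypergraph is given by its vertex set and its edge set, so there are no repeated edges.
\<close>

definition hypergraph :: "'a set \<Rightarrow> 'a set set \<Rightarrow> bool" where
  "hypergraph V E \<longleftrightarrow> finite V \<and> (\<forall>e\<in>E. e \<subseteq> V)"

definition uniform :: "nat \<Rightarrow> 'a set set \<Rightarrow> bool" where
  "uniform r E \<longleftrightarrow> (\<forall>e\<in>E. card e = r)"

text \<open>
  A Berge cycle is represented by the list of its vertices and the list of its edges, its length
  being the common length of the two lists; its edge set is \<open>set es\<close>.
\<close>

definition berge_cycle :: "'a set \<Rightarrow> 'a set set \<Rightarrow> 'a list \<Rightarrow> 'a set list \<Rightarrow> bool" where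
  "berge_cycle V E vs es \<longleftrightarrow>
     length es = length vs \<and> distinct vs \<and> distinct es \<and> set vs \<subseteq> V \<and> set es \<subseteq> E \<and>
     (\<forall>i<length vs. {vs ! i, vs ! (Suc i mod length vs)} \<subseteq> es ! i)"

definition hamiltonian_berge_cycle :: "'a set \<Rightarrow> 'a set set \<Rightarrow> 'a list \<Rightarrow> 'a set list \<Rightarrow> bool" where
  "hamiltonian_berge_cycle V E vs es \<longleftrightarrow> berge_cycle V E vs es \<and> length vs = card V"

definition pancyclic :: "'a set \<Rightarrow> 'a set set \<Rightarrow> bool" where
  "pancyclic V E \<longleftrightarrow> (\<forall>k\<in>{2..card V}. \<exists>vs es. berge_cycle V E vs es \<and> length vs = k)"

text \<open>
  The constant $c_r$. It is only used for $r \ge \lfloor (n-1)/2 \rfloor$, and then the second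
  case is precisely $r \ge n/2$.
\<close>

definition extra_edges :: "nat \<Rightarrow> nat \<Rightarrow> nat" where
  "extra_edges n r = (if int r = \<lfloor>(real n - 1) / 2\<rfloor> then 6 else 1)"

end

theory Submission
  imports Defs
begin

text \<open>
  Number the vertices and edges along the hamiltonian cycle and suppose that there is no Berge cycle
  of length \<open>d + 1\<close>. An edge outside the cycle then contains no two positions at distance \<open>d\<close>: the
  edge would close an arc. Likewise two edges \<open>X\<close>, \<open>Y\<close> that are not used on two disjoint arcs with
  \<open>d + 1\<close> vertices in total cannot connect the ends of these arcs, in parallel or crosswise. A set of
  \<open>r\<close> positions without distance \<open>d\<close> (equivalently \<open>m = n - d\<close>) is rigid if \<open>n\<close> is close to \<open>2r\<close>:
  \<open>2r \<le> n\<close>, and all but \<open>n - 2r\<close> of the pairs \<open>x\<close>, \<open>x - m\<close> contain exactly one of its elements. This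
  settles \<open>n < 2r\<close>, and one extra edge also suffices for \<open>n = 2r\<close>.

  For \<open>n = 2r + 1\<close> and \<open>n = 2r + 2\<close> the six extra edges share position 0. If \<open>d < r\<close>, two of them
  cannot share a position at distance more than \<open>d\<close> from 0, and there are not enough such positions; \<open>d = r\<close>
  is similar. If \<open>d > r\<close>, one compares an extra edge that contains \<open>q\<close> and \<open>q + 1\<close> with the cycle edge
  between these positions, which may be exchanged with it, or with a second such extra edge. Two such
  position sets differ only by moving an end of a run of \<open>m\<close> positions, or their union is a union of
  alternating blocks of length \<open>m\<close>; both shapes can be excluded. For even \<open>n\<close>, six edges without
  such a pair would have nearly the same empty columns \<open>{x, x - m}\<close> and two of them would coincide.
\<close>

section \<open>Paths, frames and cycles with one or two chords\<close>

text \<open>The count of empty pairs is exact: none for \<open>n = 2 * r\<close>, one for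
  \<open>n = 2 * r + 1\<close>, two for \<open>n = 2 * r + 2\<close>. Each of them is one degree of
  freedom in the position set, and this is why the argument gets longer from case to case.

  The number six enters in several places. For \<open>r = 2\<close> and \<open>n <= 6\<close> at
  most five edges pass through \<open>v\<close>, so six edges give \<open>3 <= r\<close>. For
  \<open>d = r = 3\<close> and \<open>n = 8\<close> one edge may contain the position opposite to 0,
  and the other five exceed the four patterns that are left. For \<open>n = 8\<close> and
  \<open>d = 5\<close> or \<open>d = 6\<close> exactly six triples through 0 avoid the distances
  \<open>d\<close> and \<open>8 - d\<close>; only because all six must be present do two of them
  close a cycle.

  The pair \<open>n = 4\<close>, \<open>r = 2\<close> is a true exception: a 4-cycle with one chord
  has no Berge cycle of length 2, because distinct edges of a graph share at most one
  vertex.\<close>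

fun bpath :: "'a list \<Rightarrow> 'a set list \<Rightarrow> bool" where
  "bpath [u] [] = True"
| "bpath (u # w # us) (f # fs) \<longleftrightarrow> u \<in> f \<and> w \<in> f \<and> bpath (w # us) fs"
| "bpath _ _ = False"

lemma bpath_nth:
  "bpath us fs \<Longrightarrow> length us = Suc (length fs) \<and> (\<forall>i<length fs. us ! i \<in> fs ! i \<and> us ! Suc i \<in> fs ! i)"
proof (induction us fs rule: bpath.induct)
  case (2 u w us f fs)
  then show ?case by (auto simp: less_Suc_eq_0_disj)
qed auto

lemma bpath_nonempty: "bpath us fs \<Longrightarrow> us \<noteq> []"
  by (cases us) auto

lemma bpath_append:
  assumes "bpath us fs" "bpath ws gs" "last us \<in> X" "hd ws \<in> X"
  shows "bpath (us @ ws) (fs @ X # gs)"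
  using assms
proof (induction us fs rule: bpath.induct)
  case (1 u)
  then show ?case by (cases ws) auto
qed auto

lemma bpath_rev: "bpath us fs \<Longrightarrow> bpath (rev us) (rev fs)"
proof (induction us fs rule: bpath.induct)
  case (2 u w us f fs)
  then have "bpath (rev (w # us) @ [u]) (rev fs @ f # [])"
    by (intro bpath_append) auto
  then show ?case by simp
qed auto

text \<open>Distinctness enters only when a path is closed, so concatenation and reversal of a
  \<open>bpath\<close> carry no disjointness conditions.\<close>

lemma bpath_close:
  assumes "bpath us fs" "last us \<in> X" "hd us \<in> X" "distinct us" "distinct (X # fs)"
    "set us \<subseteq> V" "set (X # fs) \<subseteq> E"
  shows "berge_cycle V E us (fs @ [X])"
proof -
  have len: "length us = Suc (length fs)" and
    nth: "\<And>i. i < length fs \<Longrightarrow> us ! i \<in> fs ! i \<and> us ! Suc i \<in> fs ! i"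
    using bpath_nth[OF assms(1)] by auto
  have "us ! i \<in> (fs @ [X]) ! i \<and> us ! (Suc i mod length us) \<in> (fs @ [X]) ! i"
    if "i < length us" for i
  proof (cases "i < length fs")
    case True
    then show ?thesis using nth[OF True] len by (simp add: nth_append)
  next
    case False
    with that len have i: "i = length fs" by simp
    have ne: "us \<noteq> []" using assms(1) by (rule bpath_nonempty)
    show ?thesis using assms(2,3) len i ne by (simp add: nth_append last_conv_nth hd_conv_nth)
  qed
  then show ?thesis
    using assms len by (auto simp: berge_cycle_def)
qed

text \<open>The hamiltonian cycle unrolled to the integers: an arc that runs past the end of the
  vertex list is still an interval, and a rotation is a translation of the argument.\<close>

definition cyc_frame :: "'a set \<Rightarrow> 'a set set \<Rightarrow> int \<Rightarrow> (int \<Rightarrow> 'a) \<Rightarrow> (int \<Rightarrow> 'a set) \<Rightarrow> bool" where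
  "cyc_frame V E n vx ed \<longleftrightarrow>
     (\<forall>i j. vx i = vx j \<longleftrightarrow> i mod n = j mod n) \<and> (\<forall>i j. ed i = ed j \<longleftrightarrow> i mod n = j mod n) \<and>
     range vx = V \<and> range ed \<subseteq> E \<and> (\<forall>i. vx i \<in> ed i \<and> vx (i + 1) \<in> ed i)"

definition arcv :: "(int \<Rightarrow> 'b) \<Rightarrow> int \<Rightarrow> int \<Rightarrow> 'b list" where
  "arcv f i j = map f [i..j]"

lemma arcv_Cons: "i \<le> j \<Longrightarrow> arcv f i j = f i # arcv f (i + 1) j"
  by (simp add: arcv_def upto.simps)

lemma arcv_empty [simp]: "j < i \<Longrightarrow> arcv f i j = []"
  by (simp add: arcv_def)

lemma set_arcv [simp]: "set (arcv f i j) = f ` {i..j}"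
  by (simp add: arcv_def)

lemma length_arcv [simp]: "length (arcv f i j) = nat (j - i + 1)"
  by (simp add: arcv_def)

lemma hd_arcv [simp]: "i \<le> j \<Longrightarrow> hd (arcv f i j) = f i"
  by (simp add: arcv_Cons)

lemma last_arcv [simp]: "i \<le> j \<Longrightarrow> last (arcv f i j) = f j"
  by (simp add: arcv_def upto_rec2)

lemma distinct_arcv: "inj_on f {i..j} \<Longrightarrow> distinct (arcv f i j)"
  by (simp add: arcv_def distinct_map)

lemma bpath_arcv:
  assumes "\<And>i. vx i \<in> ed i \<and> vx (i + 1) \<in> ed i" "i \<le> j"
  shows "bpath (arcv vx i j) (arcv ed i (j - 1))"
proof -
  \<comment> \<open>The arc grows to the left, the side on which \<open>arcv_Cons\<close> unfolds
    both lists.\<close>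
  have "bpath (arcv vx (j - int k) j) (arcv ed (j - int k) (j - 1))" for k
  proof (induction k)
    case 0
    then show ?case by (simp add: arcv_Cons)
  next
    case (Suc k)
    have e: "j - int (Suc k) + 1 = j - int k" by simp
    have "arcv vx (j - int (Suc k)) j = vx (j - int (Suc k)) # arcv vx (j - int k) j"
      using arcv_Cons[of "j - int (Suc k)" j vx] e by simp
    moreover have "arcv vx (j - int k) j = vx (j - int k) # arcv vx (j - int k + 1) j"
      by (rule arcv_Cons) simp
    moreover have "arcv ed (j - int (Suc k)) (j - 1) = ed (j - int (Suc k)) # arcv ed (j - int k) (j - 1)"
      using arcv_Cons[of "j - int (Suc k)" "j - 1" ed] e by simp
    moreover have "vx (j - int (Suc k)) \<in> ed (j - int (Suc k))" "vx (j - int k) \<in> ed (j - int (Suc k))"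
      using assms(1)[of "j - int (Suc k)"] e by auto
    ultimately show ?case using Suc by simp
  qed
  from this[of "nat (j - i)"] show ?thesis using assms(2) by simp
qed

lemma mod_eq_close:
  fixes n x y :: int
  assumes "x mod n = y mod n" "\<bar>x - y\<bar> < n"
  shows "x = y"
proof -
  have "n dvd x - y" using assms(1) by (simp add: mod_eq_dvd_iff)
  then show ?thesis using assms(2)
    by (smt (verit) zdvd_imp_le dvd_minus_iff)
qed

section \<open>Chords that would close a cycle of the missing length d + 1\<close>

locale no_cycle =
  fixes V :: "'a set" and E :: "'a set set" and n d r :: int
  assumes no_cycle: "berge_cycle V E us fs \<Longrightarrow> int (length us) \<noteq> d + 1"
    and d_pos: "1 \<le> d" and d_le: "d \<le> n - 2"
    and edge_sub: "e \<in> E \<Longrightarrow> e \<subseteq> V" and edge_card: "e \<in> E \<Longrightarrow> int (card e) = r"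
begin

lemma n_pos: "0 < n" using d_pos d_le by simp

abbreviation "frame \<equiv> cyc_frame V E n"

lemma frame_vx: "frame vx ed \<Longrightarrow> vx i = vx j \<longleftrightarrow> i mod n = j mod n"
  and frame_ed: "frame vx ed \<Longrightarrow> ed i = ed j \<longleftrightarrow> i mod n = j mod n"
  and frame_range: "frame vx ed \<Longrightarrow> range vx = V"
  and frame_inE: "frame vx ed \<Longrightarrow> ed i \<in> E"
  and frame_inc: "frame vx ed \<Longrightarrow> vx i \<in> ed i \<and> vx (i + 1) \<in> ed i"
  by (auto simp: cyc_frame_def)

lemma frame_inj:
  assumes "frame vx ed" "\<And>i j. i \<in> S \<Longrightarrow> j \<in> S \<Longrightarrow> \<bar>i - j\<bar> < n"
  shows "inj_on vx S" "inj_on ed S"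
  using assms mod_eq_close[of _ n] by (auto simp: inj_on_def frame_vx frame_ed)

text \<open>Only the edges of this arc are forbidden for \<open>X\<close>. It may be used elsewhere
  on the cycle, so a cycle edge can also serve as the chord.\<close>

lemma one_arc:
  assumes fr: "frame vx ed" and X: "X \<in> E" "X \<notin> ed ` {i..<i + d}" "vx i \<in> X" "vx (i + d) \<in> X"
  shows False
proof -
  have "berge_cycle V E (arcv vx i (i + d)) (arcv ed i (i + d - 1) @ [X])"
  proof (rule bpath_close)
    show "bpath (arcv vx i (i + d)) (arcv ed i (i + d - 1))"
      using bpath_arcv[of vx ed i "i + d"] frame_inc[OF fr] d_pos by simp
    show "distinct (arcv vx i (i + d))"
      by (rule distinct_arcv, rule frame_inj(1)[OF fr]) (use d_le in auto)
    have "distinct (arcv ed i (i + d - 1))"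
      by (rule distinct_arcv, rule frame_inj(2)[OF fr]) (use d_le in auto)
    moreover have "{i..i + d - 1} = {i..<i + d}" by auto
    ultimately show "distinct (X # arcv ed i (i + d - 1))" using X by simp
  qed (use X d_pos frame_range[OF fr] frame_inE[OF fr] in auto)
  from no_cycle[OF this] d_pos show False by simp
qed

lemma two_paths:
  assumes "bpath us fs" "bpath ws gs" "last us \<in> X" "hd ws \<in> X" "last ws \<in> Y" "hd us \<in> Y"
    "distinct (us @ ws)" "distinct (Y # fs @ X # gs)" "set (us @ ws) \<subseteq> V" "set (Y # fs @ X # gs) \<subseteq> E"
    "int (length us + length ws) = d + 1"
  shows False
proof -
  have ne: "us \<noteq> []" "ws \<noteq> []" using assms(1,2) bpath_nonempty by auto
  have "berge_cycle V E (us @ ws) ((fs @ X # gs) @ [Y])"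
    by (rule bpath_close[OF bpath_append[OF assms(1-4)]]) (use assms ne in auto)
  from no_cycle[OF this] assms(11) show False by simp
qed

lemma arcs_distinct:
  assumes "frame vx ed" "i \<le> i'" "i' < j" "j \<le> j'" "j' < i + n"
  shows "distinct (arcv vx i i' @ arcv vx j j')"
    "distinct (arcv ed i (i' - 1) @ arcv ed j (j' - 1))"
proof -
  have *: "inj_on vx {i..j'}" "inj_on ed {i..j'}"
    by (rule frame_inj[OF assms(1)]; use assms in auto)+
  have "f ` {i..a} \<inter> f ` {j..b} = {}" if "inj_on f {i..j'}" "a \<le> i'" "b \<le> j'" for f :: "int \<Rightarrow> 'c" and a b
  proof -
    have "f ` {i..a} \<inter> f ` {j..b} = f ` ({i..a} \<inter> {j..b})"
      by (rule inj_on_image_Int[OF that(1), symmetric]) (use that assms in auto)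
    also have "{i..a} \<inter> {j..b} = {}" using that assms by auto
    finally show ?thesis by simp
  qed
  from this[OF *(1), of i' j'] this[OF *(2), of "i' - 1" "j' - 1"]
  show "distinct (arcv vx i i' @ arcv vx j j')" "distinct (arcv ed i (i' - 1) @ arcv ed j (j' - 1))"
    using assms * by (auto intro!: distinct_arcv intro: inj_on_subset)
qed

text \<open>Both arcs are run upwards: from \<open>i\<close> to \<open>i'\<close>, along
  \<open>X\<close> to \<open>j\<close>, on to \<open>j'\<close>, and back along \<open>Y\<close>.
  The bound \<open>j' < i + n\<close> keeps the arcs disjoint.\<close>

lemma para:
  assumes fr: "frame vx ed" and XY: "X \<in> E" "Y \<in> E" "X \<noteq> Y"
    and o: "i \<le> i'" "i' < j" "j \<le> j'" "j' < i + n" "(i' - i) + (j' - j) = d - 1"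
    and fX: "X \<notin> ed ` ({i..<i'} \<union> {j..<j'})" and fY: "Y \<notin> ed ` ({i..<i'} \<union> {j..<j'})"
    and inc: "vx i' \<in> X" "vx j \<in> X" "vx j' \<in> Y" "vx i \<in> Y"
  shows False
proof -
  have s: "{i..i' - 1} = {i..<i'}" "{j..j' - 1} = {j..<j'}" by auto
  show False
    by (rule two_paths[OF bpath_arcv[of vx ed i i'] bpath_arcv[of vx ed j j'], where X = X and Y = Y])
      (use frame_inc[OF fr] frame_range[OF fr] frame_inE[OF fr] XY o fX fY inc arcs_distinct[OF fr o(1-4)] s in auto)
qed

text \<open>The second arc is run downwards: from \<open>i\<close> to \<open>i'\<close>, along
  \<open>Y\<close> to \<open>j'\<close>, down to \<open>j\<close>, and back along
  \<open>X\<close>.\<close>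

lemma cross:
  assumes fr: "frame vx ed" and XY: "X \<in> E" "Y \<in> E" "X \<noteq> Y"
    and o: "i \<le> i'" "i' < j" "j \<le> j'" "j' < i + n" "(i' - i) + (j' - j) = d - 1"
    and fX: "X \<notin> ed ` ({i..<i'} \<union> {j..<j'})" and fY: "Y \<notin> ed ` ({i..<i'} \<union> {j..<j'})"
    and inc: "vx i \<in> X" "vx j \<in> X" "vx i' \<in> Y" "vx j' \<in> Y"
  shows False
proof -
  have s: "{i..i' - 1} = {i..<i'}" "{j..j' - 1} = {j..<j'}" by auto
  have ne: "arcv vx j j' \<noteq> []" using o by (simp add: arcv_Cons)
  have r: "bpath (rev (arcv vx j j')) (rev (arcv ed j (j' - 1)))"
    by (rule bpath_rev, rule bpath_arcv) (use frame_inc[OF fr] o in auto)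
  show False
    by (rule two_paths[OF bpath_arcv[of vx ed i i'] r, where X = Y and Y = X])
      (use frame_inc[OF fr] frame_range[OF fr] frame_inE[OF fr] XY o fX fY inc arcs_distinct[OF fr o(1-4)] s ne
        in \<open>auto simp: hd_rev last_rev\<close>)
qed

end

section \<open>Position sets of edges\<close>

lemma frame_of_hamiltonian:
  assumes "hamiltonian_berge_cycle V E vs es" "finite V" "v \<in> V"
  obtains vx ed where "cyc_frame V E (int (card V)) vx ed" "vx 0 = v" "range ed = set es"
proof -
  let ?n = "length vs"
  have bc: "length es = ?n" "distinct vs" "distinct es" "set vs \<subseteq> V" "set es \<subseteq> E" "?n = card V"
    and inc: "\<And>i. i < ?n \<Longrightarrow> vs ! i \<in> es ! i \<and> vs ! (Suc i mod ?n) \<in> es ! i"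
    using assms(1) by (auto simp: hamiltonian_berge_cycle_def berge_cycle_def)
  have V: "set vs = V"
    using bc assms(2) by (metis card_subset_eq distinct_card)
  obtain c where c: "c < ?n" "vs ! c = v" using assms(3) V by (metis in_set_conv_nth)
  \<comment> \<open>The list index of position \<open>i\<close>, rotated so that \<open>v\<close>
    stands at position 0.\<close>
  let ?k = "\<lambda>i. nat ((i + int c) mod int ?n)"
  have n0: "0 < ?n" using c by linarith
  have kl: "?k i < ?n" for i using n0 by (simp add: nat_less_iff)
  have keq: "?k i = ?k j \<longleftrightarrow> i mod int ?n = j mod int ?n" for i j
  proof -
    have "?k i = ?k j \<longleftrightarrow> (i + int c) mod int ?n = (j + int c) mod int ?n"
      using n0 by (auto simp: nat_eq_iff2)
    also have "\<dots> \<longleftrightarrow> i mod int ?n = j mod int ?n" by (simp add: mod_eq_dvd_iff)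
    finally show ?thesis .
  qed
  have ks: "?k (i + 1) = Suc (?k i) mod ?n" for i
  proof -
    have "int (Suc (?k i) mod ?n) = ((i + int c) mod int ?n + 1) mod int ?n"
      using n0 by (simp add: zmod_int add.commute)
    also have "\<dots> = (i + 1 + int c) mod int ?n" by (simp add: mod_simps algebra_simps)
    finally show ?thesis by (metis nat_int)
  qed
  have sur: "\<exists>i. ?k i = j" if "j < ?n" for j
    by (rule exI[of _ "int j - int c"]) (use that in simp)
  have R: "range (\<lambda>i. xs ! ?k i) = set xs" if "length xs = ?n" for xs :: "'b list"
    using that kl sur by (fastforce simp: in_set_conv_nth)
  have D: "(xs ! ?k i = xs ! ?k j) \<longleftrightarrow> i mod int ?n = j mod int ?n" if "length xs = ?n" "distinct xs" for xs :: "'b list" and i j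
    using that kl keq by (metis nth_eq_iff_index_eq)
  have R1: "range (\<lambda>i. vs ! ?k i) = V" using R[of vs] V by simp
  have R2: "range (\<lambda>i. es ! ?k i) = set es" using R[of es] bc by simp
  have D1: "(vs ! ?k i = vs ! ?k j) \<longleftrightarrow> i mod int ?n = j mod int ?n" for i j
    using D[of vs] bc by simp
  have D2: "(es ! ?k i = es ! ?k j) \<longleftrightarrow> i mod int ?n = j mod int ?n" for i j
    using D[of es] bc by simp
  have "vs ! ?k i \<in> es ! ?k i \<and> vs ! ?k (i + 1) \<in> es ! ?k i" for i
    using inc[OF kl[of i]] ks by simp
  then have "cyc_frame V E (int ?n) (\<lambda>i. vs ! ?k i) (\<lambda>i. es ! ?k i)"
    unfolding cyc_frame_def using R1 R2 D1 D2 bc(5) by simp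
  moreover have "vs ! ?k 0 = v" using c by simp
  ultimately show thesis using that R2 bc(6) by metis
qed

definition periodic_set :: "int \<Rightarrow> int \<Rightarrow> int set \<Rightarrow> bool" where
  "periodic_set n r A \<longleftrightarrow> (\<forall>i. i + n \<in> A \<longleftrightarrow> i \<in> A) \<and> int (card (A \<inter> {0..<n})) = r"

lemma periodic_add_mult:
  assumes "\<And>i. i + n \<in> A \<longleftrightarrow> i \<in> A"
  shows "i + n * k \<in> A \<longleftrightarrow> i \<in> (A :: int set)"
proof -
  have *: "i + n * int j \<in> A \<longleftrightarrow> i \<in> A" for j i
  proof (induction j)
    case (Suc j)
    have "i + n * int (Suc j) = (i + n * int j) + n" by (simp add: algebra_simps)
    then show ?case using assms Suc by metis
  qed simp
  show ?thesis
  proof (cases "0 \<le> k")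
    case True
    then show ?thesis using *[of i "nat k"] by simp
  next
    case False
    then show ?thesis using *[of "i + n * k" "nat (- k)"] by simp
  qed
qed

lemma periodic_mod:
  assumes "\<And>i. i + n \<in> A \<longleftrightarrow> i \<in> (A :: int set)" "x mod n = y mod n"
  shows "x \<in> A \<longleftrightarrow> y \<in> A"
proof -
  obtain k where "x = y + n * k" using assms(2) by (metis mod_eq_dvd_iff dvdE add_diff_cancel_left' diff_add_cancel add.commute)
  then show ?thesis using periodic_add_mult[OF assms(1)] by metis
qed

lemma card_window:
  assumes "\<And>i. i + n \<in> A \<longleftrightarrow> i \<in> (A :: int set)" "0 < n"
  shows "card (A \<inter> {c..<c + n}) = card (A \<inter> {0..<n})"
proof (rule bij_betw_same_card[of "\<lambda>x. x mod n"])
  have inA: "x mod n \<in> A \<longleftrightarrow> x \<in> A" for x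
    by (rule periodic_mod[OF assms(1)]) simp
  have inj: "inj_on (\<lambda>x. x mod n) {c..<c + n}"
    by (auto simp: inj_on_def intro!: mod_eq_close[of _ n])
  have "(\<lambda>x. x mod n) ` (A \<inter> {c..<c + n}) = A \<inter> {0..<n}"
  proof (intro equalityI subsetI)
    fix y assume y: "y \<in> A \<inter> {0..<n}"
    let ?x = "c + (y - c) mod n"
    have "?x mod n = y mod n" by (simp add: mod_simps)
    then have "?x mod n = y" using y by simp
    moreover have "?x \<in> A" using inA[of ?x] calculation y by simp
    moreover have "?x \<in> {c..<c + n}" using assms(2) by simp
    ultimately show "y \<in> (\<lambda>x. x mod n) ` (A \<inter> {c..<c + n})"
      by (metis (no_types, lifting) IntI image_eqI)
  qed (use inA assms(2) in auto)
  then show "bij_betw (\<lambda>x. x mod n) (A \<inter> {c..<c + n}) (A \<inter> {0..<n})"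
    using inj by (auto simp: bij_betw_def intro: inj_on_subset)
qed

definition pos :: "(int \<Rightarrow> 'a) \<Rightarrow> 'a set \<Rightarrow> int set" where
  "pos vx X = {i. vx i \<in> X}"

lemma pos_iff [simp]: "i \<in> pos vx X \<longleftrightarrow> vx i \<in> X"
  by (simp add: pos_def)

definition swap_edge :: "int \<Rightarrow> (int \<Rightarrow> 'a set) \<Rightarrow> int \<Rightarrow> 'a set \<Rightarrow> int \<Rightarrow> 'a set" where
  "swap_edge n ed q X = (\<lambda>j. if j mod n = q mod n then X else ed j)"

context no_cycle
begin

lemma frame_period: "frame vx ed \<Longrightarrow> vx (i + n) = vx i"
  by (simp add: frame_vx)

lemma frame_bij:
  assumes "frame vx ed"
  shows "bij_betw vx {0..<n} V"
proof -
  have "vx ` {0..<n} = V"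
  proof (intro equalityI subsetI)
    fix v assume "v \<in> V"
    then obtain i where "v = vx i" using frame_range[OF assms] by auto
    then have "v = vx (i mod n)" using frame_vx[OF assms] by (metis mod_mod_trivial)
    then show "v \<in> vx ` {0..<n}" using n_pos by simp
  qed (use frame_range[OF assms] in auto)
  then show ?thesis using frame_inj(1)[OF assms, of "{0..<n}"] by (simp add: bij_betw_def abs_if)
qed

lemma pos_periodic:
  assumes "frame vx ed" "X \<in> E"
  shows "periodic_set n r (pos vx X)"
proof -
  have "card (pos vx X \<inter> {0..<n}) = card X"
  proof (rule bij_betw_same_card)
    have "vx ` (pos vx X \<inter> {0..<n}) = X"
      using frame_bij[OF assms(1)] edge_sub[OF assms(2)] by (auto simp: bij_betw_def)
    then show "bij_betw vx (pos vx X \<inter> {0..<n}) X"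
      using frame_bij[OF assms(1)] by (auto simp: bij_betw_def intro: inj_on_subset)
  qed
  then show ?thesis
    using edge_card[OF assms(2)] frame_period[OF assms(1)] by (simp add: periodic_set_def)
qed

lemma pos_eq:
  assumes "frame vx ed" "X \<in> E" "Y \<in> E" "pos vx X = pos vx Y"
  shows "X = Y"
proof -
  have "x \<in> X \<longleftrightarrow> x \<in> Y" for x
  proof (cases "x \<in> V")
    case True
    then obtain i where "x = vx i" using frame_range[OF assms(1)] by auto
    then show ?thesis using assms(4) by (metis pos_iff)
  qed (use edge_sub assms in auto)
  then show ?thesis by auto
qed

lemma frame_shift:
  assumes "frame vx ed"
  shows "frame (\<lambda>i. vx (i + q)) (\<lambda>i. ed (i + q))" "range (\<lambda>i. ed (i + q)) = range ed"
proof -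
  have R: "range (\<lambda>i. f (i + q)) = range f" for f :: "int \<Rightarrow> 'b"
  proof (intro equalityI subsetI)
    fix y assume "y \<in> range f"
    then obtain j where "y = f j" by blast
    then have "y = f ((j - q) + q)" by simp
    then show "y \<in> range (\<lambda>i. f (i + q))" by blast
  qed blast
  have M: "(i + q) mod n = (j + q) mod n \<longleftrightarrow> i mod n = j mod n" for i j
    by (simp add: mod_eq_dvd_iff)
  have I: "vx (i + q) \<in> ed (i + q) \<and> vx (i + 1 + q) \<in> ed (i + q)" for i
    using frame_inc[OF assms, of "i + q"] by (simp add: algebra_simps)
  have "vx (i + q) = vx (j + q) \<longleftrightarrow> i mod n = j mod n" "ed (i + q) = ed (j + q) \<longleftrightarrow> i mod n = j mod n" for i j
    using frame_vx[OF assms, of "i + q" "j + q"] frame_ed[OF assms, of "i + q" "j + q"] M by blast+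
  moreover have "range (\<lambda>i. vx (i + q)) = V" "range (\<lambda>i. ed (i + q)) \<subseteq> E"
    unfolding R using assms unfolding cyc_frame_def by blast+
  ultimately show "frame (\<lambda>i. vx (i + q)) (\<lambda>i. ed (i + q))"
    unfolding cyc_frame_def using I by blast
  show "range (\<lambda>i. ed (i + q)) = range ed" by (rule R)
qed

lemma frame_swap:
  assumes "frame vx ed" "X \<in> E" "X \<notin> range ed" "vx q \<in> X" "vx (q + 1) \<in> X"
  shows "frame vx (swap_edge n ed q X)" "range (swap_edge n ed q X) \<subseteq> insert X (range ed - {ed q})"
proof -
  let ?e = "swap_edge n ed q X"
  have e: "?e j = X" if "j mod n = q mod n" for j using that by (simp add: swap_edge_def)
  have e': "?e j = ed j" if "j mod n \<noteq> q mod n" for j using that by (simp add: swap_edge_def)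
  have X: "X \<noteq> ed j" for j using assms(3) by blast
  have "vx i \<in> ?e i \<and> vx (i + 1) \<in> ?e i" for i
  proof (cases "i mod n = q mod n")
    case True
    then have "(i + 1) mod n = (q + 1) mod n" by (metis mod_add_left_eq)
    then have "vx i = vx q" "vx (i + 1) = vx (q + 1)" using frame_vx[OF assms(1)] True by blast+
    then show ?thesis using e[OF True] assms(4,5) by simp
  next
    case False
    then show ?thesis using e'[OF False] frame_inc[OF assms(1), of i] by simp
  qed
  moreover have "?e i = ?e j \<longleftrightarrow> i mod n = j mod n" for i j
  proof (cases "i mod n = q mod n"; cases "j mod n = q mod n")
    assume "i mod n \<noteq> q mod n" "j mod n \<noteq> q mod n"
    then show ?thesis using e' frame_ed[OF assms(1), of i j] by simp
  next
    assume *: "i mod n \<noteq> q mod n" "j mod n = q mod n"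
    then show ?thesis using e[OF *(2)] e'[OF *(1)] X[of i] by auto
  next
    assume *: "i mod n = q mod n" "j mod n \<noteq> q mod n"
    then show ?thesis using e[OF *(1)] e'[OF *(2)] X[of j] by auto
  qed (simp add: e)
  moreover have "?e i \<in> E" for i
    using e[of i] e'[of i] assms(2) frame_inE[OF assms(1), of i] by (cases "i mod n = q mod n") simp_all
  ultimately show "frame vx ?e"
    using frame_vx[OF assms(1)] frame_range[OF assms(1)] unfolding cyc_frame_def by blast
  show "range ?e \<subseteq> insert X (range ed - {ed q})"
  proof (rule image_subsetI)
    fix i
    show "?e i \<in> insert X (range ed - {ed q})"
      using e[of i] e'[of i] frame_ed[OF assms(1), of i q] by (cases "i mod n = q mod n") simp_all
  qed
qed

text \<open>An edge is available at position 0 when the cycle uses it at most there: this covers both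
  the edges outside the cycle and the cycle edge \<open>ed 0\<close>.\<close>

definition avail :: "(int \<Rightarrow> 'a set) \<Rightarrow> 'a set \<Rightarrow> bool" where
  "avail ed X \<longleftrightarrow> X \<in> E \<and> (\<forall>j. ed j = X \<longrightarrow> j mod n = 0)"

lemma availD: "avail ed X \<Longrightarrow> X \<in> E"
  by (simp add: avail_def)

lemma avail_extra: "X \<in> E \<Longrightarrow> X \<notin> range ed \<Longrightarrow> avail ed X"
  by (auto simp: avail_def)

lemma avail_zero: "frame vx ed \<Longrightarrow> avail ed (ed 0)"
  by (auto simp: avail_def frame_ed frame_inE)

lemma avail_image:
  assumes "avail ed X" "\<And>j. j \<in> S \<Longrightarrow> 0 < j \<and> j < n \<or> - n < j \<and> j < 0"
  shows "X \<notin> ed ` S"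
proof
  assume "X \<in> ed ` S"
  then obtain j where j: "j \<in> S" "j mod n = 0" using assms(1) by (auto simp: avail_def)
  then have "j mod n = 0 mod n" by simp
  from mod_eq_close[OF this] assms(2)[OF j(1)] show False by auto
qed

text \<open>Distance \<open>n - d\<close> is distance \<open>d\<close> read from the other end: the
  arc starts at \<open>i + (n - d)\<close> and ends at \<open>i + n\<close>.\<close>

lemma extra_free:
  assumes "frame vx ed" "X \<in> E" "X \<notin> range ed" "vx i \<in> X"
  shows "vx (i + d) \<notin> X" "vx (i + (n - d)) \<notin> X"
proof -
  show "vx (i + d) \<notin> X"
    using one_arc[OF assms(1,2) _ assms(4)] assms(3) by auto
  show "vx (i + (n - d)) \<notin> X"
    using one_arc[OF assms(1,2), of "i + (n - d)"] assms(3,4) frame_period[OF assms(1), of i] by auto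
qed

text \<open>With \<open>X\<close> in its place, \<open>ed q\<close> lies outside a hamiltonian cycle
  on the same vertices, and \<open>extra_free\<close> applies to it.\<close>

lemma replaced_free:
  assumes "frame vx ed" "X \<in> E" "X \<notin> range ed" "vx q \<in> X" "vx (q + 1) \<in> X" "vx i \<in> ed q"
  shows "vx (i + d) \<notin> ed q" "vx (i + (n - d)) \<notin> ed q"
proof -
  note s = frame_swap[OF assms(1-5)]
  have "ed q \<notin> range (swap_edge n ed q X)" using s(2) assms(3) by auto
  then show "vx (i + d) \<notin> ed q" "vx (i + (n - d)) \<notin> ed q"
    using extra_free[OF s(1) frame_inE[OF assms(1)] _ assms(6)] by auto
qed

text \<open>This is \<open>para\<close> with the first arc shrunk to the common vertex
  \<open>p\<close>.\<close>

lemma common_vertex: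
  assumes "frame vx ed" "X \<in> E" "Y \<in> E" "X \<noteq> Y" "X \<notin> ed ` {x..<x + d - 1}" "Y \<notin> ed ` {x..<x + d - 1}"
    and "p < x" "x + d - 1 < p + n" "vx p \<in> X" "vx p \<in> Y" "vx x \<in> X"
  shows "vx (x + d - 1) \<notin> Y"
proof
  assume "vx (x + d - 1) \<in> Y"
  then show False
    using para[OF assms(1-4), of p p x "x + d - 1"] assms d_pos by auto
qed

lemma crossing:
  assumes "frame vx ed" "X \<in> E" "Y \<in> E" "X \<noteq> Y"
    and "X \<notin> ed ` ({y..<z - 1} \<union> {z..<y + d})" "Y \<notin> ed ` ({y..<z - 1} \<union> {z..<y + d})"
    and "y < z" "z \<le> y + d" "vx y \<in> X" "vx (y + d) \<in> Y" "vx z \<in> X"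
  shows "vx (z - 1) \<notin> Y"
proof
  assume "vx (z - 1) \<in> Y"
  then show False
    using cross[OF assms(1-4), of y "z - 1" z "y + d"] assms d_le by auto
qed

end

text \<open>What is left of two edges through positions 0 and 1 when the hypergraph is forgotten.
  \<open>straddle\<close> combines freeness with the cut between 0 and 1; \<open>stepA\<close> and
  \<open>stepB\<close> come from cycles through the common vertex 0 or 1. The pair can be two extra
  edges, or an extra edge and the cycle edge between these positions.\<close>

locale qpair =
  fixes n m r :: int and A B :: "int set"
  assumes perA: "periodic_set n r A" and perB: "periodic_set n r B"
    and freeA: "x \<in> A \<Longrightarrow> x + m \<notin> A" and freeB: "x \<in> B \<Longrightarrow> x + m \<notin> B"
    and in0: "0 \<in> A" "0 \<in> B" and in1: "1 \<in> A" "1 \<in> B"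
    and straddle: "m + 1 \<le> x \<Longrightarrow> x \<le> n \<Longrightarrow> x \<in> A \<union> B \<Longrightarrow> x - m \<notin> A \<union> B"
    and stepA: "1 \<le> x \<Longrightarrow> x \<le> m + 1 \<Longrightarrow> x \<in> A \<Longrightarrow> x - 1 - m \<notin> B"
    and stepB: "1 \<le> x \<Longrightarrow> x \<le> m + 1 \<Longrightarrow> x \<in> B \<Longrightarrow> x - 1 - m \<notin> A"
    and m2: "2 \<le> m" and mn: "2 * m \<le> n"

section \<open>Two edges that share the positions 0 and 1\<close>

context no_cycle
begin

lemma common_step:
  assumes fr: "frame vx ed" and X: "avail ed X" and Y: "avail ed Y" and ne: "X \<noteq> Y"
    and i: "vx 0 \<in> X" "vx 0 \<in> Y" and x: "1 \<le> x" "x \<le> n - d" "vx x \<in> X"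
  shows "vx (x - 1 - (n - d)) \<notin> Y"
proof -
  have "vx (x + d - 1) \<notin> Y"
    by (rule common_vertex[OF fr availD[OF X] availD[OF Y] ne avail_image[OF X] avail_image[OF Y] _ _ i x(3)])
      (use x d_pos in auto)
  moreover have "vx (x - 1 - (n - d)) = vx (x + d - 1)"
    using frame_period[OF fr, of "x - 1 - (n - d)"] by (simp add: algebra_simps)
  ultimately show ?thesis by simp
qed

lemma common_step':
  assumes fr: "frame vx ed" and X: "avail ed X" and Y: "avail ed Y" and ne: "X \<noteq> Y"
    and i: "vx 1 \<in> X" "vx 1 \<in> Y" and x: "2 \<le> x" "x \<le> n - d + 1" "vx x \<in> X"
  shows "vx (x - 1 - (n - d)) \<notin> Y"
proof -
  have "vx (x + d - 1) \<notin> Y"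
    by (rule common_vertex[OF fr availD[OF X] availD[OF Y] ne avail_image[OF X] avail_image[OF Y] _ _ i x(3)])
      (use x d_pos in auto)
  moreover have "vx (x - 1 - (n - d)) = vx (x + d - 1)"
    using frame_period[OF fr, of "x - 1 - (n - d)"] by (simp add: algebra_simps)
  ultimately show ?thesis by simp
qed

lemma straddling:
  assumes fr: "frame vx ed" and X: "avail ed X" and Y: "avail ed Y" and ne: "X \<noteq> Y"
    and i: "vx 0 \<in> X" "vx 0 \<in> Y" "vx 1 \<in> X" "vx 1 \<in> Y"
    and y: "1 - d \<le> y" "y \<le> 0" "vx y \<in> X"
  shows "vx (y + d) \<notin> Y"
proof
  assume "vx (y + d) \<in> Y"
  then have "vx (1 - 1) \<notin> Y"
    by (intro crossing[OF fr availD[OF X] availD[OF Y] ne avail_image[OF X] avail_image[OF Y]])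
      (use y i d_le in auto)
  then show False using i by simp
qed

text \<open>Freeness is a hypothesis on each edge because it has two sources:
  \<open>extra_free\<close> for an extra edge, and \<open>replaced_free\<close> for
  \<open>ed 0\<close>.\<close>

lemma qpair_intro:
  assumes fr: "frame vx ed" and X: "avail ed X" and Y: "avail ed Y" and ne: "X \<noteq> Y"
    and i: "vx 0 \<in> X" "vx 0 \<in> Y" "vx 1 \<in> X" "vx 1 \<in> Y"
    and fX: "\<And>x. vx x \<in> X \<Longrightarrow> vx (x + (n - d)) \<notin> X" and fY: "\<And>x. vx x \<in> Y \<Longrightarrow> vx (x + (n - d)) \<notin> Y"
    and mn: "2 * (n - d) \<le> n"
  shows "qpair n (n - d) r (pos vx X) (pos vx Y)"
proof
  show "periodic_set n r (pos vx X)" "periodic_set n r (pos vx Y)"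
    using pos_periodic[OF fr] X Y availD by blast+
  show "x - (n - d) \<notin> pos vx X \<union> pos vx Y" if x: "n - d + 1 \<le> x" "x \<le> n" "x \<in> pos vx X \<union> pos vx Y" for x
  proof
    assume a: "x - (n - d) \<in> pos vx X \<union> pos vx Y"
    have e: "vx (x - n + d) = vx (x - (n - d))" "vx (x - n) = vx x"
      using frame_period[OF fr, of "x - n"] by (simp_all add: algebra_simps)
    have "vx x \<notin> X \<or> vx (x - (n - d)) \<notin> X" using fX[of "x - (n - d)"] by auto
    moreover have "vx x \<notin> Y \<or> vx (x - (n - d)) \<notin> Y" using fY[of "x - (n - d)"] by auto
    moreover have "vx x \<notin> X \<or> vx (x - (n - d)) \<notin> Y"
      using straddling[OF fr X Y ne i, of "x - n"] e x by auto
    moreover have "vx x \<notin> Y \<or> vx (x - (n - d)) \<notin> X"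
      using straddling[OF fr Y X ne[symmetric], of "x - n"] i e x by auto
    ultimately show False using a x by auto
  qed
  show "x - 1 - (n - d) \<notin> pos vx Y" if "1 \<le> x" "x \<le> n - d + 1" "x \<in> pos vx X" for x
    using common_step[OF fr X Y ne, of x] common_step'[OF fr X Y ne, of x] that i
    by (cases "x \<le> n - d") (use d_le in auto)
  show "x - 1 - (n - d) \<notin> pos vx X" if "1 \<le> x" "x \<le> n - d + 1" "x \<in> pos vx Y" for x
    using common_step[OF fr Y X ne[symmetric], of x] common_step'[OF fr Y X ne[symmetric], of x] that i
    by (cases "x \<le> n - d") (use d_le in auto)
qed (use i fX fY mn d_le in auto)

end

section \<open>Sets without two elements at a fixed distance\<close>

locale free_set =
  fixes n m r :: int and A :: "int set"
  assumes periodic: "periodic_set n r A" and free: "x \<in> A \<Longrightarrow> x + m \<notin> A"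
    and n_pos: "0 < n"
begin

lemma per: "i + n \<in> A \<longleftrightarrow> i \<in> A"
  using periodic by (simp add: periodic_set_def)

lemma cong: "x mod n = y mod n \<Longrightarrow> x \<in> A \<longleftrightarrow> y \<in> A"
  using periodic_mod[of n A, OF per] by blast

lemma card_win: "int (card (A \<inter> {c..<c + n})) = r"
  using card_window[of n A, OF per n_pos] periodic by (simp add: periodic_set_def)

lemma free': "x \<in> A \<Longrightarrow> x - m \<notin> A"
  using free[of "x - m"] by auto

text \<open>The empty columns: a column is a pair \<open>x\<close>, \<open>x - m\<close>, named by
  its upper position.\<close>

definition defect :: "int set" where
  "defect = {x. x \<notin> A \<and> x - m \<notin> A}"

lemma defect_iff: "x \<in> defect \<longleftrightarrow> x \<notin> A \<and> x - m \<notin> A"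
  by (simp add: defect_def)

lemma defect_per: "i + n \<in> defect \<longleftrightarrow> i \<in> defect"
proof -
  have "i + n - m \<in> A \<longleftrightarrow> i - m \<in> A" using per[of "i - m"] by (simp add: algebra_simps)
  then show ?thesis using per[of i] by (simp add: defect_iff)
qed

lemma defect_cong: "x mod n = y mod n \<Longrightarrow> x \<in> defect \<longleftrightarrow> y \<in> defect"
  using periodic_mod[of n defect, OF defect_per] by blast

lemma card_shift: "card {x. x - m \<in> A \<and> x \<in> {c + m..<c + m + l}} = card (A \<inter> {c..<c + l})"
proof -
  have "{x. x - m \<in> A \<and> x \<in> {c + m..<c + m + l}} = (\<lambda>x. x + m) ` (A \<inter> {c..<c + l})"
  proof (intro equalityI subsetI)
    fix x assume "x \<in> {x. x - m \<in> A \<and> x \<in> {c + m..<c + m + l}}"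
    then have "x - m \<in> A \<inter> {c..<c + l}" "x = (x - m) + m" by auto
    then show "x \<in> (\<lambda>x. x + m) ` (A \<inter> {c..<c + l})" by blast
  qed auto
  then show ?thesis by (simp add: card_image)
qed

text \<open>For every \<open>x\<close> of the upper window exactly one of three things holds:
  \<open>x\<close> is in \<open>A\<close>, \<open>x - m\<close> is in \<open>A\<close>, or column
  \<open>x\<close> is empty.\<close>

lemma window_split:
  assumes "0 \<le> l"
  shows "int (card (A \<inter> {c..<c + l})) + int (card (A \<inter> {c + m..<c + m + l}))
    + int (card (defect \<inter> {c + m..<c + m + l})) = l"
proof -
  let ?W = "{c + m..<c + m + l}"
  let ?P = "{x. x - m \<in> A \<and> x \<in> ?W}"
  have W: "?W = (A \<inter> ?W) \<union> (?P \<union> (defect \<inter> ?W))" by (auto simp: defect_iff)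
  have d: "(A \<inter> ?W) \<inter> (?P \<union> (defect \<inter> ?W)) = {}" "?P \<inter> (defect \<inter> ?W) = {}"
    using free' by (auto simp: defect_iff)
  have "finite ?P" by (rule finite_subset[of _ ?W]) auto
  then have "card (?P \<union> (defect \<inter> ?W)) = card ?P + card (defect \<inter> ?W)"
    by (intro card_Un_disjoint d) auto
  moreover have "card ((A \<inter> ?W) \<union> (?P \<union> (defect \<inter> ?W))) = card (A \<inter> ?W) + card (?P \<union> (defect \<inter> ?W))"
    using \<open>finite ?P\<close> by (intro card_Un_disjoint d) auto
  ultimately have "card ?W = card (A \<inter> ?W) + (card ?P + card (defect \<inter> ?W))"
    using W by simp
  moreover have "card ?P = card (A \<inter> {c..<c + l})" by (rule card_shift)
  moreover have "int (card ?W) = l" using assms by simp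
  ultimately show ?thesis by simp
qed

lemma card_defect: "int (card (defect \<inter> {c..<c + n})) = n - 2 * r"
  using window_split[of n "c - m"] card_win[of "c - m"] card_win[of c] n_pos by simp

lemma defect_mod: "x \<in> defect \<Longrightarrow> x mod n \<in> defect \<inter> {0..<0 + n}"
  using defect_cong[of x "x mod n"] n_pos by simp

lemma defect_unique:
  assumes "n = 2 * r + 1" "x \<in> defect" "y \<in> defect"
  shows "x mod n = y mod n"
proof -
  have "card (defect \<inter> {0..<0 + n}) = 1" using card_defect[of 0] assms(1) by simp
  then show ?thesis using defect_mod assms(2,3) by (metis card_1_singletonE singletonD)
qed

lemma defect_two:
  assumes "n = 2 * r + 2" "x \<in> defect" "y \<in> defect" "z \<in> defect" "x mod n \<noteq> y mod n"
  shows "z mod n = x mod n \<or> z mod n = y mod n"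
proof (rule ccontr)
  assume neg: "\<not> ?thesis"
  have "card (defect \<inter> {0..<0 + n}) = 2" using card_defect[of 0] assms(1) by simp
  moreover have "{x mod n, y mod n, z mod n} \<subseteq> defect \<inter> {0..<0 + n}"
    using defect_mod assms(2-4) by blast
  then have "card {x mod n, y mod n, z mod n} \<le> card (defect \<inter> {0..<0 + n})"
    by (intro card_mono) auto
  ultimately show False using neg assms(5) by auto
qed

end

lemma card_nonadjacent:
  fixes S :: "int set"
  assumes "\<And>x. a < x \<Longrightarrow> x < b \<Longrightarrow> x \<in> S \<Longrightarrow> x - 1 \<notin> S" "a \<le> b"
  shows "2 * int (card (S \<inter> {a..<b})) \<le> b - a + 1"
proof -
  have "\<And>b. nat (b - a) = k \<Longrightarrow> a \<le> b \<Longrightarrow> (\<And>x. a < x \<Longrightarrow> x < b \<Longrightarrow> x \<in> S \<Longrightarrow> x - 1 \<notin> S) \<Longrightarrow>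
    2 * int (card (S \<inter> {a..<b})) \<le> b - a + 1" for k
  proof (induction k rule: less_induct)
    case (less k)
    show ?case
    proof (cases "b - a \<le> 1")
      case True
      then have "b = a \<or> b = a + 1" using less.prems by auto
      moreover have "{a..<a + 1} = {a}" by auto
      moreover have "card (S \<inter> {a}) \<le> 1" by (metis Int_lower2 card.empty card_insert_disjoint card_mono empty_iff finite.emptyI finite.insertI One_nat_def)
      ultimately show ?thesis by auto
    next
      case False
      have "S \<inter> {a..<b} = (S \<inter> {a..<b - 2}) \<union> (S \<inter> {b - 2, b - 1})" using False by auto
      moreover have "card (S \<inter> {b - 2, b - 1}) \<le> 1"
      proof (cases "b - 1 \<in> S")
        case True
        then have "b - 2 \<notin> S" using less.prems(3)[of "b - 1"] False by simp
        then have "S \<inter> {b - 2, b - 1} \<subseteq> {b - 1}" by auto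
        then show ?thesis using card_mono[of "{b - 1}"] by fastforce
      next
        case False
        then have "S \<inter> {b - 2, b - 1} \<subseteq> {b - 2}" by auto
        then show ?thesis using card_mono[of "{b - 2}"] by fastforce
      qed
      ultimately have "card (S \<inter> {a..<b}) \<le> card (S \<inter> {a..<b - 2}) + 1"
        using card_Un_le[of "S \<inter> {a..<b - 2}" "S \<inter> {b - 2, b - 1}"] by simp
      moreover have "2 * int (card (S \<inter> {a..<b - 2})) \<le> (b - 2) - a + 1"
        using False less.prems by (intro less.IH[of "nat (b - 2 - a)"]) auto
      ultimately show ?thesis by simp
    qed
  qed
  from this[of b "nat (b - a)"] show ?thesis using assms by simp
qed

lemma mod_neq:
  fixes n x y :: int
  assumes "x \<noteq> y" "\<bar>x - y\<bar> < n"
  shows "x mod n \<noteq> y mod n"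
  using mod_eq_close[of x n y] assms by auto

sublocale qpair \<subseteq> A: free_set n m r A
  by unfold_locales (use perA freeA m2 mn in auto)

sublocale qpair \<subseteq> B: free_set n m r B
  by unfold_locales (use perB freeB m2 mn in auto)

section \<open>How two free sets through 0 and 1 can differ\<close>

context qpair
begin

lemma swap: "qpair n m r B A"
  by unfold_locales (use perA perB freeA freeB in0 in1 straddle stepA stepB m2 mn in auto)

lemma n_gt: "m < n" using m2 mn by simp

lemma card_diff: "card ((B - A) \<inter> {c..<c + n}) = card ((A - B) \<inter> {c..<c + n})"
proof -
  let ?W = "{c..<c + n}"
  have "card (X \<inter> ?W) = card ((X - Y) \<inter> ?W) + card (X \<inter> Y \<inter> ?W)" for X Y :: "int set"
    by (subst card_Un_disjoint[symmetric]) (auto intro!: arg_cong[of _ _ card])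
  from this[of A B] this[of B A] show ?thesis
    using A.card_win[of c] B.card_win[of c] by (simp add: Int_commute)
qed

text \<open>The gained position \<open>z\<close> lies in the columns \<open>z\<close> and
  \<open>z + m\<close>. If one of them meets \<open>A\<close>, the element has moved inside that
  column, upwards in case 1 and downwards in case 2, and \<open>straddle\<close> confines the column
  to \<open>2..m - 1\<close>. Otherwise both columns are empty in \<open>A\<close>.\<close>

lemma kinds:
  assumes "z \<in> B" "z \<notin> A"
  obtains (1) x where "x mod n = z mod n" "2 \<le> x" "x \<le> m - 1" "x \<in> B" "x \<notin> A" "x - m \<in> A" "x - m \<notin> B" "x + m \<notin> A"
  | (2) x where "x mod n = z mod n" "2 \<le> x + m" "x + m \<le> m - 1" "x \<in> B" "x \<notin> A" "x + m \<in> A" "x + m \<notin> B" "x - m \<notin> A"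
  | (3) "z - m \<notin> A" "z + m \<notin> A"
proof -
  \<comment> \<open>The representative in \<open>1..n\<close>; from \<open>m + 1\<close> on
    \<open>straddle\<close> speaks about it.\<close>
  define y where "y = 1 + (z - 1) mod n"
  have ym: "y mod n = z mod n" by (simp add: y_def mod_simps)
  have yb: "1 \<le> y" "y \<le> n"
    using pos_mod_sign[OF A.n_pos, of "z - 1"] pos_mod_bound[OF A.n_pos, of "z - 1"] by (simp_all only: y_def)
  have y: "y \<in> B" "y \<notin> A" using assms A.cong[OF ym] B.cong[OF ym] by auto
  have c: "y - m \<in> A \<longleftrightarrow> z - m \<in> A" "y + m \<in> A \<longleftrightarrow> z + m \<in> A"
    by (rule A.cong; metis ym mod_diff_left_eq mod_add_left_eq)+
  show thesis
  proof (cases "y - m \<in> A")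
    case True
    have "y \<le> m" using straddle[of y] True y yb by fastforce
    moreover have "y \<noteq> 1" "y \<noteq> m" using y in1 in0 freeB[of 0] by auto
    moreover have "y + m \<notin> A" using straddle[of "y + m"] y yb \<open>y \<le> m\<close> mn by auto
    moreover have "y - m \<notin> B" using B.free'[OF y(1)] .
    ultimately show thesis using 1[OF ym] y yb True by auto
  next
    case False
    show thesis
    proof (cases "y + m \<in> A")
      case t: True
      have p: "X \<in> A \<longleftrightarrow> X - n \<in> A" "X \<in> B \<longleftrightarrow> X - n \<in> B" for X
        using A.per[of "X - n"] B.per[of "X - n"] by auto
      have yn: "n < y + m" using straddle[of "y + m"] y yb t by fastforce
      let ?x = "y - n"
      have x: "?x \<in> B" "?x \<notin> A" "?x + m \<in> A" "?x - m \<notin> A" using p[of y] p[of "y + m"] p[of "y - m"] y t False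
        by (simp_all add: algebra_simps)
      have "?x \<noteq> 0" using x in0 by auto
      moreover have "?x + m \<noteq> 1" using freeB[OF x(1)] in1 by auto
      ultimately show thesis using 2[of ?x] x yn yb ym freeB[OF x(1)] by auto
    next
      case f: False
      then show thesis using 3 False c by blast
    qed
  qed
qed

text \<open>Column \<open>x\<close> consists of the positions \<open>x\<close> and \<open>x - m\<close>. When no column in \<open>1..m\<close> is empty,
  the steps from column to column force a full run of \<open>m\<close> positions ending before \<open>z\<close>.\<close>

lemma run:
  assumes z: "2 \<le> z" "z \<le> m - 1" "z \<in> B" "z \<notin> A" "z - m \<in> A"
    and agree: "\<And>x. x mod n \<noteq> z mod n \<Longrightarrow> x mod n \<noteq> (z - m) mod n \<Longrightarrow> x \<in> A \<longleftrightarrow> x \<in> B"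
    and col: "\<And>x. 1 \<le> x \<Longrightarrow> x \<le> m \<Longrightarrow> x \<noteq> z \<Longrightarrow> x \<in> A \<or> x - m \<in> A"
  shows "{z - m..z - 1} \<subseteq> A"
proof -
  have ag: "x \<in> A \<longleftrightarrow> x \<in> B" if "\<bar>x - z\<bar> < n" "\<bar>x - (z - m)\<bar> < n" "x \<noteq> z" "x \<noteq> z - m" for x
    using agree[OF mod_neq mod_neq] that by blast
  have down: "z - 1 - int j \<in> A" if "1 \<le> z - 1 - int j" for j
    using that
  proof (induction j)
    case 0
    have "z - 1 - m \<notin> A" using stepB[of z] z by simp
    then show ?case using col[of "z - 1"] z by (simp add: algebra_simps)
  next
    case (Suc j)
    let ?x = "z - 1 - int j"
    have x: "?x \<in> A" using Suc by simp
    have "?x - 1 - m \<notin> B" using stepA[of ?x] x Suc.prems z by simp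
    then have "?x - 1 - m \<notin> A" using ag[of "?x - 1 - m"] Suc.prems z mn by auto
    then have "?x - 1 \<in> A" using col[of "?x - 1"] Suc.prems z by auto
    then show ?case by (simp add: algebra_simps)
  qed
  have up: "z - m + int j \<in> A" if "z + int j \<le> m" for j
    using that
  proof (induction j)
    case 0
    then show ?case using z by simp
  next
    case (Suc j)
    let ?x = "z + int j + 1"
    have "z - m + int j \<in> A" using Suc by simp
    then have "?x \<notin> B" using stepB[of ?x] Suc.prems z by (auto simp: algebra_simps)
    then have "?x \<notin> A" using ag[of ?x] Suc.prems z mn by auto
    then have "?x - m \<in> A" using col[of ?x] Suc.prems z by auto
    then show ?case by (simp add: algebra_simps)
  qed
  show ?thesis
  proof
    fix x assume x: "x \<in> {z - m..z - 1}"
    show "x \<in> A"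
    proof (cases "1 \<le> x")
      case True
      then show ?thesis using down[of "nat (z - 1 - x)"] x by simp
    next
      case False
      then show ?thesis using up[of "nat (x - (z - m))"] x by simp
    qed
  qed
qed

end

lemma (in free_set) mem_mod: "x mod n \<in> A \<longleftrightarrow> x \<in> A"
  by (rule cong) simp

context qpair
begin

lemma differ:
  assumes "A \<noteq> B"
  obtains z where "z \<in> B" "z \<notin> A"
proof -
  obtain x where x: "x \<in> A \<union> B" "\<not> (x \<in> A \<and> x \<in> B)" using assms by blast
  show thesis
  proof (cases "x \<in> B")
    case False
    then have "x mod n \<in> (A - B) \<inter> {0..<0 + n}"
      using x A.n_pos by (simp add: A.mem_mod B.mem_mod)
    then have "card ((A - B) \<inter> {0..<0 + n}) \<noteq> 0" by (metis card_0_eq empty_iff finite_Int finite_atLeastLessThan_int)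
    then have "(B - A) \<inter> {0..<0 + n} \<noteq> {}" using card_diff[of 0] by (metis card.empty)
    then show thesis using that by auto
  qed (use x that in auto)
qed

text \<open>Both sets have \<open>r\<close> elements per period, so a single gained position modulo
  \<open>n\<close> allows only a single lost one.\<close>

lemma diff_single:
  assumes "\<And>x. x \<in> B \<Longrightarrow> x \<notin> A \<Longrightarrow> x mod n = z mod n" "w \<in> A" "w \<notin> B" "y \<in> A" "y \<notin> B"
  shows "y mod n = w mod n"
proof (rule ccontr)
  assume ne: "y mod n \<noteq> w mod n"
  have "(B - A) \<inter> {0..<0 + n} \<subseteq> {z mod n}"
  proof
    fix x assume x: "x \<in> (B - A) \<inter> {0..<0 + n}"
    then have "x mod n = z mod n" using assms(1) by blast
    then show "x \<in> {z mod n}" using x by simp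
  qed
  then have "card ((B - A) \<inter> {0..<0 + n}) \<le> 1" using card_mono[of "{z mod n}"] by fastforce
  moreover have "{w mod n, y mod n} \<subseteq> (A - B) \<inter> {0..<0 + n}"
    using assms(2-5) A.n_pos by (simp add: A.mem_mod B.mem_mod)
  then have "card {w mod n, y mod n} \<le> card ((A - B) \<inter> {0..<0 + n})" by (intro card_mono) auto
  ultimately show False using ne card_diff[of 0] by simp
qed

text \<open>Column \<open>x + m\<close> is empty in \<open>A\<close>, hence the only empty one for
  odd \<open>n\<close>. Any other gained position would bring an empty column of its own, so the
  sets differ only at \<open>x\<close> and \<open>x - m\<close>; and the columns \<open>1..m\<close>
  are full, as \<open>run\<close> requires.\<close>

lemma odd_flip_one:
  assumes odd: "n = 2 * r + 1"
    and x: "2 \<le> x" "x \<le> m - 1" "x \<in> B" "x \<notin> A" "x - m \<in> A" "x + m \<notin> A"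
  shows "{x - m..x - 1} \<subseteq> A"
    and "\<And>y. y mod n \<noteq> x mod n \<Longrightarrow> y mod n \<noteq> (x - m) mod n \<Longrightarrow> y \<in> A \<longleftrightarrow> y \<in> B"
proof -
  have dx: "x + m \<in> A.defect" using x by (simp add: A.defect_iff)
  have xm: "x + m \<notin> B" "x - m \<notin> B" using x freeB B.free' by auto
  have single: "y mod n = x mod n" if "y \<in> B" "y \<notin> A" for y
    using that
  proof (cases rule: kinds)
    case (1 z)
    then have "z + m \<in> A.defect" by (simp add: A.defect_iff)
    then have "(z + m) mod n = (x + m) mod n" by (rule A.defect_unique[OF odd _ dx])
    then have "z mod n = x mod n" by (simp add: mod_eq_dvd_iff)
    then show ?thesis using 1 by simp
  next
    case (2 z)
    then have "z \<in> A.defect" by (simp add: A.defect_iff)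
    then have "z mod n = (x + m) mod n" by (rule A.defect_unique[OF odd _ dx])
    then show ?thesis using B.cong[of z "x + m"] 2 xm by simp
  next
    case 3
    then have "y \<in> A.defect" "y + m \<in> A.defect" using that by (auto simp: A.defect_iff)
    then have "y mod n = (y + m) mod n" by (rule A.defect_unique[OF odd])
    then show ?thesis using mod_neq[of y "y + m" n] m2 n_gt by simp
  qed
  show ag: "y \<in> A \<longleftrightarrow> y \<in> B" if "y mod n \<noteq> x mod n" "y mod n \<noteq> (x - m) mod n" for y
    using single[of y] diff_single[OF single x(5) xm(2), of y] that by blast
  show "{x - m..x - 1} \<subseteq> A"
  proof (rule run[OF x(1-5) ag])
    fix y assume y: "1 \<le> y" "y \<le> m" "y \<noteq> x"
    have "y \<notin> A.defect"
      using A.defect_unique[OF odd _ dx, of y] mod_neq[of y "x + m" n] y x mn by auto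
    then show "y \<in> A \<or> y - m \<in> A" by (simp add: A.defect_iff)
  qed
qed

end

lemma (in qpair) odd_flip:
  assumes odd: "n = 2 * r + 1" and ne: "A \<noteq> B"
  obtains z where "2 \<le> z" "z \<le> m - 1" "z \<in> B" "z \<notin> A" "z - m \<in> A" "z - m \<notin> B" "{z - m..z - 1} \<subseteq> A"
    "\<And>y. y mod n \<noteq> z mod n \<Longrightarrow> y mod n \<noteq> (z - m) mod n \<Longrightarrow> y \<in> A \<longleftrightarrow> y \<in> B"
  | z where "2 \<le> z" "z \<le> m - 1" "z \<in> A" "z \<notin> B" "z - m \<in> B" "z - m \<notin> A" "{z - m..z - 1} \<subseteq> B"
    "\<And>y. y mod n \<noteq> z mod n \<Longrightarrow> y mod n \<noteq> (z - m) mod n \<Longrightarrow> y \<in> A \<longleftrightarrow> y \<in> B"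
proof -
  obtain y where y: "y \<in> B" "y \<notin> A" using differ[OF ne] .
  then show thesis
  proof (cases rule: kinds)
    case (1 x)
    show thesis
      by (rule that(1)[of x]) (use 1 odd_flip_one[OF odd 1(2-6,8)] in auto)
  next
    case (2 x)
    let ?z = "x + m"
    have dx: "x \<in> A.defect" using 2 by (simp add: A.defect_iff)
    \<comment> \<open>This is the last hypothesis of \<open>odd_flip_one\<close> after the exchange
      of \<open>A\<close> and \<open>B\<close>. An element of \<open>B\<close> there would be a
      gained one, and each of its kinds conflicts with \<open>x\<close> being the only empty column
      of \<open>A\<close> or with \<open>?z\<close> being in \<open>A\<close>.\<close>
    have zB: "?z + m \<notin> B"
    proof
      assume b: "?z + m \<in> B"
      have "?z + m \<notin> A" using 2 freeA by blast
      with b show False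
      proof (cases rule: kinds)
        case (1 w)
        then have "w + m \<in> A.defect" by (simp add: A.defect_iff)
        then have "(w + m) mod n = x mod n" by (rule A.defect_unique[OF odd _ dx])
        then show False using B.cong 1 2 freeB by blast
      next
        case w: (2 w)
        then have "w \<in> A.defect" by (simp add: A.defect_iff)
        then have "w mod n = x mod n" by (rule A.defect_unique[OF odd _ dx])
        then have "(x + 2 * m) mod n = x mod n" using w(1) by (simp add: algebra_simps)
        moreover have "2 * m < n" using mn odd by presburger
        ultimately show False using mod_neq[of "x + 2 * m" x n] m2 by auto
      next
        case 3
        then show False using 2 by (simp add: add.commute)
      qed
    qed
    interpret s: qpair n m r B A by (rule swap)
    have b: "?z - m \<in> B" "?z - m \<notin> A" using 2 by simp_all
    note one = s.odd_flip_one[OF odd 2(2,3,6,7) b(1) zB]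
    show thesis
      by (rule that(2)[OF 2(2,3,6,7) b one(1)]) (use one(2) in blast)
  next
    case 3
    then have "y \<in> A.defect" "y + m \<in> A.defect" using y by (auto simp: A.defect_iff)
    then have "y mod n = (y + m) mod n" by (rule A.defect_unique[OF odd])
    then show thesis using mod_neq[of y "y + m" n] m2 n_gt by simp
  qed
qed

text \<open>Two edges outside the cycle may be cut at any position \<open>z\<close>, not just
  between 0 and 1. For even \<open>n\<close> there are two empty columns, and this further
  information controls them.\<close>

locale qpair_full = qpair +
  assumes crossA: "y \<in> A \<Longrightarrow> y - m \<in> B \<Longrightarrow> y < z \<Longrightarrow> z \<le> y + n - m \<Longrightarrow> z \<in> A \<Longrightarrow> z - 1 \<notin> B"
    and crossB: "y \<in> B \<Longrightarrow> y - m \<in> A \<Longrightarrow> y < z \<Longrightarrow> z \<le> y + n - m \<Longrightarrow> z \<in> B \<Longrightarrow> z - 1 \<notin> A"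
    and even: "n = 2 * r + 2" and m_lt: "2 * m < n" and ne: "A \<noteq> B"
begin

lemma swap_full: "qpair_full n m r B A"
  by (intro qpair_full.intro swap, unfold_locales) (use crossA crossB even m_lt ne in auto)

text \<open>On two adjacent windows of length \<open>m\<close> the set \<open>A\<close> has
  \<open>m\<close> elements minus its empty columns, and on the remaining positions
  \<open>crossB\<close> forbids adjacent elements. The total \<open>r\<close> then leaves no empty
  column in \<open>z..z + m - 1\<close>. The same count for \<open>B\<close>, on shifted windows,
  handles the columns \<open>z - m + 1..z\<close>.\<close>

lemma full_columns_one:
  assumes z: "2 \<le> z" "z \<le> m - 1" "z \<in> B" "z \<notin> A" "z - m \<in> A" "z + m \<notin> A"
    and single: "\<And>x. x \<in> B \<Longrightarrow> x \<notin> A \<Longrightarrow> x mod n = z mod n"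
    and y: "1 \<le> y" "y \<le> m"
  shows "y \<in> A \<or> y - m \<in> A" "y \<in> B \<or> y - m \<in> B"
proof -
  have n4: "2 * m + 2 \<le> n" using m_lt even by presburger
  have zm: "z - m \<notin> B" using z B.free' by auto
  have ag: "x \<in> A \<longleftrightarrow> x \<in> B" if "\<bar>x - z\<bar> < n" "\<bar>x - (z - m)\<bar> < n" "x \<noteq> z" "x \<noteq> z - m" for x
    using single[of x] diff_single[OF single z(5) zm, of x] mod_neq that by blast
  have z1: "z + 1 \<notin> B" using stepB[of "z + 1"] z by auto
  have z1': "z - 1 - m \<notin> A" using stepB[of z] z by auto
  have z2: "z - 2 * m \<notin> B"
    using A.free'[OF z(5)] ag[of "z - 2 * m"] n4 m2 by (auto simp: algebra_simps)
  have cr: "x - 1 \<notin> A" if "z < x" "x \<le> z + n - m" "x \<in> B" for x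
    using crossB[OF z(3,5) that] .
  let ?c = "\<lambda>S a b. int (card (S \<inter> {a..<b}))"
  have split: "?c S a b = ?c S a u + ?c S u b" if "a \<le> u" "u \<le> b" for S :: "int set" and a b u
  proof -
    have "S \<inter> {a..<b} = (S \<inter> {a..<u}) \<union> (S \<inter> {u..<b})" using that by auto
    moreover have "card ((S \<inter> {a..<u}) \<union> (S \<inter> {u..<b})) = card (S \<inter> {a..<u}) + card (S \<inter> {u..<b})"
      by (rule card_Un_disjoint) auto
    ultimately show ?thesis by simp
  qed
  have "?c A (z - m) z + ?c A z (z + m) + ?c A.defect z (z + m) = m"
    using A.window_split[of m "z - m"] m2 by simp
  moreover have "?c A (z - m) (z - m + n) = r" by (rule A.card_win)
  moreover have "?c A (z - m) (z - m + n) = ?c A (z - m) z + ?c A z (z + m) + ?c A (z + m) (z - m + n)"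
    using split[of "z - m" z "z - m + n" A] split[of z "z + m" "z - m + n" A] n4 m2 by simp
  \<comment> \<open>Both ends of the remaining range are unoccupied; without them the bound for
    nonadjacent elements is just small enough.\<close>
  moreover have "?c A (z + m) (z - m + n) = ?c A (z + m + 1) (z - m + n - 1)"
  proof -
    have "z - m + n - 1 \<notin> A" using z1' A.per[of "z - 1 - m"] by (simp add: algebra_simps)
    then have "x \<noteq> z - m + n - 1 \<and> x \<noteq> z + m" if "x \<in> A" for x using that z(6) by blast
    then have "A \<inter> {z + m..<z - m + n} = A \<inter> {z + m + 1..<z - m + n - 1}" using n4 by force
    then show ?thesis by simp
  qed
  moreover have "2 * ?c A (z + m + 1) (z - m + n - 1) \<le> (z - m + n - 1) - (z + m + 1) + 1"
  proof (rule card_nonadjacent)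
    fix x assume x: "z + m + 1 < x" "x < z - m + n - 1" "x \<in> A"
    then have "x \<in> B" using ag[of x] m2 by auto
    then show "x - 1 \<notin> A" using cr[of x] x m2 by auto
  qed (use n4 in auto)
  ultimately have "?c A.defect z (z + m) = 0" using even by linarith
  then have dA: "x \<notin> A.defect" if "z \<le> x" "x < z + m" for x using that by auto
  have "?c B (z - 2 * m + 1) (z - m + 1) + ?c B (z - m + 1) (z + 1) + ?c B.defect (z - m + 1) (z + 1) = m"
    using B.window_split[of m "z - 2 * m + 1"] m2 by (simp add: algebra_simps)
  moreover have "?c B (z - 2 * m + 1) (z - 2 * m + 1 + n) = r" by (rule B.card_win)
  moreover have "?c B (z - 2 * m + 1) (z - 2 * m + 1 + n) =
      ?c B (z - 2 * m + 1) (z - m + 1) + ?c B (z - m + 1) (z + 1) + ?c B (z + 1) (z - 2 * m + 1 + n)"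
    using split[of "z - 2 * m + 1" "z - m + 1" "z - 2 * m + 1 + n" B]
      split[of "z - m + 1" "z + 1" "z - 2 * m + 1 + n" B] n4 m2 by simp
  moreover have "?c B (z + 1) (z - 2 * m + 1 + n) = ?c B (z + 2) (z - 2 * m + n)"
  proof -
    have "z - 2 * m + n \<notin> B" using z2 B.per[of "z - 2 * m"] by simp
    then have "x \<noteq> z - 2 * m + n \<and> x \<noteq> z + 1" if "x \<in> B" for x using that z1 by blast
    then have "B \<inter> {z + 1..<z - 2 * m + 1 + n} = B \<inter> {z + 2..<z - 2 * m + n}" using n4 by force
    then show ?thesis by simp
  qed
  moreover have "2 * ?c B (z + 2) (z - 2 * m + n) \<le> (z - 2 * m + n) - (z + 2) + 1"
  proof (rule card_nonadjacent)
    fix x assume x: "z + 2 < x" "x < z - 2 * m + n" "x \<in> B"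
    then have "x - 1 \<notin> A" using cr[of x] m2 by auto
    then show "x - 1 \<notin> B" using ag[of "x - 1"] x m2 by auto
  qed (use n4 in auto)
  ultimately have "?c B.defect (z - m + 1) (z + 1) = 0" using even by linarith
  then have dB: "x \<notin> B.defect" if "z - m + 1 \<le> x" "x < z + 1" for x using that by auto
  have both: "(y \<in> A \<longleftrightarrow> y \<in> B) \<and> (y - m \<in> A \<longleftrightarrow> y - m \<in> B)" if "y \<noteq> z"
    using ag[of y] ag[of "y - m"] that y z n4 by auto
  have "(y \<in> A \<or> y - m \<in> A) \<and> (y \<in> B \<or> y - m \<in> B)"
  proof (cases y z rule: linorder_cases)
    case less
    then show ?thesis using dB[of y] both y z by (auto simp: B.defect_iff)
  next
    case equal
    then show ?thesis using z by auto
  next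
    case greater
    then show ?thesis using dA[of y] both y z by (auto simp: A.defect_iff)
  qed
  then show "y \<in> A \<or> y - m \<in> A" "y \<in> B \<or> y - m \<in> B" by auto
qed

end

context qpair
begin

text \<open>\<open>z\<close> and \<open>z + m\<close> are the two empty columns of \<open>A\<close>,
  so every gained position is congruent to \<open>z\<close>. This one element fills both of them,
  and the union meets each column exactly once.\<close>

lemma ideal_union:
  assumes even: "n = 2 * r + 2" and z: "z \<in> B" "z \<notin> A" "z - m \<notin> A" "z + m \<notin> A"
  shows "\<And>y. y \<in> B \<Longrightarrow> y \<notin> A \<Longrightarrow> y mod n = z mod n"
    and "\<And>x. x \<in> A \<union> B \<Longrightarrow> x + m \<notin> A \<union> B"
    and "\<And>x. x \<notin> A \<union> B \<Longrightarrow> x + m \<in> A \<union> B"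
proof -
  have dz: "z \<in> A.defect" "z + m \<in> A.defect" using z by (auto simp: A.defect_iff)
  have nz: "z mod n \<noteq> (z + m) mod n" using mod_neq[of z "z + m" n] m2 n_gt by simp
  note two = A.defect_two[OF even dz _ nz]
  have bm: "w mod n \<noteq> (u + m) mod n" if "w \<in> B" "u \<in> B" for u w
    using that freeB B.cong by blast
  show single: "y mod n = z mod n" if y: "y \<in> B" "y \<notin> A" for y
    using y
  proof (cases rule: kinds)
    case (1 x)
    then have "x + m \<in> A.defect" by (simp add: A.defect_iff)
    then have "(x + m) mod n = z mod n \<or> (x + m) mod n = (z + m) mod n" by (rule two)
    moreover have "(x + m) mod n \<noteq> z mod n" using bm[OF z(1) 1(4)] by metis
    ultimately have "x mod n = z mod n" by (simp add: mod_eq_dvd_iff)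
    then show ?thesis using 1 by simp
  next
    case (2 x)
    then have "x \<in> A.defect" by (simp add: A.defect_iff)
    then have "x mod n = z mod n \<or> x mod n = (z + m) mod n" by (rule two)
    then show ?thesis using bm[OF 2(4) z(1)] 2(1) by simp
  next
    case 3
    then have "y \<in> A.defect" using y by (simp add: A.defect_iff)
    then have "y mod n = z mod n \<or> y mod n = (z + m) mod n" by (rule two)
    then show ?thesis using bm[OF y(1) z(1)] by simp
  qed
  show "x + m \<notin> A \<union> B" if x: "x \<in> A \<union> B" for x
  proof
    assume xm: "x + m \<in> A \<union> B"
    show False
    proof (cases "x \<in> A")
      case True
      then have "x + m \<in> B" "x + m \<notin> A" using xm freeA by auto
      then have "(x + m) mod n = z mod n" by (rule single)
      then have "x mod n = (z - m) mod n" by (metis add_diff_cancel_right' mod_diff_left_eq)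
      then show False using True z A.cong by blast
    next
      case False
      then have "x \<in> B" "x + m \<in> A" using x xm freeB by auto
      moreover have "(x + m) mod n = (z + m) mod n"
        using single[of x] False calculation by (metis mod_add_left_eq)
      ultimately show False using z A.cong by blast
    qed
  qed
  show "x + m \<in> A \<union> B" if x: "x \<notin> A \<union> B" for x
  proof (rule ccontr)
    assume "x + m \<notin> A \<union> B"
    then have "x + m \<in> A.defect" using x by (simp add: A.defect_iff)
    then have "(x + m) mod n = z mod n \<or> (x + m) mod n = (z + m) mod n" by (rule two)
    then have "(x + m) mod n = z mod n \<or> x mod n = z mod n" by (simp add: mod_eq_dvd_iff)
    then show False using \<open>x + m \<notin> A \<union> B\<close> x z B.cong by blast
  qed
qed

end

section \<open>Even n: sets that differ only by moves inside columns\<close>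

context qpair_full
begin

text \<open>As in \<open>run\<close>, full columns hand membership downwards, now alternating
  between \<open>A\<close> and \<open>B\<close>. The tops differ in at most two of the columns, so
  from \<open>p - 2\<close> down to 1 both sets contain everything; above \<open>p\<close> the tops
  are missing in \<open>B\<close>, which puts the bottoms into \<open>B\<close>.\<close>

lemma run_of_columns:
  assumes colA: "\<And>y. 1 \<le> y \<Longrightarrow> y \<le> m \<Longrightarrow> y \<in> A \<or> y - m \<in> A"
    and colB: "\<And>y. 1 \<le> y \<Longrightarrow> y \<le> m \<Longrightarrow> y \<in> B \<or> y - m \<in> B"
    and two: "\<And>u v w. 1 \<le> u \<Longrightarrow> u < v \<Longrightarrow> v < w \<Longrightarrow> w \<le> m \<Longrightarrow>
      (u \<in> A \<longleftrightarrow> u \<in> B) \<or> (v \<in> A \<longleftrightarrow> v \<in> B) \<or> (w \<in> A \<longleftrightarrow> w \<in> B)"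
    and p: "1 \<le> p" "p \<le> m" "p \<in> A" "p \<notin> B" and top: "\<And>y. p < y \<Longrightarrow> y \<le> m \<Longrightarrow> y \<notin> B"
  shows "{p - m..p - 1} \<subseteq> B"
proof -
  have p2: "2 \<le> p" using p in1 by (cases "p = 1") auto
  have AB: "y - 1 \<in> B" if "2 \<le> y" "y \<le> m" "y \<in> A" for y
    using stepA[of y] colB[of "y - 1"] that by auto
  have BA: "y - 1 \<in> A" if "2 \<le> y" "y \<le> m" "y \<in> B" for y
    using stepB[of y] colA[of "y - 1"] that by auto
  have p1: "p - 1 \<in> B" using AB[of p] p p2 by auto
  have down: "p - 2 - int j \<in> A \<and> p - 2 - int j \<in> B" if "1 \<le> p - 2 - int j" for j
    using that
  proof (induction j)
    case 0
    have a: "p - 2 \<in> A" using BA[of "p - 1"] p1 p 0 by simp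
    moreover have "p - 2 \<in> B"
    proof (cases "p - 1 \<in> A")
      case True
      then show ?thesis using AB[of "p - 1"] p 0 by simp
    next
      case False
      then show ?thesis using two[of "p - 2" "p - 1" p] a p p1 0 by auto
    qed
    ultimately show ?case by simp
  next
    case (Suc j)
    have e: "p - 2 - int (Suc j) = (p - 2 - int j) - 1" by simp
    have "p - 2 - int j \<in> A \<and> p - 2 - int j \<in> B" using Suc by simp
    then show ?case unfolding e using AB[of "p - 2 - int j"] BA[of "p - 2 - int j"] Suc.prems p by simp
  qed
  show ?thesis
  proof
    fix x assume x: "x \<in> {p - m..p - 1}"
    consider "x = p - 1" | "1 \<le> x" "x \<le> p - 2" | "x < 1" using x by fastforce
    then show "x \<in> B"
    proof cases
      case 2
      then show ?thesis using down[of "nat (p - 2 - x)"] by simp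
    next
      case 3
      have "x + m \<notin> B" using top[of "x + m"] p x 3 by (cases "x + m = p") auto
      then show ?thesis using colB[of "x + m"] x p 3 by auto
    qed (use p1 in simp)
  qed
qed

text \<open>A run of \<open>m\<close> positions empties the \<open>m\<close> positions on either
  side of it. Beyond these \<open>B\<close> lies inside \<open>A\<close>, and \<open>crossA\<close>
  at \<open>y = p\<close> forbids adjacent elements. If \<open>n\<close> exceeds
  \<open>2 * m + 2\<close>, the remaining \<open>r - m\<close> elements of \<open>B\<close> do not
  fit.\<close>

lemma interval_of_run:
  assumes p: "1 \<le> p" "p \<le> m" "p \<in> A" "p \<notin> B" and run: "{p - m..p - 1} \<subseteq> B" and m3: "3 \<le> m"
    and inrun: "\<And>z. z \<in> B \<Longrightarrow> z \<notin> A \<Longrightarrow> \<exists>w\<in>{p - m..p - 1}. z mod n = w mod n"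
  shows "n = 2 * m + 2" "B \<inter> {p - m..<p - m + n} = {p - m..<p}"
proof -
  have n2: "2 * m + 2 \<le> n" using m_lt even by presburger
  have pm: "p - m \<in> B" using run m2 by auto
  have out: "z \<in> A" if zz: "z \<in> B" "p \<le> z" "z < p - m + n" for z
  proof (rule ccontr)
    assume "z \<notin> A"
    then obtain w where w: "w \<in> {p - m..p - 1}" "z mod n = w mod n" using inrun zz by blast
    then show False using mod_neq[of z w n] zz by auto
  qed
  have zer: "x \<notin> B" if "p \<le> x" "x \<le> p + m - 1" for x
  proof -
    have "x - m \<in> B" using run that by auto
    then show ?thesis using freeB[of "x - m"] by auto
  qed
  have zer': "x \<notin> B" if "p - 2 * m + n \<le> x" "x \<le> p - m - 1 + n" for x
  proof -
    have "x - n + m \<in> B" using run that by auto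
    then have "x - n \<notin> B" using freeB by auto
    then show ?thesis using B.per[of "x - n"] by simp
  qed
  have pm': "p + m \<notin> B" using out[of "p + m"] freeA[OF p(3)] n2 m2 by auto
  let ?c = "\<lambda>S a b. int (card (S \<inter> {a..<b}))"
  have "B \<inter> {p - m..<p - m + n} = {p - m..<p} \<union> (B \<inter> {p + m + 1..<p - m + n})"
  proof (intro equalityI subsetI)
    fix x assume x: "x \<in> B \<inter> {p - m..<p - m + n}"
    then have "x < p \<or> p + m \<le> x" using zer[of x] by force
    then show "x \<in> {p - m..<p} \<union> (B \<inter> {p + m + 1..<p - m + n})" using x pm' by (cases "x = p + m") auto
  next
    fix x assume "x \<in> {p - m..<p} \<union> (B \<inter> {p + m + 1..<p - m + n})"
    then show "x \<in> B \<inter> {p - m..<p - m + n}" using run n2 m2 by auto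
  qed
  note dec = this
  have "card ({p - m..<p} \<union> (B \<inter> {p + m + 1..<p - m + n})) = card {p - m..<p} + card (B \<inter> {p + m + 1..<p - m + n})"
    by (rule card_Un_disjoint) (use m2 in auto)
  then have cnt: "?c B (p + m + 1) (p - m + n) = r - m" using dec B.card_win[of "p - m"] m2 by simp
  show "n = 2 * m + 2"
  proof (rule ccontr)
    assume "n \<noteq> 2 * m + 2"
    then have n4: "2 * m + 4 \<le> n" using n2 even by presburger
    \<comment> \<open>Of the \<open>m\<close> empty positions before the next copy of the run, the
      last three are enough for the count; this is the use of \<open>3 <= m\<close>.\<close>
    have "x < p - m + n - 3" if "x \<in> B" "x < p - m + n" for x
      using zer'[of x] that m3 by linarith
    then have "B \<inter> {p + m + 1..<p - m + n} = B \<inter> {p + m + 1..<p - m + n - 3}" by auto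
    moreover have "2 * ?c B (p + m + 1) (p - m + n - 3) \<le> (p - m + n - 3) - (p + m + 1) + 1"
    proof (rule card_nonadjacent)
      fix x assume x: "p + m + 1 < x" "x < p - m + n - 3" "x \<in> B"
      then have "x \<in> A" using out[of x] m2 by auto
      then show "x - 1 \<notin> B" using crossA[OF p(3) pm, of x] x m2 by auto
    qed (use n4 in auto)
    ultimately have "2 * (r - m) \<le> n - 2 * m - 3" using cnt by simp
    then show False using even by simp
  qed
  then have "r = m" using even by simp
  then have "card (B \<inter> {p + m + 1..<p - m + n}) = 0" using cnt by simp
  then have "B \<inter> {p + m + 1..<p - m + n} = {}" by (metis card_0_eq finite_Int finite_atLeastLessThan_int)
  then show "B \<inter> {p - m..<p - m + n} = {p - m..<p}" using dec by blast
qed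

text \<open>Excludes the third case of \<open>kinds\<close>: every gained element comes from a
  partner in one of its columns.\<close>

definition flips :: bool where
  "flips \<longleftrightarrow> (\<forall>z. z \<in> B \<longrightarrow> z \<notin> A \<longrightarrow> z - m \<in> A \<or> z + m \<in> A)"

lemma flip_kinds:
  assumes "flips" "z \<in> B" "z \<notin> A"
  obtains (1) x where "x mod n = z mod n" "2 \<le> x" "x \<le> m - 1" "x \<in> B" "x \<notin> A" "x - m \<in> A" "x - m \<notin> B" "x + m \<notin> A"
  | (2) x where "x mod n = z mod n" "2 \<le> x + m" "x + m \<le> m - 1" "x \<in> B" "x \<notin> A" "x + m \<in> A" "x + m \<notin> B" "x - m \<notin> A"
  using assms(2,3)
proof (cases rule: kinds)
  case 3
  then show thesis using assms by (auto simp: flips_def)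
qed (use that in auto)

text \<open>If the exchanged pair had a position of the third kind, \<open>ideal_union\<close> would
  make the union free, and then no gained position of \<open>B\<close> could have a partner in
  \<open>A\<close>.\<close>

lemma flips_swap:
  assumes "flips"
  shows "qpair_full.flips m B A"
proof -
  interpret s: qpair_full n m r B A by (rule swap_full)
  show ?thesis
    unfolding s.flips_def
  proof (intro allI impI, rule ccontr)
    fix z assume z: "z \<in> A" "z \<notin> B" and "\<not> (z - m \<in> B \<or> z + m \<in> B)"
    then have u: "x + m \<notin> A \<union> B" if "x \<in> A \<union> B" for x
      using s.ideal_union(2)[OF even, of z x] that by auto
    obtain w where w: "w \<in> B" "w \<notin> A" using differ[OF ne] .
    then have "w - m \<in> A \<or> w + m \<in> A" using assms by (auto simp: flips_def)
    then show False using u[of w] u[of "w - m"] w by auto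
  qed
qed

lemma flip_defect:
  assumes "flips" "z \<in> B" "z \<notin> A"
  shows "z \<in> A.defect \<or> z + m \<in> A.defect"
  using assms
proof (cases rule: flip_kinds)
  case (1 x)
  then have "x + m \<in> A.defect" by (simp add: A.defect_iff)
  moreover have "(x + m) mod n = (z + m) mod n" using 1(1) by (metis mod_add_left_eq)
  ultimately show ?thesis using A.defect_cong by blast
next
  case (2 x)
  then have "x \<in> A.defect" by (simp add: A.defect_iff)
  then show ?thesis using A.defect_cong 2(1) by blast
qed

text \<open>Each gained position owns an empty column of \<open>A\<close>, either \<open>z\<close>
  or \<open>z + m\<close>. Freeness of \<open>B\<close> keeps these columns distinct modulo
  \<open>n\<close>, and \<open>A\<close> has just two.\<close>

lemma at_most_two:
  assumes "flips" "u \<in> B - A" "v \<in> B - A" "w \<in> B - A"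
    "u mod n \<noteq> v mod n" "v mod n \<noteq> w mod n" "u mod n \<noteq> w mod n"
  shows False
proof -
  define f where "f z = (if z \<in> A.defect then z else z + m)" for z
  have fd: "f z \<in> A.defect" if "z \<in> B - A" for z
    using flip_defect[OF assms(1), of z] that by (auto simp: f_def)
  have fn: "f x mod n \<noteq> f y mod n" if "x \<in> B - A" "y \<in> B - A" "x mod n \<noteq> y mod n" for x y
  proof -
    have "x mod n \<noteq> (y + m) mod n" "(x + m) mod n \<noteq> y mod n" using that freeB B.cong by blast+
    moreover have "(x + m) mod n \<noteq> (y + m) mod n" using that(3) by (simp add: mod_eq_dvd_iff)
    ultimately show ?thesis using that(3) by (simp add: f_def)
  qed
  have "f w mod n = f u mod n \<or> f w mod n = f v mod n"
    by (rule A.defect_two[OF even fd fd fd fn]) (use assms in auto)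
  then show False using fn assms by metis
qed

lemma column_witness:
  assumes "flips" and colB: "y \<in> B \<or> y - m \<in> B" and y: "(y \<in> A) \<noteq> (y \<in> B)"
  shows "\<exists>w\<in>{y, y - m}. w \<in> B - A"
  using colB y A.free'[of y] by auto

text \<open>Two gained positions use up both empty columns of \<open>A\<close>, and by
  \<open>flip_kinds\<close> neither of those is among \<open>1..m\<close>. If column
  \<open>y\<close> were empty in \<open>B\<close>, its element of \<open>A\<close> would be lost,
  and its partner in the other column would be a gained position that violates
  \<open>flip_kinds\<close>.\<close>

lemma columns_two:
  assumes fl: "flips" and z: "u \<in> B - A" "v \<in> B - A" "u mod n \<noteq> v mod n" and y: "1 \<le> y" "y \<le> m"
  shows "y \<in> A \<or> y - m \<in> A" "y \<in> B \<or> y - m \<in> B"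
proof -
  have far: "\<not> (t \<in> A.defect \<and> y mod n = t mod n \<and> w mod n \<in> {t mod n, (t - m) mod n})"
    if w: "w \<in> B - A" for t w
  proof
    assume t: "t \<in> A.defect \<and> y mod n = t mod n \<and> w mod n \<in> {t mod n, (t - m) mod n}"
    then have dy: "y \<notin> A" "y - m \<notin> A" using A.defect_cong[of y t] by (auto simp: A.defect_iff)
    have ym: "(y - m) mod n = (t - m) mod n" using t by (metis mod_diff_left_eq)
    have "w \<in> B" "w \<notin> A" using w by auto
    with fl show False
    proof (cases rule: flip_kinds)
      case (1 x)
      consider "x mod n = y mod n" | "x mod n = (y - m) mod n" using 1(1) t ym by auto
      then show False
      proof cases
        case 1
        then have "x = y" using mod_neq[of x y n] \<open>2 \<le> x\<close> \<open>x \<le> m - 1\<close> y n_gt by auto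
        then show False using dy \<open>x - m \<in> A\<close> by simp
      next
        case 2
        then show False using mod_neq[of x "y - m" n] \<open>2 \<le> x\<close> \<open>x \<le> m - 1\<close> y mn by auto
      qed
    next
      case (2 x)
      consider "x mod n = y mod n" | "x mod n = (y - m) mod n" using 2(1) t ym by auto
      then show False
      proof cases
        case 1
        then show False using mod_neq[of x y n] 2 y mn by auto
      next
        case c: 2
        then have "x = y - m" using mod_eq_close[of x n "y - m"] 2 y n_gt by auto
        then show False using dy 2 by simp
      qed
    qed
  qed
  show cA: "y \<in> A \<or> y - m \<in> A"
  proof (rule ccontr)
    assume "\<not> ?thesis"
    then have dy: "y \<in> A.defect" by (simp add: A.defect_iff)
    have um: "u mod n \<noteq> (v + m) mod n" "(u + m) mod n \<noteq> v mod n" using z freeB B.cong by blast+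
    obtain s where s: "s \<in> {u, u + m}" "s \<in> A.defect" using flip_defect[OF fl, of u] z by auto
    obtain t where t: "t \<in> {v, v + m}" "t \<in> A.defect" using flip_defect[OF fl, of v] z by auto
    have "(u + m) mod n \<noteq> (v + m) mod n" using z(3) by (simp add: mod_eq_dvd_iff)
    then have "s mod n \<noteq> t mod n" using s t um z(3) by auto
    from A.defect_two[OF even s(2) t(2) dy this] show False
      using far[OF z(1), of s] far[OF z(2), of t] s t by auto
  qed
  show "y \<in> B \<or> y - m \<in> B"
  proof (rule ccontr)
    assume neg: "\<not> ?thesis"
    interpret s: qpair_full n m r B A by (rule swap_full)
    have sf: "\<And>w. w \<in> A \<Longrightarrow> w \<notin> B \<Longrightarrow> w - m \<in> B \<or> w + m \<in> B"
      using flips_swap[OF fl] by (auto simp: s.flips_def)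
    show False
    proof (cases "y \<in> A")
      case True
      then have w: "y + m \<in> B" "y + m \<notin> A" using sf[of y] neg freeA by auto
      with fl show False
      proof (cases rule: flip_kinds)
        case (1 x)
        then show False using mod_neq[of x "y + m" n] y mn by auto
      next
        case (2 x)
        have "(x - m) mod n = y mod n" using 2(1) by (metis add_diff_cancel_right' mod_diff_left_eq)
        then show False using 2 True A.cong by blast
      qed
    next
      case False
      then have a: "y - m \<in> A" using cA by auto
      then have w: "y - 2 * m \<in> B" "y - 2 * m \<notin> A" using sf[of "y - m"] neg A.free'[OF a] by (auto simp: algebra_simps)
      with fl show False
      proof (cases rule: flip_kinds)
        case (1 x)
        have "(x + m) mod n = (y - m) mod n" using 1(1) mod_add_left_eq[of x n m] mod_add_left_eq[of "y - 2 * m" n m] by (simp add: algebra_simps)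
        then show False using 1 a A.cong by blast
      next
        case (2 x)
        then show False using mod_neq[of x "y - 2 * m" n] y m_lt by auto
      qed
    qed
  qed
qed

text \<open>Two gained positions are handled by \<open>columns_two\<close>, a single one by the
  count in \<open>full_columns_one\<close>, with \<open>A\<close> and \<open>B\<close> exchanged if
  the element moved downwards.\<close>

lemma columns:
  assumes fl: "flips" and y: "1 \<le> y" "y \<le> m"
  shows "y \<in> A \<or> y - m \<in> A" "y \<in> B \<or> y - m \<in> B"
proof -
  obtain z where z: "z \<in> B" "z \<notin> A" using differ[OF ne] .
  have "(y \<in> A \<or> y - m \<in> A) \<and> (y \<in> B \<or> y - m \<in> B)"
  proof (cases "\<forall>w. w \<in> B \<longrightarrow> w \<notin> A \<longrightarrow> w mod n = z mod n")
    case False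
    then obtain w where "w \<in> B - A" "w mod n \<noteq> z mod n" by auto
    then show ?thesis using columns_two[OF fl, of w z] z y by auto
  next
    case True
    from fl z show ?thesis
    proof (cases rule: flip_kinds)
      case (1 x)
      have "\<And>w. w \<in> B \<Longrightarrow> w \<notin> A \<Longrightarrow> w mod n = x mod n" using True 1(1) by simp
      then show ?thesis using full_columns_one[OF 1(2-6,8)] y by blast
    next
      case (2 x)
      interpret s: qpair_full n m r B A by (rule swap_full)
      have single: "\<And>w. w \<in> B \<Longrightarrow> w \<notin> A \<Longrightarrow> w mod n = x mod n" using True 2(1) by simp
      have "\<And>w. w \<in> A \<Longrightarrow> w \<notin> B \<Longrightarrow> w mod n = (x + m) mod n"
        using diff_single[OF single 2(6,7)] by blast
      moreover have "x + m + m \<notin> B"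
      proof
        assume "x + m + m \<in> B"
        then have "(x + m + m) mod n = x mod n" using single freeA[OF 2(6)] by blast
        then show False using mod_neq[of "x + m + m" x n] m_lt m2 by auto
      qed
      moreover have "x + m - m \<in> B" using 2 by simp
      ultimately show ?thesis using s.full_columns_one[OF 2(2,3,6,7)] y by blast
    qed
  qed
  then show "y \<in> A \<or> y - m \<in> A" "y \<in> B \<or> y - m \<in> B" by auto
qed

lemma interval_top:
  assumes fl: "flips" and p: "1 \<le> p" "p \<le> m" "p \<in> A" "p \<notin> B"
    and top: "\<And>y. p < y \<Longrightarrow> y \<le> m \<Longrightarrow> y \<notin> A \<and> y \<notin> B" and m3: "3 \<le> m"
  shows "n = 2 * m + 2" "B \<inter> {p - m..<p - m + n} = {p - m..<p}"
proof -
  have run: "{p - m..p - 1} \<subseteq> B"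
  proof (rule run_of_columns[OF columns(1)[OF fl] columns(2)[OF fl] _ p])
    fix u v w assume o: "1 \<le> u" "u < v" "v < w" "w \<le> m"
    show "(u \<in> A \<longleftrightarrow> u \<in> B) \<or> (v \<in> A \<longleftrightarrow> v \<in> B) \<or> (w \<in> A \<longleftrightarrow> w \<in> B)"
    proof (rule ccontr)
      assume "\<not> ?thesis"
      then have d: "(u \<in> A) \<noteq> (u \<in> B)" "(v \<in> A) \<noteq> (v \<in> B)" "(w \<in> A) \<noteq> (w \<in> B)" by blast+
      obtain a b c where abc: "a \<in> {u, u - m}" "a \<in> B - A" "b \<in> {v, v - m}" "b \<in> B - A"
        "c \<in> {w, w - m}" "c \<in> B - A"
        using column_witness[OF fl columns(2)[OF fl] d(1)] column_witness[OF fl columns(2)[OF fl] d(2)]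
          column_witness[OF fl columns(2)[OF fl] d(3)] o by force
      have "a mod n \<noteq> b mod n" "b mod n \<noteq> c mod n" "a mod n \<noteq> c mod n"
        by (rule mod_neq; use abc o m_lt in auto)+
      then show False using at_most_two[OF fl] abc by blast
    qed
  qed (use top in auto)
  have "\<exists>w\<in>{p - m..p - 1}. z mod n = w mod n" if z: "z \<in> B" "z \<notin> A" for z
    using fl z
  proof (cases rule: flip_kinds)
    case (1 x)
    have "x \<le> p" "x \<noteq> p" using top[of x] 1 p by force+
    then show ?thesis using 1 p by (intro bexI[of _ x]) auto
  next
    case (2 x)
    have "x + m \<le> p" using top[of "x + m"] 2 by force
    moreover have "x + m \<notin> {p - m..p - 1}" using 2(7) run by blast
    ultimately have "x = p - m" using 2 p by auto
    then show ?thesis using 2 m2 by (intro bexI[of _ x]) auto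
  qed
  from interval_of_run[OF p run m3 this]
  show "n = 2 * m + 2" "B \<inter> {p - m..<p - m + n} = {p - m..<p}" by auto
qed

text \<open>The highest column met by \<open>A\<close> or \<open>B\<close> must separate them, since below a column
  met by both the two sets coincide.\<close>

lemma flips_interval:
  assumes fl: "flips"
  shows "n = 2 * m + 2 \<and> (\<exists>s. B \<inter> {s..<s + n} = {s..<s + m} \<or> A \<inter> {s..<s + n} = {s..<s + m})"
proof -
  interpret s: qpair_full n m r B A by (rule swap_full)
  obtain c where c: "2 \<le> c" "c \<le> m - 1" "(c \<in> A) \<noteq> (c \<in> B)"
  proof -
    obtain z where z: "z \<in> B" "z \<notin> A" using differ[OF ne] .
    from fl z show thesis
      by (cases rule: flip_kinds) (use that in auto)
  qed
  let ?P = "(A \<union> B) \<inter> {1..m}"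
  define p where "p = Max ?P"
  have "1 \<in> ?P" using in1 m2 by auto
  then have pP: "p \<in> ?P" unfolding p_def by (intro Max_in) auto
  have top: "y \<notin> A \<and> y \<notin> B" if "p < y" "y \<le> m" for y
  proof -
    have "y \<notin> ?P" using that Max_ge[of ?P y] by (fastforce simp: p_def)
    then show ?thesis using that pP by auto
  qed
  have AB: "y - 1 \<in> B" if "2 \<le> y" "y \<le> m" "y \<in> A" for y
    using stepA[of y] columns(2)[OF fl, of "y - 1"] that by auto
  have BA: "y - 1 \<in> A" if "2 \<le> y" "y \<le> m" "y \<in> B" for y
    using stepB[of y] columns(1)[OF fl, of "y - 1"] that by auto
  have m3: "3 \<le> m" using c by simp
  have "\<not> (p \<in> A \<and> p \<in> B)"
  proof
    assume pp: "p \<in> A \<and> p \<in> B"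
    have "p - int j \<in> A \<and> p - int j \<in> B" if "1 \<le> p - int j" for j
      using that
    proof (induction j)
      case (Suc j)
      have e: "p - int (Suc j) = (p - int j) - 1" by simp
      have "p - int j \<in> A \<and> p - int j \<in> B" using Suc by simp
      then show ?case unfolding e using AB[of "p - int j"] BA[of "p - int j"] Suc.prems pP by simp
    qed (use pp in simp)
    from this[of "nat (p - c)"] show False using c top[of c] by (cases "c \<le> p") auto
  qed
  then consider "p \<in> A" "p \<notin> B" | "p \<in> B" "p \<notin> A" using pP by blast
  then show ?thesis
  proof cases
    case 1
    have e: "p - m + m = p" by simp
    have "n = 2 * m + 2" "B \<inter> {p - m..<p - m + n} = {p - m..<p - m + m}"
      using interval_top[OF fl _ _ 1 top m3] pP by auto
    then show ?thesis by blast
  next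
    case 2
    have e: "p - m + m = p" by simp
    have "n = 2 * m + 2" "A \<inter> {p - m..<p - m + n} = {p - m..<p - m + m}"
      using s.interval_top[OF flips_swap[OF fl] _ _ 2 _ m3] top pP by auto
    then show ?thesis by blast
  qed
qed

end

section \<open>The case $n = 2r$\<close>

context no_cycle
begin

lemma free_set_d:
  assumes "frame vx ed" "X \<in> E" "X \<notin> range ed"
  shows "free_set n d r (pos vx X)"
  by unfold_locales (use pos_periodic[OF assms(1,2)] extra_free[OF assms] n_pos in auto)

lemma free_set_m:
  assumes "frame vx ed" "X \<in> E" "X \<notin> range ed"
  shows "free_set n (n - d) r (pos vx X)"
  by unfold_locales (use pos_periodic[OF assms(1,2)] extra_free[OF assms] n_pos in auto)

lemma edge_bound:
  assumes "frame vx ed" "X \<in> E" "X \<notin> range ed"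
  shows "2 * r \<le> n"
proof -
  interpret free_set n d r "pos vx X" using assms by (rule free_set_d)
  show ?thesis using card_defect[of 0] by simp
qed

text \<open>Both position sets are complementary to their translates by \<open>d\<close>, so their symmetric
  difference is invariant under this translation and meets the pairs that straddle the edge.\<close>

lemma half_consecutive:
  assumes fr: "frame vx ed" and X: "X \<in> E" "X \<notin> range ed" and half: "n = 2 * r"
    and i: "vx 0 \<in> X" "vx 1 \<in> X"
  shows False
proof -
  let ?A = "pos vx X" and ?B = "pos vx (ed 0)"
  have B0: "vx 0 \<in> ed 0" "vx 1 \<in> ed 0" using frame_inc[OF fr, of 0] by auto
  interpret A: free_set n d r ?A using fr X by (rule free_set_d)
  interpret B: free_set n d r ?B
    by unfold_locales (use pos_periodic[OF fr frame_inE[OF fr]] replaced_free(1)[OF fr X, of 0] i n_pos in auto)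
  have dA: "A.defect = {}"
  proof -
    have "card (A.defect \<inter> {0..<0 + n}) = 0" using A.card_defect[of 0] half by simp
    then have "A.defect \<inter> {0..<0 + n} = {}" by (metis card_0_eq finite_Int finite_atLeastLessThan_int)
    then show ?thesis using A.defect_mod by blast
  qed
  have dB: "B.defect = {}"
  proof -
    have "card (B.defect \<inter> {0..<0 + n}) = 0" using B.card_defect[of 0] half by simp
    then have "B.defect \<inter> {0..<0 + n} = {}" by (metis card_0_eq finite_Int finite_atLeastLessThan_int)
    then show ?thesis using B.defect_mod by blast
  qed
  have shA: "x + d \<in> ?A \<longleftrightarrow> x \<notin> ?A" for x using dA A.free[of x] A.defect_iff[of "x + d"] by auto
  have shB: "x + d \<in> ?B \<longleftrightarrow> x \<notin> ?B" for x using dB B.free[of x] B.defect_iff[of "x + d"] by auto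
  define D where "D x \<longleftrightarrow> (x \<in> ?A) \<noteq> (x \<in> ?B)" for x
  have Dd: "D (x + d * int j) \<longleftrightarrow> D x" for x j
  proof (induction j)
    case (Suc j)
    have "x + d * int (Suc j) = (x + d * int j) + d" by (simp add: algebra_simps)
    then show ?case using Suc shA[of "x + d * int j"] shB[of "x + d * int j"] by (simp only: D_def) auto
  qed simp
  have "X \<noteq> ed 0" using X by auto
  then have "?A \<noteq> ?B" using pos_eq[OF fr X(1) frame_inE[OF fr]] by blast
  then obtain x0 where "(x0 \<in> ?A) \<noteq> (x0 \<in> ?B)" by blast
  then have "D x0" unfolding D_def .
  \<comment> \<open>\<open>Dd\<close> only moves upwards by \<open>d\<close>, hence a nonpositive
    representative of \<open>x0\<close> first. Steps of length \<open>d\<close> then lead to a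
    \<open>y\<close> in \<open>1 - d..0\<close>, the range of \<open>straddling\<close>.\<close>
  define x where "x = x0 - n * (\<bar>x0\<bar> + 1)"
  have "1 * (\<bar>x0\<bar> + 1) \<le> n * (\<bar>x0\<bar> + 1)" by (rule mult_right_mono) (use n_pos in auto)
  moreover have "x0 \<le> 1 * (\<bar>x0\<bar> + 1)" by simp
  ultimately have "x0 \<le> n * (\<bar>x0\<bar> + 1)" by (rule order_trans[rotated])
  then have xneg: "x \<le> 0" by (simp only: x_def diff_le_0_iff_le)
  have "x mod n = x0 mod n" by (simp add: x_def mod_eq_dvd_iff)
  then have "D x" using \<open>D x0\<close> A.cong[of x x0] B.cong[of x x0] by (simp add: D_def)
  define y where "y = x + d * ((- x) div d)"
  have "0 \<le> (- x) div d" using xneg d_pos by (simp add: pos_imp_zdiv_nonneg_iff)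
  then have "D y" using Dd[of x "nat ((- x) div d)"] \<open>D x\<close> by (simp add: y_def)
  have "y = - ((- x) mod d)" by (simp add: y_def minus_div_mult_eq_mod[symmetric] algebra_simps)
  then have yb: "1 - d \<le> y" "y \<le> 0" using pos_mod_sign[of d "- x"] pos_mod_bound[of d "- x"] d_pos by linarith+
  have "D (y + d)" using Dd[of y 1] \<open>D y\<close> by simp
  have av: "avail ed X" "avail ed (ed 0)" using avail_extra[OF X] avail_zero[OF fr] by auto
  have "vx y \<in> X \<Longrightarrow> vx (y + d) \<notin> ed 0" "vx y \<in> ed 0 \<Longrightarrow> vx (y + d) \<notin> X"
    using straddling[OF fr av \<open>X \<noteq> ed 0\<close> _ _ _ _ yb] straddling[OF fr av(2,1) \<open>X \<noteq> ed 0\<close>[symmetric] _ _ _ _ yb] i B0 by auto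
  then show False using \<open>D y\<close> \<open>D (y + d)\<close> shA[of y] shB[of y] by (auto simp: D_def)
qed

text \<open>Here no two consecutive positions of \<open>X\<close> exist, so no cycle edge can be
  exchanged for \<open>X\<close>. For \<open>d > 1\<close> the edge \<open>ed (- 1)\<close>, which
  meets \<open>X\<close> at 0, is combined with \<open>X\<close> until too few positions remain for
  it; \<open>d = 1\<close> needs a pigeonhole argument.\<close>

lemma half_alternating:
  assumes fr: "frame vx ed" and X: "X \<in> E" "X \<notin> range ed" and half: "n = 2 * r" and r3: "3 \<le> r"
    and ev: "\<And>x. vx x \<in> X \<longleftrightarrow> even x"
  shows False
proof -
  let ?A = "pos vx X"
  have "odd d" using extra_free(1)[OF fr X, of 0] ev by auto
  show False
  proof (cases "d = 1")
    case False
    with \<open>odd d\<close> d_pos have d3: "3 \<le> d" by presburger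
    have dn: "d \<le> n - 3" using d_le \<open>odd d\<close> half by presburger
    let ?Y = "ed (- 1)"
    let ?B = "pos vx ?Y"
    have B: "vx (- 1) \<in> ?Y" "vx 0 \<in> ?Y" using frame_inc[OF fr, of "- 1"] by auto
    have Y: "?Y \<in> E" "?Y \<noteq> X" using frame_inE[OF fr] X by auto
    have fX: "X \<notin> ed ` S" for S using X by auto
    have fY: "?Y \<notin> ed ` S" if "\<And>j. j \<in> S \<Longrightarrow> - n \<le> j \<and> j < - 1 \<or> 0 \<le> j \<and> j < n - 1" for S
    proof
      assume "?Y \<in> ed ` S"
      then obtain j where j: "j \<in> S" "j mod n = (- 1) mod n" using frame_ed[OF fr] by (metis imageE)
      then show False using that[OF j(1)] mod_eq_close[OF j(2)] by auto
    qed
    have f1: "t \<notin> ?B" if t: "odd t" "0 \<le> t" "t \<le> d - 1" for t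
    proof
      assume "t \<in> ?B"
      then have tB: "vx (t - d + d) \<in> ?Y" by simp
      have tX: "vx (t - d) \<in> X" "vx 0 \<in> X" using t \<open>odd d\<close> by (simp_all add: ev)
      have "?Y \<notin> ed ` ({t - d..<0 - 1} \<union> {0..<t - d + d})" by (rule fY) (use t d_pos dn in auto)
      from crossing[OF fr X(1) Y(1) Y(2)[symmetric] fX this _ _ tX(1) tB tX(2)] t B(1) show False by simp
    qed
    have f2: "t \<notin> ?B" if t: "even t" "d + 1 \<le> t" "t \<le> n - 1" for t
    proof -
      have tX: "vx 0 \<in> X" "vx (t - d + 1) \<in> X" using t \<open>odd d\<close> by (simp_all add: ev)
      have "?Y \<notin> ed ` {t - d + 1..<t - d + 1 + d - 1}" by (rule fY) (use t d_pos dn in auto)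
      from common_vertex[OF fr X(1) Y(1) Y(2)[symmetric] fX this _ _ tX(1) B(2) tX(2)] t show ?thesis by simp
    qed
    have f3: "t \<notin> ?B" if t: "even t" "1 \<le> t" "t \<le> n - d" for t
    proof
      assume "t \<in> ?B"
      then have tB: "vx t \<in> ?Y" by simp
      have tX: "vx 0 \<in> X" "vx (t + d - 1) \<in> X" using t \<open>odd d\<close> by (simp_all add: ev)
      have "?Y \<notin> ed ` {t..<t + d - 1}" by (rule fY) (use t d_pos dn in auto)
      from common_vertex[OF fr Y(1) X(1) Y(2) this fX _ _ B(2) tX(1) tB] t tX(2) show False by simp
    qed
    have f4: "d \<notin> ?B"
    proof
      assume "d \<in> ?B"
      then have dB: "vx (0 + d) \<in> ?Y" by simp
      have "?Y \<notin> ed ` {0..<0 + d}" by (rule fY) (use d_pos dn in auto)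
      from one_arc[OF fr Y(1) this B(2) dB] show False .
    qed
    \<comment> \<open>What \<open>f1\<close> to \<open>f4\<close> leave besides 0: even positions
      strictly between \<open>n - d\<close> and \<open>d\<close>, and odd positions from
      \<open>d + 2\<close> on. These are fewer than \<open>r - 1\<close>.\<close>
    let ?U = "{t. even t} \<inter> {n - d + 1..<d}" and ?O = "{t. odd t} \<inter> {d + 2..<n}"
    have sub: "?B \<inter> {0..<0 + n} \<subseteq> insert 0 (?U \<union> ?O)"
    proof
      fix t assume t: "t \<in> ?B \<inter> {0..<0 + n}"
      show "t \<in> insert 0 (?U \<union> ?O)"
      proof (cases "even t")
        case True
        have "t < d + 1" using f2[OF True] t by force
        moreover have "t = 0 \<or> n - d < t" using f3[OF True] t by force
        moreover have "t \<noteq> d" using True \<open>odd d\<close> by auto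
        ultimately show ?thesis using True by auto
      next
        case False
        have "d \<le> t" using f1[OF False] t by force
        moreover have "t \<noteq> d" using f4 t by auto
        moreover have "t \<noteq> d + 1" using False \<open>odd d\<close> by auto
        ultimately show ?thesis using False t by auto
      qed
    qed
    have "card (?B \<inter> {0..<0 + n}) \<le> card (insert 0 (?U \<union> ?O))" by (rule card_mono[OF _ sub]) auto
    also have "\<dots> \<le> Suc (card (?U \<union> ?O))" by (rule card_insert_le_m1) auto
    also have "card (?U \<union> ?O) \<le> card ?U + card ?O" by (rule card_Un_le)
    finally have c: "int (card (?B \<inter> {0..<0 + n})) \<le> 1 + int (card ?U) + int (card ?O)" by simp
    have "int (card (?B \<inter> {0..<0 + n})) = r"
      using pos_periodic[OF fr Y(1)] by (simp add: periodic_set_def)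
    moreover have "2 * int (card ?O) \<le> n - (d + 2) + 1"
      by (rule card_nonadjacent) (use dn in auto)
    moreover have "2 * int (card ?U) \<le> max 0 (d - (n - d + 1) + 1)"
    proof (cases "n - d + 1 \<le> d")
      case True
      have "2 * int (card ?U) \<le> d - (n - d + 1) + 1"
        by (rule card_nonadjacent) (use True in auto)
      then show ?thesis by simp
    qed simp
    ultimately have "2 * r \<le> 2 + max 0 (2 * d - n) + (n - d - 1)" using c by simp
    then show False using half d3 dn by (simp add: max_def split: if_splits)
  next
    case True
    \<comment> \<open>The missing length is now 2, so two distinct edges have at most one common
      vertex. In particular an edge other than \<open>X\<close> has at most one even position and
      misses at most one odd one.\<close>
    have share: False if "Y \<in> E" "Z \<in> E" "Y \<noteq> Z" "i < j" "j < i + n" "vx i \<in> Y" "vx j \<in> Y" "vx i \<in> Z" "vx j \<in> Z" for Y Z i j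
      using cross[OF fr that(1-3), of i i j j] that True by auto
    have miss: "vx a \<in> Y \<or> vx b \<in> Y" if Y: "Y \<in> E" "Y \<noteq> X" and ab: "a \<in> {0..<n}" "b \<in> {0..<n}" "odd a" "odd b" "a \<noteq> b" for Y a b
    proof (rule ccontr)
      assume neg: "\<not> ?thesis"
      let ?B = "pos vx Y \<inter> {0..<n}" and ?Od = "{t. odd t} \<inter> {0..<n}"
      have "card (?B \<inter> {t. even t}) \<le> Suc 0"
      proof (rule ccontr)
        assume "\<not> ?thesis"
        then obtain s t where "s \<in> ?B \<inter> {t. even t}" "t \<in> ?B \<inter> {t. even t}" "s \<noteq> t"
          by (metis card_le_Suc0_iff_eq finite_Int finite_atLeastLessThan_int)
        then show False using share[OF Y(1) X(1) Y(2), of s t] share[OF Y(1) X(1) Y(2), of t s] ev by (cases "s < t") auto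
      qed
      moreover have "?B - {t. even t} \<subseteq> ?Od - {a, b}" using neg by auto
      then have "card (?B - {t. even t}) \<le> card (?Od - {a, b})" by (intro card_mono) auto
      moreover have "card (?Od - {a, b}) = card ?Od - card {a, b}" by (rule card_Diff_subset) (use ab in auto)
      moreover have "card {a, b} = 2" using ab by simp
      moreover have "2 * int (card ({t. odd t} \<inter> {1..<n})) \<le> n - 1 + 1"
        by (rule card_nonadjacent) (use n_pos in auto)
      moreover have "?Od = {t. odd t} \<inter> {1..<n}"
      proof -
        have "odd t \<Longrightarrow> t \<noteq> 0" for t :: int by auto
        then show ?thesis by force
      qed
      moreover have "card ?B = card (?B \<inter> {t. even t}) + card (?B - {t. even t})"
        by (subst card_Un_disjoint[symmetric]) (auto intro!: arg_cong[of _ _ card])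
      moreover have "int (card ?B) = r" using pos_periodic[OF fr Y(1)] by (simp add: periodic_set_def)
      moreover have "2 \<le> card ?Od"
        using card_mono[of ?Od "{a, b}"] ab by auto
      ultimately show False using half by simp
    qed
    have n6: "6 \<le> n" using half r3 by simp
    have ne: "ed i \<noteq> X" for i using X by auto
    have pair: False if "i \<noteq> j" "i \<in> {0..3}" "j \<in> {0..3}" "a \<noteq> b" "a \<in> {1,3,5}" "b \<in> {1,3,5}"
      "vx a \<in> ed i" "vx b \<in> ed i" "vx a \<in> ed j" "vx b \<in> ed j" for i j a b
    proof -
      have "ed i \<noteq> ed j" using frame_ed[OF fr, of i j] mod_neq[of i j n] that n6 by auto
      then show False
        using share[OF frame_inE[OF fr] frame_inE[OF fr], of i j a b] share[OF frame_inE[OF fr] frame_inE[OF fr], of i j b a]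
          that n6 by (cases "a < b") auto
    qed
    define P where "P i s \<longleftrightarrow> vx s \<in> ed i" for i s
    have m: "P i 1 \<or> P i 3" "P i 1 \<or> P i 5" "P i 3 \<or> P i 5" for i
      using miss[OF frame_inE[OF fr] ne, of 1 3 i] miss[OF frame_inE[OF fr] ne, of 1 5 i] miss[OF frame_inE[OF fr] ne, of 3 5 i] n6
      by (auto simp: P_def)
    have q: "\<not> (P i a \<and> P i b \<and> P j a \<and> P j b)" if "i \<noteq> j" "i \<in> {0..3}" "j \<in> {0..3}" "a \<noteq> b" "a \<in> {1,3,5}" "b \<in> {1,3,5}" for i j a b
      using pair[OF that] by (auto simp: P_def)
    \<comment> \<open>\<open>c i\<close> names a pair among the positions 1, 3, 5 that
      \<open>ed i\<close> contains. Four edges share three possible pairs.\<close>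
    define c :: "int \<Rightarrow> nat" where "c i = (if P i 1 \<and> P i 3 then 0 else if P i 1 \<and> P i 5 then 1 else 2)" for i
    have "c i \<noteq> c j" if "i \<noteq> j" "i \<in> {0..3}" "j \<in> {0..3}" for i j
      using q[OF that, of 1 3] q[OF that, of 1 5] q[OF that, of 3 5] m[of i] m[of j]
      by (simp add: c_def) blast
    from this[of 0 1] this[of 0 2] this[of 0 3] this[of 1 2] this[of 1 3] this[of 2 3]
    have "distinct [c 0, c 1, c 2, c 3]" by simp
    moreover have "set [c 0, c 1, c 2, c 3] \<subseteq> {0, 1, 2}" by (auto simp: c_def)
    then have "card (set [c 0, c 1, c 2, c 3]) \<le> 3" using card_mono[of "{0, 1, 2 :: nat}" "set [c 0, c 1, c 2, c 3]"] by simp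
    ultimately show False by (metis distinct_card eval_nat_numeral(3) length_Cons list.size(3) not_less_eq_eq numeral_2_eq_2 numeral_3_eq_3 order_refl)
  qed
qed

text \<open>Without two consecutive positions \<open>X\<close> is a free set for distance 1 as well;
  \<open>n = 2 * r\<close> leaves it no empty column, so it alternates.\<close>

lemma half_case:
  assumes fr: "frame vx ed" and X: "X \<in> E" "X \<notin> range ed" and half: "n = 2 * r" and r3: "3 \<le> r"
  shows False
proof (cases "\<exists>q. vx q \<in> X \<and> vx (q + 1) \<in> X")
  case True
  then obtain q where q: "vx q \<in> X" "vx (q + 1) \<in> X" by blast
  note s = frame_shift[OF fr, of q]
  show False
    by (rule half_consecutive[OF s(1) X(1) _ half]) (use s(2) X q in \<open>auto simp: add.commute\<close>)
next
  case False
  interpret A: free_set n 1 r "pos vx X"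
    by unfold_locales (use pos_periodic[OF fr X(1)] False n_pos in auto)
  have "card (A.defect \<inter> {0..<0 + n}) = 0" using A.card_defect[of 0] half by simp
  then have "A.defect \<inter> {0..<0 + n} = {}" by (metis card_0_eq finite_Int finite_atLeastLessThan_int)
  then have "A.defect = {}" using A.defect_mod by blast
  then have step: "vx (x + 1) \<in> X \<longleftrightarrow> vx x \<notin> X" for x
    using A.free[of x] A.defect_iff[of "x + 1"] by auto
  have "card (pos vx X \<inter> {0..<0 + n}) \<noteq> 0" using A.card_win[of 0] r3 by (metis int_eq_iff_numeral linorder_not_less of_nat_0 zero_less_numeral)
  then obtain q where q: "vx q \<in> X" by (metis IntE card.empty ex_in_conv pos_iff)
  have up: "vx (q + int j) \<in> X \<longleftrightarrow> even j" for j
  proof (induction j)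
    case (Suc j)
    then show ?case using step[of "q + int j"] by (simp add: algebra_simps)
  qed (use q in simp)
  have ev: "vx (x + q) \<in> X \<longleftrightarrow> even x" for x
  proof (cases "0 \<le> x")
    case True
    then show ?thesis using up[of "nat x"] by (simp add: algebra_simps even_nat_iff)
  next
    case False
    have dn: "vx (q - int j) \<in> X \<longleftrightarrow> even j" for j
    proof (induction j)
      case (Suc j)
      then show ?case using step[of "q - int j - 1"] by (simp add: algebra_simps)
    qed (use q in simp)
    show ?thesis using dn[of "nat (- x)"] False by (simp add: algebra_simps even_nat_iff)
  qed
  note s = frame_shift[OF fr, of q]
  show False
    by (rule half_alternating[OF s(1) X(1) _ half r3 ev]) (use s(2) X in auto)
qed

end

section \<open>Short cycles and the middle length\<close>

context no_cycle
begin

text \<open>Rotation by \<open>d\<close> of the interval \<open>u..w\<close>, closed up to a cycle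
  by an edge that contains both ends.\<close>

definition wrap :: "int \<Rightarrow> int \<Rightarrow> int \<Rightarrow> int" where
  "wrap u w t = (if t + d \<le> w then t + d else t + d - (w - u + 1))"

lemma wrap_in: "d + 1 \<le> w - u \<Longrightarrow> t \<in> {u..w} \<Longrightarrow> wrap u w t \<in> {u..w}"
  using d_pos by (auto simp: wrap_def)

lemma wrap_inj: "d + 1 \<le> w - u \<Longrightarrow> inj_on (wrap u w) {u..w}"
  using d_pos by (auto simp: wrap_def inj_on_def split: if_splits)

text \<open>If \<open>t + d\<close> passes \<open>w\<close>, the arcs from \<open>u\<close> to the
  image of \<open>t\<close> and from \<open>t\<close> to \<open>w\<close> have \<open>d + 1\<close>
  vertices together. \<open>X\<close> joins their outer ends, so \<open>Y\<close> cannot join the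
  inner ones.\<close>

lemma wrap_free:
  assumes fr: "frame vx ed" and X: "X \<in> E" "X \<notin> range ed" and Y: "Y \<in> E" "Y \<notin> range ed" "X \<noteq> Y"
    and uw: "vx u \<in> X" "vx w \<in> X" "d + 1 \<le> w - u" "w - u < n" and t: "t \<in> {u..w}" "vx t \<in> Y"
  shows "vx (wrap u w t) \<notin> Y"
proof (cases "t + d \<le> w")
  case True
  then show ?thesis using extra_free(1)[OF fr Y(1,2) t(2)] by (simp add: wrap_def)
next
  case False
  show ?thesis
  proof
    assume "vx (wrap u w t) \<in> Y"
    moreover have "X \<notin> ed ` S" "Y \<notin> ed ` S" for S using X Y by auto
    ultimately show False
      using para[OF fr Y(1) X(1) Y(3)[symmetric], of u "wrap u w t" t w] False uw t d_pos
      by (simp add: wrap_def)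
  qed
qed

text \<open>\<open>wrap\<close> maps the positions of \<open>Y\<close> in the interval injectively
  to positions outside \<open>Y\<close>. In the case of equality this map is onto, so positions
  outside \<open>Y\<close> must go to \<open>Y\<close>.\<close>

lemma balance:
  assumes fr: "frame vx ed" and X: "X \<in> E" "X \<notin> range ed" and Y: "Y \<in> E" "Y \<notin> range ed" "X \<noteq> Y"
    and uw: "vx u \<in> X" "vx w \<in> X" "d + 1 \<le> w - u" "w - u < n"
  shows "2 * int (card (pos vx Y \<inter> {u..w})) \<le> w - u + 1"
    and "2 * int (card (pos vx Y \<inter> {u..w})) = w - u + 1 \<Longrightarrow> t \<in> {u..w} \<Longrightarrow> vx t \<notin> Y \<Longrightarrow> vx (wrap u w t) \<in> Y"
proof -
  let ?B = "pos vx Y \<inter> {u..w}" and ?C = "{u..w} - pos vx Y"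
  have inj: "inj_on (wrap u w) {u..w}" by (rule wrap_inj[OF uw(3)])
  have sub: "wrap u w ` ?B \<subseteq> ?C"
    using wrap_free[OF fr X Y uw] wrap_in[OF uw(3)] by auto
  have cB: "card (wrap u w ` ?B) = card ?B" by (rule card_image) (rule inj_on_subset[OF inj], auto)
  have le: "card ?B \<le> card ?C" using card_mono[OF _ sub] cB by simp
  have "card {u..w} = card (?B \<union> ?C)" by (rule arg_cong[of _ _ card]) auto
  also have "\<dots> = card ?B + card ?C" by (rule card_Un_disjoint) auto
  finally have "card {u..w} = card ?B + card ?C" .
  then have tot: "int (card ?B) + int (card ?C) = w - u + 1" using uw d_pos by simp
  then show "2 * int (card ?B) \<le> w - u + 1" using le by simp
  assume eq: "2 * int (card ?B) = w - u + 1" and t: "t \<in> {u..w}" "vx t \<notin> Y"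
  have C: "wrap u w ` ?B = ?C" by (rule card_subset_eq[OF _ sub]) (use eq tot cB in auto)
  show "vx (wrap u w t) \<in> Y"
  proof (rule ccontr)
    assume "vx (wrap u w t) \<notin> Y"
    then have "wrap u w t \<in> wrap u w ` ?B" using C wrap_in[OF uw(3) t(1)] by auto
    then obtain b where "b \<in> ?B" "wrap u w t = wrap u w b" by blast
    then show False using inj_onD[OF inj, of t b] t by auto
  qed
qed

text \<open>If both sets fill exactly half of the interval, each is complementary to its translate,
  and the last position where they differ closes a cycle with its translate.\<close>

lemma balanced_agree:
  assumes fr: "frame vx ed" and X: "X \<in> E" "X \<notin> range ed" and Y: "Y \<in> E" "Y \<notin> range ed" "X \<noteq> Y"
    and u: "vx u \<in> X" "vx u \<in> Y" and w: "vx w \<in> X" "vx w \<in> Y" and uw: "d + 1 \<le> w - u" "w - u < n"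
    and hX: "2 * int (card (pos vx X \<inter> {u..w})) = w - u + 1" and hY: "2 * int (card (pos vx Y \<inter> {u..w})) = w - u + 1"
    and t: "t \<in> {u..w}"
  shows "vx t \<in> X \<longleftrightarrow> vx t \<in> Y"
proof (rule ccontr)
  assume neg: "\<not> ?thesis"
  let ?D = "{t \<in> {u..w}. (vx t \<in> X) \<noteq> (vx t \<in> Y)}"
  have fin: "finite ?D" by (rule finite_subset[of _ "{u..w}"]) auto
  define x where "x = Max ?D"
  have xD: "x \<in> ?D" unfolding x_def by (rule Max_in[OF fin]) (use neg t in auto)
  have xmax: "y \<le> x" if "y \<in> ?D" for y unfolding x_def by (rule Max_ge[OF fin that])
  have x: "x \<in> {u..w}" using xD by simp
  note wX = wrap_free[OF fr Y(1,2) X(1,2) Y(3)[symmetric] u(2) w(2) uw x] balance(2)[OF fr Y(1,2) X(1,2) Y(3)[symmetric] u(2) w(2) uw hX x]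
  note wY = wrap_free[OF fr X Y u(1) w(1) uw x] balance(2)[OF fr X Y u(1) w(1) uw hY x]
  let ?x = "wrap u w x"
  have "?x \<in> ?D" using wX wY xD wrap_in[OF uw(1) x] by auto
  then have "?x \<le> x" by (rule xmax)
  then have o: "\<not> x + d \<le> w" using d_pos by (auto simp: wrap_def)
  have f: "X \<notin> ed ` S" "Y \<notin> ed ` S" for S using X Y by auto
  show False
  proof (cases "vx x \<in> X")
    case True
    then show False
      using cross[OF fr X(1) Y(1,3), of u ?x x w] f wX wY xD u w uw o x d_pos by (auto simp: wrap_def)
  next
    case False
    then show False
      using cross[OF fr Y(1) X(1) Y(3)[symmetric], of u ?x x w] f wX wY xD u w uw o x d_pos by (auto simp: wrap_def)
  qed
qed

text \<open>The 2 accounts for \<open>w\<close>, counted in both intervals, and for position 0,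
  counted again as \<open>n\<close>.\<close>

lemma split_at:
  assumes "frame vx ed" "X \<in> E" "vx 0 \<in> X" "vx w \<in> X" "0 < w" "w < n"
  shows "int (card (pos vx X \<inter> {0..w})) + int (card (pos vx X \<inter> {w..n})) = r + 2"
proof -
  let ?P = "pos vx X"
  have "?P \<inter> {0..w} = insert w (?P \<inter> {0..<w})" using assms by auto
  moreover have "vx n \<in> X" using frame_period[OF assms(1), of 0] assms(3) by simp
  then have "?P \<inter> {w..n} = insert n (?P \<inter> {w..<n})" using assms by auto
  moreover have "?P \<inter> {0..<n} = (?P \<inter> {0..<w}) \<union> (?P \<inter> {w..<n})" using assms by auto
  moreover have "card ((?P \<inter> {0..<w}) \<union> (?P \<inter> {w..<n})) = card (?P \<inter> {0..<w}) + card (?P \<inter> {w..<n})"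
    by (rule card_Un_disjoint) auto
  moreover have "int (card (?P \<inter> {0..<n})) = r" using pos_periodic[OF assms(1,2)] by (simp add: periodic_set_def)
  ultimately show ?thesis by simp
qed

text \<open>The bounds of \<open>balance\<close> for the two intervals add up to
  \<open>n + 2\<close>, while twice the number of positions is \<open>2 * r + 4\<close>. As
  \<open>n <= 2 * r + 2\<close>, both intervals are exactly half full for both edges, and
  \<open>balanced_agree\<close> identifies them.\<close>

lemma far_unique:
  assumes fr: "frame vx ed" and X: "X \<in> E" "X \<notin> range ed" and Y: "Y \<in> E" "Y \<notin> range ed"
    and z: "vx 0 \<in> X" "vx 0 \<in> Y" and w: "vx w \<in> X" "vx w \<in> Y" "d + 1 \<le> w" "w \<le> n - d - 1"
    and n: "n \<le> 2 * r + 2"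
  shows "X = Y"
proof (rule ccontr)
  assume ne: "X \<noteq> Y"
  have vn: "vx n \<in> X" "vx n \<in> Y" using frame_period[OF fr, of 0] z by simp_all
  have wb: "d + 1 \<le> w - 0" "w - 0 < n" "d + 1 \<le> n - w" "n - w < n" using w d_pos by auto
  note ne' = ne[symmetric]
  have hX: "2 * int (card (pos vx X \<inter> {0..w})) = w - 0 + 1" "2 * int (card (pos vx X \<inter> {w..n})) = n - w + 1"
    using balance(1)[OF fr Y X ne' z(2) w(2) wb(1,2)] balance(1)[OF fr Y X ne' w(2) vn(2) wb(3,4)]
      split_at[OF fr X(1) z(1) w(1)] wb d_pos n by linarith+
  have hY: "2 * int (card (pos vx Y \<inter> {0..w})) = w - 0 + 1" "2 * int (card (pos vx Y \<inter> {w..n})) = n - w + 1"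
    using balance(1)[OF fr X Y ne z(1) w(1) wb(1,2)] balance(1)[OF fr X Y ne w(1) vn(1) wb(3,4)]
      split_at[OF fr Y(1) z(2) w(2)] wb d_pos n by linarith+
  have ag: "vx t \<in> X \<longleftrightarrow> vx t \<in> Y" if "t \<in> {0..n}" for t
  proof (cases "t \<le> w")
    case True
    show ?thesis
      by (rule balanced_agree[OF fr X Y ne z w(1,2) wb(1,2) hX(1) hY(1)]) (use that True in auto)
  next
    case False
    show ?thesis
      by (rule balanced_agree[OF fr X Y ne w(1,2) vn wb(3,4) hX(2) hY(2)]) (use that False in auto)
  qed
  have "vx t \<in> X \<longleftrightarrow> vx t \<in> Y" for t
  proof -
    have "vx (t mod n) = vx t" using frame_vx[OF fr, of "t mod n" t] by simp
    moreover have "t mod n \<in> {0..n}"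
      using pos_mod_sign[OF n_pos, of t] pos_mod_bound[OF n_pos, of t] by (simp only: atLeastAtMost_iff less_imp_le)
    ultimately show ?thesis using ag[of "t mod n"] by simp
  qed
  then have "pos vx X = pos vx Y" by auto
  then show False using pos_eq[OF fr X(1) Y(1)] ne by blast
qed

text \<open>At most \<open>d\<close> positions lie in \<open>- d..d\<close>: position 0, and at most
  one from each of the \<open>d - 1\<close> pairs \<open>t\<close>, \<open>t - d\<close> with
  \<open>1 <= t < d\<close>; the two ends are excluded by 0.\<close>

lemma many_far:
  assumes fr: "frame vx ed" and X: "X \<in> E" "X \<notin> range ed" and z: "vx 0 \<in> X"
  shows "r - d \<le> int (card (pos vx X \<inter> {d + 1..n - d - 1}))"
proof -
  let ?P = "pos vx X"
  interpret free_set n d r ?P using fr X by (rule free_set_d)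
  have nd: "d \<notin> ?P" "- d \<notin> ?P" using free[of 0] free[of "- d"] z by auto
  have "?P \<inter> {- d..<- d + n} \<subseteq> insert 0 ((?P \<inter> {1 - d..<1 - d + (d - 1)}) \<union> (?P \<inter> {1 - d + d..<1 - d + d + (d - 1)}) \<union> (?P \<inter> {d + 1..n - d - 1}))"
    (is "_ \<subseteq> insert 0 (?U \<union> ?W \<union> ?Z)")
  proof
    fix x assume x: "x \<in> ?P \<inter> {- d..<- d + n}"
    then have "x \<noteq> d" "x \<noteq> - d" using nd by auto
    then show "x \<in> insert 0 (?U \<union> ?W \<union> ?Z)" using x by auto
  qed
  then have "card (?P \<inter> {- d..<- d + n}) \<le> card (insert 0 (?U \<union> ?W \<union> ?Z))" by (intro card_mono) auto
  also have "\<dots> \<le> Suc (card (?U \<union> ?W \<union> ?Z))" by (rule card_insert_le_m1) auto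
  also have "card (?U \<union> ?W \<union> ?Z) \<le> card ?U + card ?W + card ?Z" using card_Un_le[of "?U \<union> ?W" ?Z] card_Un_le[of ?U ?W] by linarith
  finally have "r \<le> 1 + int (card ?U) + int (card ?W) + int (card ?Z)" using card_win[of "- d"] by simp
  moreover have "int (card ?U) + int (card ?W) \<le> d - 1" using window_split[of "d - 1" "1 - d"] d_pos by simp
  ultimately show ?thesis by simp
qed

end

lemma three_elements:
  assumes "3 \<le> card S"
  obtains x y z where "x \<in> S" "y \<in> S" "z \<in> S" "x \<noteq> y" "y \<noteq> z" "x \<noteq> z"
proof -
  obtain T where "T \<subseteq> S" "card T = 3" using obtain_subset_with_card_n[OF assms] by blast
  then obtain x y z where "T = {x, y, z}" "x \<noteq> y" "y \<noteq> z" "x \<noteq> z" by (auto simp: card_3_iff)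
  then show thesis using that \<open>T \<subseteq> S\<close> by auto
qed

lemma two_elements:
  assumes "2 \<le> card S"
  obtains x y where "x \<in> S" "y \<in> S" "x \<noteq> y"
proof -
  obtain T where "T \<subseteq> S" "card T = 2" using obtain_subset_with_card_n[OF assms] by blast
  then show thesis using that by (auto simp: card_2_iff)
qed

section \<open>Six extra edges through position 0: lengths up to r + 1\<close>

locale six_extra = no_cycle V E n d r for V :: "'a set" and E n d r +
  fixes vx :: "int \<Rightarrow> 'a" and ed :: "int \<Rightarrow> 'a set" and F :: "'a set set"
  assumes fr: "frame vx ed"
    and FE: "X \<in> F \<Longrightarrow> X \<in> E" and FR: "X \<in> F \<Longrightarrow> X \<notin> range ed" and F0: "X \<in> F \<Longrightarrow> vx 0 \<in> X"
    and cF: "6 \<le> card F" and r3: "3 \<le> r"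
begin

lemma finF: "finite F" using cF by (metis card.infinite not_numeral_le_zero)

lemma F_notin [simp]: "X \<in> F \<Longrightarrow> X \<notin> ed ` S" using FR by auto

lemma F_free_d: "X \<in> F \<Longrightarrow> free_set n d r (pos vx X)"
  by (rule free_set_d[OF fr FE FR])

lemma F_free_m: "X \<in> F \<Longrightarrow> free_set n (n - d) r (pos vx X)"
  by (rule free_set_m[OF fr FE FR])

lemma F_eqI:
  assumes "X \<in> F" "Y \<in> F" "\<And>t. c \<le> t \<Longrightarrow> t < c + n \<Longrightarrow> vx t \<in> X \<longleftrightarrow> vx t \<in> Y"
  shows "X = Y"
proof -
  have "vx t \<in> X \<longleftrightarrow> vx t \<in> Y" for t
  proof -
    let ?t = "c + (t - c) mod n"
    have "?t mod n = t mod n" by (simp add: mod_simps)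
    then have "vx ?t = vx t" using frame_vx[OF fr, of ?t t] by blast
    moreover have "c \<le> ?t" "?t < c + n" using n_pos by simp_all
    ultimately show ?thesis using assms(3) by metis
  qed
  then have "pos vx X = pos vx Y" by auto
  then show ?thesis using pos_eq[OF fr] FE assms by blast
qed

text \<open>By \<open>far_unique\<close> the far parts of the edges are disjoint. Six sets of at
  least \<open>r - d\<close> positions do not fit into
  \<open>n - 2 * d - 1 <= 2 * (r - d) + 1\<close>.\<close>

lemma short_cycles:
  assumes n: "2 * r < n" "n \<le> 2 * r + 2" and d: "d < r"
  shows False
proof -
  let ?W = "{d + 1..n - d - 1}"
  let ?c = "\<lambda>X. pos vx X \<inter> ?W"
  have dis: "?c X \<inter> ?c Y = {}" if "X \<in> F" "Y \<in> F" "X \<noteq> Y" for X Y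
  proof (rule ccontr)
    assume "\<not> ?thesis"
    then obtain w where "w \<in> ?c X" "w \<in> ?c Y" by blast
    then show False
      using far_unique[OF fr FE[OF that(1)] FR[OF that(1)] FE[OF that(2)] FR[OF that(2)] F0[OF that(1)] F0[OF that(2)], of w] n that(3)
      by auto
  qed
  have "card (\<Union>X\<in>F. ?c X) = (\<Sum>X\<in>F. card (?c X))"
    by (rule card_UN_disjoint) (use finF dis in auto)
  moreover have "card (\<Union>X\<in>F. ?c X) \<le> card ?W" by (rule card_mono) auto
  moreover have "card F * nat (r - d) \<le> (\<Sum>X\<in>F. card (?c X))"
  proof -
    have "nat (r - d) \<le> card (?c X)" if "X \<in> F" for X
      using many_far[OF fr FE[OF that] FR[OF that] F0[OF that]] by linarith
    from sum_bounded_below[of F "nat (r - d)" "\<lambda>X. card (?c X)", OF this] show ?thesis by simp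
  qed
  moreover have "6 * nat (r - d) \<le> card F * nat (r - d)" using cF by (rule mult_right_mono) simp
  ultimately have "6 * nat (r - d) \<le> card ?W" by linarith
  then show False using n d by simp
qed

text \<open>Apart from 0, all positions of \<open>X\<close> lie in \<open>r - 1\<close> disjoint
  pairs \<open>x\<close>, \<open>x - r\<close>, each meeting \<open>X\<close> at most once. Since
  \<open>X\<close> has \<open>r\<close> positions, every pair is met.\<close>

lemma column_full:
  assumes d: "d = r" and X: "X \<in> F" and n: "n = 2 * r + 1 \<or> n = 2 * r + 2" and last: "n = 2 * r + 2 \<Longrightarrow> vx (r + 1) \<notin> X"
    and x: "1 \<le> x" "x \<le> r - 1"
  shows "vx x \<in> X \<longleftrightarrow> vx (x - r) \<notin> X"
proof -
  let ?P = "pos vx X"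
  interpret free_set n r r ?P using F_free_d[OF X] d by simp
  have z: "0 \<in> ?P" using F0[OF X] by simp
  have nd: "r \<notin> ?P" "- r \<notin> ?P" using free[of 0] free[of "- r"] z by auto
  let ?U = "?P \<inter> {1 - r..<1 - r + (r - 1)}" and ?W = "?P \<inter> {1 - r + r..<1 - r + r + (r - 1)}"
  have "?P \<inter> {- r..<- r + n} \<subseteq> insert 0 (?U \<union> ?W)"
  proof
    fix x assume x: "x \<in> ?P \<inter> {- r..<- r + n}"
    then have "x \<noteq> r" "x \<noteq> - r" "x \<noteq> r + 1" using nd n last by auto
    then show "x \<in> insert 0 (?U \<union> ?W)" using x n by auto
  qed
  then have "card (?P \<inter> {- r..<- r + n}) \<le> card (insert 0 (?U \<union> ?W))" by (intro card_mono) auto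
  also have "\<dots> \<le> Suc (card (?U \<union> ?W))" by (rule card_insert_le_m1) auto
  also have "card (?U \<union> ?W) \<le> card ?U + card ?W" by (rule card_Un_le)
  finally have "r \<le> 1 + int (card ?U) + int (card ?W)" using card_win[of "- r"] by simp
  then have "int (card (defect \<inter> {1 - r + r..<1 - r + r + (r - 1)})) \<le> 0" using window_split[of "r - 1" "1 - r"] r3 by linarith
  then have "defect \<inter> {1 - r + r..<1 - r + r + (r - 1)} = {}" by simp
  then show ?thesis using free'[of x] x by (auto simp: defect_iff)
qed

text \<open>The distances \<open>r\<close> and \<open>r + 1\<close> are both forbidden, which makes
  each edge an interval \<open>p - r + 1..p\<close> around 0. If two values of \<open>p\<close>
  differ by more than 2, a cycle through the common vertex 0 arises; so there are at most three
  edges.\<close>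

lemma middle_odd:
  assumes n: "n = 2 * r + 1" and d: "d = r"
  shows False
proof -
  have form: "\<exists>p\<in>{0..r - 1}. \<forall>t\<in>{- r..r}. vx t \<in> X \<longleftrightarrow> p - r + 1 \<le> t \<and> t \<le> p" if X: "X \<in> F" for X
  proof -
    let ?P = "pos vx X"
    interpret free_set n r r ?P using F_free_d[OF X] d by simp
    interpret m: free_set n "r + 1" r ?P using F_free_m[OF X] n d by simp
    have z: "0 \<in> ?P" using F0[OF X] by simp
    have nd: "r \<notin> ?P" "- r \<notin> ?P" using free[of 0] free[of "- r"] z by auto
    have one: "x \<in> ?P \<longleftrightarrow> x - r \<notin> ?P" if "1 \<le> x" "x \<le> r - 1" for x
      using column_full[OF d X _ _ that] n by simp
    have step: "x - 1 \<in> ?P" if "2 \<le> x" "x \<le> r - 1" "x \<in> ?P" for x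
      using m.free'[of x] one[of "x - 1"] that by (simp add: algebra_simps)
    define p where "p = Max (?P \<inter> {0..r - 1})"
    have p: "p \<in> ?P \<inter> {0..r - 1}" unfolding p_def by (rule Max_in) (use z r3 in auto)
    have pm: "t \<le> p" if "t \<in> ?P" "0 \<le> t" "t \<le> r - 1" for t unfolding p_def by (rule Max_ge) (use that in auto)
    have dn: "p - int j \<in> ?P" if "0 \<le> p - int j" for j
      using that
    proof (induction j)
      case (Suc j)
      then show ?case using step[of "p - int j"] p z by (cases "p - int j = 1") (auto simp: algebra_simps)
    qed (use p in simp)
    have right: "t \<in> ?P \<longleftrightarrow> t \<le> p" if "0 \<le> t" "t \<le> r - 1" for t
      using dn[of "nat (p - t)"] pm[of t] that by auto
    have "t \<in> ?P \<longleftrightarrow> p - r + 1 \<le> t \<and> t \<le> p" if t: "t \<in> {- r..r}" for t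
    proof (cases "0 \<le> t")
      case True
      then show ?thesis using right[of t] nd p t by (cases "t = r") auto
    next
      case False
      then show ?thesis using right[of "t + r"] one[of "t + r"] nd p t by (cases "t = - r") auto
    qed
    then show ?thesis using p by auto
  qed
  then obtain p where p: "\<And>X. X \<in> F \<Longrightarrow> p X \<in> {0..r - 1}"
    "\<And>X t. X \<in> F \<Longrightarrow> t \<in> {- r..r} \<Longrightarrow> vx t \<in> X \<longleftrightarrow> p X - r + 1 \<le> t \<and> t \<le> p X" by metis
  have inj: "inj_on p F"
  proof (rule inj_onI)
    fix X Y assume "X \<in> F" "Y \<in> F" "p X = p Y"
    then show "X = Y" by (intro F_eqI[of _ _ "- r"]) (use p n in auto)
  qed
  have near: "p X \<le> p Y + 2" if "X \<in> F" "Y \<in> F" for X Y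
  proof (rule ccontr)
    assume neg: "\<not> ?thesis"
    have b: "0 \<le> p Y" "p X \<le> r - 1" using p(1) that by auto
    have "vx (p X) \<in> X" using p(2)[OF that(1), of "p X"] neg b r3 by simp
    moreover have "X \<noteq> Y" using neg by auto
    ultimately have "vx (p X + d - 1) \<notin> Y"
      using common_vertex[OF fr FE FE, of X Y "p X" 0] that F0 neg b n d by simp
    moreover have "p X + d - 1 = p X - r - 2 + n" using n d by simp
    then have "vx (p X + d - 1) = vx (p X - r - 2 + n)" by (rule arg_cong)
    then have "vx (p X + d - 1) = vx (p X - r - 2)" by (simp only: frame_period[OF fr])
    ultimately show False using p(2)[OF that(2), of "p X - r - 2"] neg b by simp
  qed
  define q where "q = Min (p ` F)"
  have ne: "p ` F \<noteq> {}" using cF by auto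
  have "q \<in> p ` F" unfolding q_def by (rule Min_in) (use finF ne in auto)
  moreover have "q \<le> p X" if "X \<in> F" for X unfolding q_def by (rule Min_le) (use finF that in auto)
  ultimately have "p ` F \<subseteq> {q..q + 2}" using near by force
  then have "card (p ` F) \<le> card {q..q + 2}" by (intro card_mono) auto
  then show False using card_image[OF inj] cF by simp
qed

lemma middle_even:
  assumes n: "n = 2 * r + 2" and d: "d = r"
  shows False
proof -
  let ?G = "{X \<in> F. vx (r + 1) \<notin> X}"
  \<comment> \<open>Position \<open>r + 1\<close> is at distance \<open>d + 1\<close> from 0 both
    ways, so \<open>far_unique\<close> applies to it.\<close>
  have cG: "5 \<le> card ?G"
  proof -
    let ?H = "{X \<in> F. vx (r + 1) \<in> X}"
    have "card ?H \<le> Suc 0"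
    proof (subst card_le_Suc0_iff_eq)
      show "\<forall>X\<in>?H. \<forall>Y\<in>?H. X = Y"
        using far_unique[OF fr FE FR FE FR F0 F0, of _ _ "r + 1"] n d by auto
    qed (use finF in auto)
    moreover have "card F = card ?G + card ?H"
      by (subst card_Un_disjoint[symmetric]) (use finF in \<open>auto intro!: arg_cong[of _ _ card]\<close>)
    ultimately show ?thesis using cF by simp
  qed
  have one: "vx x \<in> X \<longleftrightarrow> vx (x - r) \<notin> X" if "X \<in> ?G" "1 \<le> x" "x \<le> r - 1" for X x
    using column_full[OF d, of X x] n that by simp
  have step: "vx (x - 2) \<in> X" if "X \<in> ?G" "3 \<le> x" "x \<le> r - 1" "vx x \<in> X" for X x
  proof -
    interpret free_set n "r + 2" r "pos vx X" using F_free_m[of X] that(1) n d by simp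
    show ?thesis using free'[of x] one[OF that(1), of "x - 2"] that by (simp add: algebra_simps)
  qed
  have down: "vx (x - 2 * int j) \<in> X" if "X \<in> ?G" "x \<le> r - 1" "vx x \<in> X" "1 \<le> x - 2 * int j" for X x j
    using that(4)
  proof (induction j)
    case (Suc j)
    then show ?case using step[OF that(1), of "x - 2 * int j"] that(2) by (simp add: algebra_simps)
  qed (use that in simp)
  have eqI: "X = Y" if "X \<in> ?G" "Y \<in> ?G" and ag: "\<And>x. 1 \<le> x \<Longrightarrow> x \<le> r - 1 \<Longrightarrow> vx x \<in> X \<longleftrightarrow> vx x \<in> Y" for X Y
  proof (rule F_eqI[of _ _ "- r"])
    fix t assume t: "- r \<le> t" "t < - r + n"
    have "vx r \<notin> X" "vx r \<notin> Y" "vx (- r) \<notin> X" "vx (- r) \<notin> Y"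
      using extra_free(1)[OF fr FE FR, of X 0] extra_free(1)[OF fr FE FR, of X "- r"]
       extra_free(1)[OF fr FE FR, of Y 0] extra_free(1)[OF fr FE FR, of Y "- r"] that(1,2) F0 d by auto
    moreover have "vx 0 \<in> X" "vx 0 \<in> Y" using F0 that by auto
    moreover have "vx t \<in> X \<longleftrightarrow> vx t \<in> Y" if "- r < t" "t < 0"
      using one[OF \<open>X \<in> ?G\<close>, of "t + r"] one[OF \<open>Y \<in> ?G\<close>, of "t + r"] ag[of "t + r"] that by simp
    moreover have "t = - r \<or> - r < t \<and> t < 0 \<or> t = 0 \<or> 1 \<le> t \<and> t \<le> r - 1 \<or> t = r \<or> t = r + 1" using t n by auto
    ultimately show "vx t \<in> X \<longleftrightarrow> vx t \<in> Y" using that(1,2) ag[of t] by auto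
  qed (use that in auto)
  \<comment> \<open>The position \<open>x - r\<close> of \<open>X\<close> and the position
    \<open>x\<close> of \<open>Y\<close> are at distance \<open>d\<close>, so
    \<open>crossing\<close> forbids every cut between them with \<open>X\<close> above and
    \<open>Y\<close> below. The cuts on the two sides of 0 give the claims.\<close>
  have ends: "vx 1 \<notin> X \<and> vx (r - 1) \<in> Y" if XY: "X \<in> ?G" "Y \<in> ?G" "X \<noteq> Y" and x: "1 \<le> x" "x \<le> r - 1" "vx x \<notin> X" "vx x \<in> Y" for X Y x
  proof -
    have xr: "vx (x - r) \<in> X" "vx (x - r + d) \<in> Y" using one[OF XY(1) x(1,2)] x d by auto
    have e: "X \<in> E" "Y \<in> E" "vx 0 \<in> X" "vx 0 \<in> Y" using FE F0 XY by auto
    have "vx (z - 1) \<notin> Y" if "x - r < z" "z \<le> x" "vx z \<in> X" for z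
      by (rule crossing[OF fr e(1,2) XY(3) _ _ _ _ xr that(3)]) (use that XY d in auto)
    from this[of 0] this[of 1] show ?thesis using x e one[OF XY(2), of "r - 1"] r3 by auto
  qed
  have diff: "vx 1 \<notin> X \<and> vx (r - 1) \<in> Y \<or> vx 1 \<notin> Y \<and> vx (r - 1) \<in> X" if XY: "X \<in> ?G" "Y \<in> ?G" "X \<noteq> Y" for X Y
  proof -
    obtain x where "1 \<le> x" "x \<le> r - 1" "(vx x \<in> X) \<noteq> (vx x \<in> Y)" using eqI[OF XY(1,2)] XY(3) by blast
    then show ?thesis using ends[OF XY] ends[OF XY(2,1) XY(3)[symmetric]] by auto
  qed
  have c3: "3 \<le> card ?G" "2 \<le> card ?G" using cG by auto
  have "even r \<or> odd r \<and> 5 \<le> r \<or> r = 3" using r3 by presburger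
  then consider "even r" | "odd r" "5 \<le> r" | "r = 3" by blast
  then show False
  proof cases
    case 1
    \<comment> \<open>For even \<open>r\<close>, steps of length 2 lead from \<open>r - 1\<close>
      down to 1. By \<open>diff\<close>, any two edges then disagree at position 1, which three
      edges cannot do.\<close>
    have low: "vx 1 \<in> X" if "X \<in> ?G" "vx (r - 1) \<in> X" for X
      using down[OF that(1) _ that(2), of "nat (r - 2) div 2"] 1 r3 by (auto simp: zdiv_int dvd_div_mult_self elim!: evenE)
    obtain X Y Z where "X \<in> ?G" "Y \<in> ?G" "Z \<in> ?G" "X \<noteq> Y" "Y \<noteq> Z" "X \<noteq> Z" using three_elements[OF c3(1)] .
    then show False using diff[of X Y] diff[of Y Z] diff[of X Z] low by blast
  next
    case 2
    \<comment> \<open>For odd \<open>r\<close> the steps from \<open>r - 4\<close> reach 1, so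
      \<open>X\<close> misses \<open>r - 4\<close> and contains \<open>- 4\<close>. That position
      and \<open>r - 1\<close> in \<open>Y\<close> close a cycle through 0, because
      \<open>r - 1 + d - 1\<close> is congruent to \<open>- 4\<close>.\<close>
    have bad: False if XY: "X \<in> ?G" "Y \<in> ?G" "X \<noteq> Y" and v: "vx 1 \<notin> X" "vx (r - 1) \<in> Y" for X Y
    proof -
      have "vx (r - 4) \<notin> X"
      proof
        assume "vx (r - 4) \<in> X"
        then have "vx 1 \<in> X" using down[OF XY(1), of "r - 4" "nat (r - 5) div 2"] 2 by (auto simp: zdiv_int elim!: oddE)
        then show False using v by simp
      qed
      then have "vx (- 4) \<in> X" using one[OF XY(1), of "r - 4"] 2 by simp
      have "vx (r - 1 + d - 1) \<notin> X"
        by (rule common_vertex[OF fr FE FE XY(3)[symmetric], of "r - 1" 0]) (use XY F0 v n d r3 in auto)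
      moreover have "vx (r - 1 + d - 1) = vx (- 4)" using frame_period[OF fr, of "- 4"] n d by simp
      ultimately show False using \<open>vx (- 4) \<in> X\<close> by simp
    qed
    obtain X Y where "X \<in> ?G" "Y \<in> ?G" "X \<noteq> Y" using two_elements[OF c3(2)] .
    then show False using diff[of X Y] bad[of X Y] bad[of Y X] by blast
  next
    case 3
    \<comment> \<open>For \<open>r = 3\<close> only the positions 1 and 2 are undetermined: four
      patterns for five edges.\<close>
    let ?f = "\<lambda>X. (vx 1 \<in> X, vx 2 \<in> X)"
    have "inj_on ?f ?G"
    proof (rule inj_onI)
      fix X Y assume *: "X \<in> ?G" "Y \<in> ?G" "?f X = ?f Y"
      have "x = 1 \<or> x = 2" if "1 \<le> x" "x \<le> r - 1" for x using that 3 by auto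
      then show "X = Y" using eqI[OF *(1,2)] *(3) by fastforce
    qed
    then have "card ?G = card (?f ` ?G)" by (simp only: card_image)
    also have "\<dots> \<le> card (UNIV :: (bool \<times> bool) set)" by (rule card_mono) auto
    finally show False using cG by (simp add: card_UNIV_bool card_cartesian_product flip: UNIV_Times_UNIV)
  qed
qed

end

section \<open>Long cycles for odd $n$\<close>

context no_cycle
begin

lemma qpair_edge:
  assumes fr: "frame vx ed" and X: "X \<in> E" "X \<notin> range ed" and mn: "2 * (n - d) \<le> n"
    and q: "vx q \<in> X" "vx (q + 1) \<in> X"
  shows "qpair n (n - d) r (pos (\<lambda>i. vx (i + q)) X) (pos (\<lambda>i. vx (i + q)) (ed q))"
proof -
  note s = frame_shift[OF fr, of q]
  have XR: "X \<notin> range (\<lambda>i. ed (i + q))" using s(2) X(2) by simp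
  have e0: "vx (0 + q) \<in> ed (0 + q)" "vx (1 + q) \<in> ed (0 + q)" "vx (0 + q) \<in> X" "vx (1 + q) \<in> X"
    using frame_inc[OF fr, of q] q by (simp_all add: add.commute)
  have "qpair n (n - d) r (pos (\<lambda>i. vx (i + q)) X) (pos (\<lambda>i. vx (i + q)) (ed (0 + q)))"
  proof (rule qpair_intro[OF s(1) avail_extra[OF X(1) XR] avail_zero[OF s(1)] _ _ _ _ _ _ _ mn])
    show "X \<noteq> ed (0 + q)" using X by auto
    show "vx (x + (n - d) + q) \<notin> X" if "vx (x + q) \<in> X" for x
      using extra_free(2)[OF fr X that] by (simp add: algebra_simps)
    show "vx (x + (n - d) + q) \<notin> ed (0 + q)" if "vx (x + q) \<in> ed (0 + q)" for x
      using replaced_free(2)[OF fr X q, of "x + q"] that by (simp add: algebra_simps)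
  qed (use e0 in auto)
  then show ?thesis by simp
qed

text \<open>This is \<open>odd_flip\<close> carried back to position \<open>q\<close>:
  \<open>s..s + m - 1\<close> is a maximal run of \<open>X\<close>, and \<open>ed q\<close> is
  \<open>X\<close> with this run moved by one position, upwards in the first alternative and
  downwards in the second.\<close>

lemma odd_run:
  assumes fr: "frame vx ed" and X: "X \<in> E" "X \<notin> range ed" and n: "n = 2 * r + 1" and m: "m = n - d" "2 * m \<le> n"
    and q: "vx q \<in> X" "vx (q + 1) \<in> X"
  obtains s where "s \<le> q" "q + 1 \<le> s + m - 1" "\<And>x. s \<le> x \<Longrightarrow> x \<le> s + m - 1 \<Longrightarrow> vx x \<in> X"
    "vx (s - 1) \<notin> X" "vx (s + m) \<notin> X"
    "s < q \<and> (\<forall>y. vx y \<in> ed q \<longleftrightarrow> y mod n \<noteq> s mod n \<and> (y mod n = (s + m) mod n \<or> vx y \<in> X)) \<or>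
     q + 1 < s + m - 1 \<and> (\<forall>y. vx y \<in> ed q \<longleftrightarrow> y mod n \<noteq> (s + m - 1) mod n \<and> (y mod n = (s - 1) mod n \<or> vx y \<in> X))"
proof -
  let ?v = "\<lambda>i. vx (i + q)"
  let ?A = "pos ?v X" and ?B = "pos ?v (ed q)"
  interpret qpair n m r ?A ?B using qpair_edge[OF fr X _ q] m by simp
  have md: "y mod n = x mod n \<longleftrightarrow> (y - q) mod n = (x - q) mod n" for x y :: int by (simp add: mod_eq_dvd_iff)
  have "?A \<noteq> ?B"
    using pos_eq[OF frame_shift(1)[OF fr, of q] X(1) frame_inE[OF fr, of q]] X by (metis rangeI)
  from n this show thesis
  proof (cases rule: odd_flip)
    case (1 z)
    let ?s = "z - m + q"
    have run: "vx x \<in> X" if "?s \<le> x" "x \<le> ?s + m - 1" for x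
    proof -
      have "x - q \<in> ?A" using 1(7) that by (intro subsetD[OF 1(7)]) simp
      then show ?thesis by simp
    qed
    have B: "vx y \<in> ed q \<longleftrightarrow> y mod n \<noteq> ?s mod n \<and> (y mod n = (?s + m) mod n \<or> vx y \<in> X)" for y
    proof -
      have c: "(y - q) mod n = w mod n \<Longrightarrow> (vx y \<in> ed q \<longleftrightarrow> w \<in> ?B)" for w using B.cong[of "y - q" w] by simp
      have e: "y mod n = ?s mod n \<longleftrightarrow> (y - q) mod n = (z - m) mod n" "y mod n = (?s + m) mod n \<longleftrightarrow> (y - q) mod n = z mod n"
        using md[of y ?s] md[of y "?s + m"] by simp_all
      show ?thesis
        unfolding e using c[of z] c[of "z - m"] 1(3,6) 1(8)[of "y - q"] mod_neq[of "z - m" z n] m2 n_gt by auto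
    qed
    show thesis
    proof (rule that[of ?s])
      show "vx (?s - 1) \<notin> X" using A.free'[of "z - 1"] run[of "?s + m - 1"] m2 by (auto simp: algebra_simps)
      show "vx (?s + m) \<notin> X" using 1(4) by simp
    qed (use 1(1,2) run B in auto)
  next
    case (2 z)
    let ?s = "z - m + 1 + q"
    have zn: "z mod n \<noteq> (z - m) mod n" using mod_neq[of "z - m" z n] m2 n_gt by auto
    have run: "vx x \<in> X" if "?s \<le> x" "x \<le> ?s + m - 1" for x
    proof (cases "x - q = z")
      case False
      have "x - q \<in> ?B" using that False by (intro subsetD[OF 2(7)]) simp
      moreover have "(x - q) mod n \<noteq> z mod n" "(x - q) mod n \<noteq> (z - m) mod n"
        by (rule mod_neq; use that False n_gt m2 in simp)+
      ultimately show ?thesis using 2(8)[of "x - q"] by simp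
    qed (use 2(3) in auto)
    have B: "vx y \<in> ed q \<longleftrightarrow> y mod n \<noteq> (?s + m - 1) mod n \<and> (y mod n = (?s - 1) mod n \<or> vx y \<in> X)" for y
    proof -
      have c: "(y - q) mod n = w mod n \<Longrightarrow> (vx y \<in> ed q \<longleftrightarrow> w \<in> ?B)" for w using B.cong[of "y - q" w] by simp
      have e: "y mod n = (?s - 1) mod n \<longleftrightarrow> (y - q) mod n = (z - m) mod n" "y mod n = (?s + m - 1) mod n \<longleftrightarrow> (y - q) mod n = z mod n"
        using md[of y "?s - 1"] md[of y "?s + m - 1"] by simp_all
      show ?thesis
        unfolding e using c[of z] c[of "z - m"] 2(4,5) 2(8)[of "y - q"] zn by auto
    qed
    show thesis
    proof (rule that[of ?s])
      show "vx (?s - 1) \<notin> X" using 2(6) by (simp add: algebra_simps)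
      show "vx (?s + m) \<notin> X" using A.free[of "z - m + 1"] run[of ?s] m2 by (auto simp: algebra_simps)
    qed (use 2(1,2) run B in auto)
  qed
qed

text \<open>Otherwise \<open>X\<close> alternates apart from one gap of two positions. As
  \<open>m + d = n\<close> is odd, \<open>m\<close> or \<open>d\<close> is even, and two elements at
  that forbidden distance appear right after the gap.\<close>

lemma odd_consecutive:
  assumes fr: "frame vx ed" and X: "X \<in> E" "X \<notin> range ed" and n: "n = 2 * r + 1" and m: "m = n - d" "2 * m \<le> n"
  obtains q where "vx q \<in> X" "vx (q + 1) \<in> X"
proof (rule ccontr)
  assume neg: "\<not> thesis"
  let ?A = "pos vx X"
  interpret free_set n 1 r ?A
    by unfold_locales (use pos_periodic[OF fr X(1)] neg that n_pos in auto)
  have "card (defect \<inter> {0..<0 + n}) = 1" using card_defect[of 0] n by simp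
  then obtain z where z: "z \<in> defect" by (metis IntE card_1_singletonE insertI1)
  have nd: "x \<notin> defect" if "z < x" "x < z + n" for x
    using defect_unique[OF n z, of x] mod_neq[of z x n] that by auto
  have up: "z + 1 + 2 * int j \<in> ?A" if "1 + 2 * int j \<le> n - 2" for j
    using that
  proof (induction j)
    case 0
    then show ?case using nd[of "z + 1"] z by (auto simp: defect_iff)
  next
    case (Suc j)
    then have "z + 1 + 2 * int j \<in> ?A" by simp
    then have "z + 2 + 2 * int j \<notin> ?A" using free[of "z + 1 + 2 * int j"] by (simp add: algebra_simps)
    then show ?case using nd[of "z + 3 + 2 * int j"] Suc.prems by (auto simp: defect_iff algebra_simps)
  qed
  have m2: "2 \<le> m" using m d_le by simp
  have z1: "vx (z + 1) \<in> X" using up[of 0] m m2 by simp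
  show False
  proof (cases "even m")
    case True
    have "3 \<le> d" using m m2 n by presburger
    with True have "z + 1 + m \<in> ?A" using up[of "nat (m div 2)"] m m2 by simp
    then show False using extra_free(2)[OF fr X z1] m by simp
  next
    case False
    then have "even d" "3 \<le> m" using m m2 n by presburger+
    then have "z + 1 + d \<in> ?A" using up[of "nat (d div 2)"] m d_pos by simp
    then show False using extra_free(1)[OF fr X z1] by simp
  qed
qed

text \<open>Every \<open>q\<close> in the run makes \<open>ed q\<close> one of only two sets, the
  run moved up or down, and distinct cycle edges are distinct sets; so \<open>m <= 3\<close>. The
  first and last \<open>q\<close> allow one direction each, which rules out
  \<open>m = 2\<close>.\<close>

lemma odd_long_run:
  assumes fr: "frame vx ed" and X: "X \<in> E" "X \<notin> range ed" and n: "n = 2 * r + 1" and m: "m = n - d" "2 * m \<le> n" and r3: "3 \<le> r"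
  shows "m = 3 \<and> n = 7 \<and> (\<exists>s. vx s \<in> X \<and> vx (s + 1) \<in> X \<and> vx (s + 2) \<in> X)"
proof -
  obtain q0 where q0: "vx q0 \<in> X" "vx (q0 + 1) \<in> X" using odd_consecutive[OF fr X n m] .
  obtain s where s: "s \<le> q0" "q0 + 1 \<le> s + m - 1" and run: "\<And>x. s \<le> x \<Longrightarrow> x \<le> s + m - 1 \<Longrightarrow> vx x \<in> X"
    and out: "vx (s - 1) \<notin> X" "vx (s + m) \<notin> X"
    using odd_run[OF fr X n m q0] by metis
  define P1 where "P1 q \<longleftrightarrow> s < q \<and> (\<forall>y. vx y \<in> ed q \<longleftrightarrow> y mod n \<noteq> s mod n \<and> (y mod n = (s + m) mod n \<or> vx y \<in> X))" for q
  define P2 where "P2 q \<longleftrightarrow> q + 1 < s + m - 1 \<and> (\<forall>y. vx y \<in> ed q \<longleftrightarrow> y mod n \<noteq> (s + m - 1) mod n \<and> (y mod n = (s - 1) mod n \<or> vx y \<in> X))" for q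
  have P: "P1 q \<or> P2 q" if q: "s \<le> q" "q + 1 \<le> s + m - 1" for q
  proof -
    have qX: "vx q \<in> X" "vx (q + 1) \<in> X" using run q by auto
    obtain u where u: "u \<le> q" "q + 1 \<le> u + m - 1" "\<And>x. u \<le> x \<Longrightarrow> x \<le> u + m - 1 \<Longrightarrow> vx x \<in> X"
      "vx (u - 1) \<notin> X" "vx (u + m) \<notin> X"
      "u < q \<and> (\<forall>y. vx y \<in> ed q \<longleftrightarrow> y mod n \<noteq> u mod n \<and> (y mod n = (u + m) mod n \<or> vx y \<in> X)) \<or>
       q + 1 < u + m - 1 \<and> (\<forall>y. vx y \<in> ed q \<longleftrightarrow> y mod n \<noteq> (u + m - 1) mod n \<and> (y mod n = (u - 1) mod n \<or> vx y \<in> X))"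
      by (rule odd_run[OF fr X n m qX]) (rule that)
    have "u = s"
      using u(3)[of "s - 1"] out(1) run[of "u - 1"] u(1,2,4) q by (cases u s rule: linorder_cases) auto
    then show ?thesis using u(6) unfolding P1_def P2_def by simp
  qed
  have same: "q = q'" if "P1 q \<and> P1 q' \<or> P2 q \<and> P2 q'" "\<bar>q - q'\<bar> < n" for q q'
  proof -
    have "vx y \<in> ed q \<longleftrightarrow> vx y \<in> ed q'" for y using that unfolding P1_def P2_def by metis
    then have "pos vx (ed q) = pos vx (ed q')" by auto
    then have "ed q = ed q'" using pos_eq[OF fr frame_inE[OF fr] frame_inE[OF fr]] by blast
    then show ?thesis using frame_ed[OF fr, of q q'] mod_eq_close[of q n q'] that by simp
  qed
  have m2: "2 \<le> m" using m d_le by simp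
  have a: "P2 s" using P[of s] m2 by (auto simp: P1_def)
  have b: "P1 (s + m - 2)" using P[of "s + m - 2"] m2 by (auto simp: P2_def)
  have "m \<noteq> 2" using a by (auto simp: P2_def)
  moreover have "\<not> 4 \<le> m"
  proof
    assume "4 \<le> m"
    then show False using P[of "s + 1"] same[of s "s + 1"] same[of "s + 1" "s + m - 2"] a b m by auto
  qed
  ultimately have m3: "m = 3" using m2 by simp
  interpret A: free_set n m r "pos vx X" using free_set_m[OF fr X] m by simp
  have inc: "vx s \<in> X" "vx (s + 1) \<in> X" "vx (s + 2) \<in> X" using run m3 by auto
  have B1: "vx y \<in> ed (s + 1) \<longleftrightarrow> y mod n \<noteq> s mod n \<and> (y mod n = (s + 3) mod n \<or> vx y \<in> X)" for y
  proof -
    have "s + m - 2 = s + 1" using m3 by simp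
    then have "P1 (s + 1)" using b by (simp only:)
    then show ?thesis unfolding P1_def m3 by blast
  qed
  have B2: "vx y \<in> ed s \<longleftrightarrow> y mod n \<noteq> (s + 2) mod n \<and> (y mod n = (s - 1) mod n \<or> vx y \<in> X)" for y
  proof -
    have "s + m - 1 = s + 2" using m3 by simp
    then show ?thesis using a unfolding P2_def by presburger
  qed
  have neq: "(s + a) mod n \<noteq> (s + b) mod n" if "a \<noteq> b" "\<bar>a - b\<bar> < 7" for a b
    using mod_neq[of "s + a" "s + b" n] that n r3 by simp
  have nd: "n - d = 3" using m m3 by simp
  \<comment> \<open>For \<open>m = 3\<close> the freeness of the two moved runs yields an empty
    column of \<open>X\<close> on each side, at \<open>s + 6\<close> and at \<open>s - 1\<close>.
    There is only one modulo \<open>n\<close>, so \<open>n\<close> divides 7.\<close>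
  have f1: "vx (s + 6) \<notin> ed (s + 1)"
  proof -
    have i: "vx (s + 1 + 1) \<in> X" using inc(3) by (simp add: add.assoc)
    have "vx (s + 3) \<in> ed (s + 1)" using B1[of "s + 3"] neq[of 3 0] by simp
    from replaced_free(2)[OF fr X inc(2) i this] show ?thesis unfolding nd by (simp add: add.assoc)
  qed
  have "vx (s + 6) \<notin> X" using f1 B1[of "s + 6"] neq[of 6 0] by simp
  then have d1: "s + 6 \<in> A.defect" unfolding A.defect_iff using out m3 by (auto simp: add.commute)
  have "vx (s - 4) \<notin> ed s"
  proof
    assume "vx (s - 4) \<in> ed s"
    from replaced_free(2)[OF fr X inc(1,2) this] have "vx (s - 1) \<notin> ed s" unfolding nd by simp
    then show False using B2[of "s - 1"] neq[of "- 1" 2] by simp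
  qed
  then have "vx (s - 4) \<notin> X" using B2[of "s - 4"] neq[of 2 "- 4"] by auto
  then have d2: "s - 1 \<in> A.defect" unfolding A.defect_iff using out m3 by (auto simp: add.commute)
  have "(s + 6) mod n = (s - 1) mod n" by (rule A.defect_unique[OF n d1 d2])
  then have "n dvd 7" by (simp add: mod_eq_dvd_iff)
  then have "n \<le> 7" by (rule zdvd_imp_le) simp
  then show ?thesis using m3 inc n r3 by auto
qed

end

context six_extra
begin

text \<open>A run of three positions is the whole edge when \<open>r = 3\<close>, and only three
  such runs contain position 0.\<close>

lemma long_odd:
  assumes n: "n = 2 * r + 1" and d: "r < d"
  shows False
proof -
  let ?T = "\<lambda>s. {vx s, vx (s + 1), vx (s + 2)}"
  have "X \<in> ?T ` {- 2, - 1, 0}" if X: "X \<in> F" for X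
  proof -
    obtain s where s: "n = 7" "vx s \<in> X" "vx (s + 1) \<in> X" "vx (s + 2) \<in> X"
      using odd_long_run[OF fr FE[OF X] FR[OF X] n refl _ r3] n d by auto
    have dist: "vx (s + a) \<noteq> vx (s + b)" if "a \<noteq> b" "\<bar>a - b\<bar> < 7" for a b
      using frame_vx[OF fr] mod_neq[of "s + a" "s + b" n] that s(1) by simp
    have "card (?T s) = 3" using dist[of 0 1] dist[of 0 2] dist[of 1 2] by simp
    moreover have "int (card X) = 3" using edge_card[OF FE[OF X]] n s(1) by simp
    moreover have "finite X" using calculation by (metis card.infinite of_nat_0 zero_neq_numeral)
    ultimately have XT: "X = ?T s" using s by (intro card_subset_eq[symmetric]) auto
    have "vx 0 \<in> ?T s" using F0[OF X] XT by simp
    then consider "vx 0 = vx (s + 0)" | "vx 0 = vx (s + 1)" | "vx 0 = vx (s + 2)" by auto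
    then obtain j where j: "j \<in> {0, 1, 2}" "0 mod n = (s + j) mod n"
      unfolding frame_vx[OF fr] by cases blast+
    have "vx (s + a) = vx (- j + a)" for a
    proof -
      have "n dvd s + j" using j(2) by (metis dvd_eq_mod_eq_0 mod_0)
      then have "(s + a) mod n = (- j + a) mod n" by (simp add: mod_eq_dvd_iff)
      then show ?thesis using frame_vx[OF fr] by blast
    qed
    from this[of 0] this[of 1] this[of 2] have "?T s = ?T (- j)" by (simp only: add_0_right)
    then have "X = ?T (- j)" using XT by (simp only:)
    moreover have "- j \<in> {- 2, - 1, 0}" using j(1) by auto
    ultimately show ?thesis by (rule image_eqI)
  qed
  then have "card F \<le> card (?T ` {- 2, - 1, 0})" by (intro card_mono) auto
  also have "\<dots> \<le> card {- 2, - 1, 0 :: int}" by (rule card_image_le) simp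
  finally show False using cF by simp
qed

end

section \<open>Two edges whose union is complementary to its translate\<close>

text \<open>Inside \<open>0..m\<close> the union is closed downwards, hence an initial segment
  \<open>0..p\<close>. Complementation under translation by \<open>m\<close> extends it to a block
  of length \<open>m\<close> ending at \<open>p\<close> and repeats this with period
  \<open>2 * m\<close>.\<close>

lemma (in qpair) ideal_block:
  assumes even: "n = 2 * r + 2" and z: "z \<in> B" "z \<notin> A" "z - m \<notin> A" "z + m \<notin> A"
  obtains a where "a \<le> 0" "2 \<le> a + m" "2 * m dvd n" "\<And>x. x \<in> A \<union> B \<longleftrightarrow> (x - a) mod (2 * m) < m"
proof -
  let ?S = "A \<union> B"
  note iu = ideal_union[OF even z]
  have anti: "x + m \<in> ?S \<longleftrightarrow> x \<notin> ?S" for x using iu(2,3) by blast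
  have anti': "x - m \<in> ?S \<longleftrightarrow> x \<notin> ?S" for x using anti[of "x - m"] by auto
  have per: "x + n \<in> ?S \<longleftrightarrow> x \<in> ?S" for x using A.per B.per by auto
  \<comment> \<open>By \<open>stepA\<close> and \<open>stepB\<close> the two positions would both be
    gained or both be lost, but only one position of each sort exists modulo
    \<open>n\<close>.\<close>
  have noLR: "\<not> (x \<in> ?S \<and> x - 1 - m \<in> ?S)" if x: "1 \<le> x" "x \<le> m + 1" for x
  proof
    assume s: "x \<in> ?S \<and> x - 1 - m \<in> ?S"
    have ne: "x mod n \<noteq> (x - 1 - m) mod n"
      by (rule mod_neq) (use m2 mn even in auto)
    note sA = stepA[OF x] and sB = stepB[OF x]
    consider "x \<in> A" "x \<notin> B" "x - 1 - m \<in> A" "x - 1 - m \<notin> B" | "x \<in> B" "x \<notin> A" "x - 1 - m \<in> B" "x - 1 - m \<notin> A"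
      using s sA sB by blast
    then show False
    proof cases
      case 1
      then show False using diff_single[of z "x - 1 - m" x] iu(1) ne by blast
    next
      case 2
      then show False using iu(1)[of x] iu(1)[of "x - 1 - m"] ne by simp
    qed
  qed
  have dn: "x - 1 \<in> ?S" if "1 \<le> x" "x \<le> m + 1" "x \<in> ?S" for x
    using noLR[OF that(1,2)] anti'[of "x - 1"] that(3) by blast
  define P where "P = ?S \<inter> {0..m}"
  define p where "p = Max P"
  have fP: "finite P" by (simp add: P_def)
  have S01: "0 \<in> ?S" "1 \<in> ?S" using in0 in1 by auto
  have "1 \<in> P" using S01 m2 by (simp add: P_def)
  then have "p \<in> P" "1 \<le> p" unfolding p_def using Max_in[OF fP] Max_ge[OF fP] by auto
  have pmax: "x \<le> p" if "x \<in> P" for x unfolding p_def by (rule Max_ge[OF fP that])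
  have "m \<notin> ?S" using anti[of 0] S01 by simp
  then have "p \<noteq> m" using \<open>p \<in> P\<close> by (auto simp: P_def)
  then have p: "p \<in> ?S" "1 \<le> p" "p \<le> m - 1" using \<open>p \<in> P\<close> \<open>1 \<le> p\<close> by (auto simp: P_def)
  have down: "p - int j \<in> ?S" if "0 \<le> p - int j" for j
    using that
  proof (induction j)
    case (Suc j)
    then show ?case using dn[of "p - int j"] p by (simp add: algebra_simps)
  qed (use p in simp)
  have right: "x \<in> ?S \<longleftrightarrow> x \<le> p" if "0 \<le> x" "x \<le> m" for x
    using down[of "nat (p - x)"] pmax[of x] that by (auto simp: P_def)
  define a where "a = p + 1 - m"
  have block: "x \<in> ?S" if "a \<le> x" "x < a + m" for x
  proof (cases "0 \<le> x")
    case True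
    then show ?thesis using right[of x] that p by (simp add: a_def)
  next
    case False
    then show ?thesis using right[of "x + m"] anti[of x] that p by (simp add: a_def)
  qed
  have per2: "x + 2 * m \<in> ?S \<longleftrightarrow> x \<in> ?S" for x using anti[of x] anti[of "x + m"] by (simp add: add.assoc)
  have iff: "x \<in> ?S \<longleftrightarrow> (x - a) mod (2 * m) < m" for x
  proof -
    let ?t = "(x - a) mod (2 * m)"
    have t: "0 \<le> ?t" "?t < 2 * m" using m2 by simp_all
    have "x = (a + ?t) + (2 * m) * ((x - a) div (2 * m))" using mod_mult_div_eq[of "x - a" "2 * m"] by simp
    then have "x \<in> ?S \<longleftrightarrow> a + ?t \<in> ?S" using periodic_add_mult[of "2 * m" ?S, OF per2] by metis
    also have "\<dots> \<longleftrightarrow> ?t < m"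
    proof (cases "?t < m")
      case True
      then show ?thesis using block[of "a + ?t"] t by simp
    next
      case False
      then have "a + ?t - m \<in> ?S" using t by (intro block) simp_all
      then show ?thesis using anti'[of "a + ?t"] False by blast
    qed
    finally show ?thesis .
  qed
  \<comment> \<open>Period \<open>n\<close> carries the beginning of a block to a beginning of a
    block: \<open>a + n\<close> is in the union and \<open>a - 1 + n\<close> is not.\<close>
  have "2 * m dvd n"
  proof -
    let ?t = "n mod (2 * m)"
    have "?t < m" using iff[of "a + n"] per[of a] iff[of a] m2 by simp
    moreover have "a - 1 + n \<notin> ?S"
    proof -
      have "a - 1 + m \<in> ?S" by (rule block) (use m2 in auto)
      then show ?thesis using per[of "a - 1"] anti[of "a - 1"] by simp
    qed
    then have "\<not> (n - 1) mod (2 * m) < m" using iff[of "a - 1 + n"] by simp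
    moreover have "(n - 1) mod (2 * m) = (?t - 1) mod (2 * m)" by (simp add: mod_diff_left_eq)
    moreover have "(?t - 1) mod (2 * m) = ?t - 1" if "?t \<noteq> 0"
    proof (rule mod_pos_pos_trivial)
      have "0 \<le> ?t" "?t < 2 * m" using pos_mod_sign[of "2 * m" n] pos_mod_bound[of "2 * m" n] m2 by linarith+
      then show "0 \<le> ?t - 1" "?t - 1 < 2 * m" using that by linarith+
    qed
    ultimately have "?t = 0" by fastforce
    then show ?thesis by (rule mod_0_imp_dvd)
  qed
  then show thesis using that[of a] iff p by (simp add: a_def)
qed

context no_cycle
begin

text \<open>A set that is complementary to its translate contains half of a period, that is
  \<open>r + 1\<close> positions, so an edge inside it misses just one.\<close>

lemma half_missing:
  assumes fr: "frame vx ed" and e: "e \<in> E" and n: "n = 2 * r + 2"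
    and per: "\<And>x. x + n \<in> T \<longleftrightarrow> x \<in> T" and anti: "\<And>x. x + m \<in> T \<longleftrightarrow> x \<notin> T"
    and sub: "pos vx e \<subseteq> T" and uv: "u \<in> T" "v \<in> T" "vx u \<notin> e" "vx v \<notin> e"
  shows "u mod n = v mod n"
proof (rule ccontr)
  assume ne: "u mod n \<noteq> v mod n"
  interpret free_set n m "int (card (T \<inter> {0..<n}))" T
    by unfold_locales (use per anti n_pos in \<open>auto simp: periodic_set_def\<close>)
  have "x \<notin> defect" for x using anti[of "x - m"] by (auto simp: defect_iff)
  then have "defect = {}" by blast
  then have c: "int (card (T \<inter> {0..<n})) = r + 1" using card_defect[of 0] n by simp
  have um: "x mod n \<in> T \<longleftrightarrow> x \<in> T" "vx (x mod n) = vx x" for x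
    using mem_mod[of x] frame_vx[OF fr, of "x mod n" x] by simp_all
  let ?U = "{u mod n, v mod n}"
  have U: "?U \<subseteq> T \<inter> {0..<n}" using um uv n_pos by simp
  have "pos vx e \<inter> {0..<n} \<subseteq> T \<inter> {0..<n} - ?U" using sub um uv by auto
  then have "card (pos vx e \<inter> {0..<n}) \<le> card (T \<inter> {0..<n} - ?U)" by (intro card_mono) auto
  moreover have "card (T \<inter> {0..<n} - ?U) = card (T \<inter> {0..<n}) - card ?U" by (rule card_Diff_subset[OF _ U]) simp
  moreover have "card ?U \<le> card (T \<inter> {0..<n})" by (rule card_mono[OF _ U]) simp
  moreover have "card ?U = 2" using ne by simp
  moreover have "int (card (pos vx e \<inter> {0..<n})) = r" using pos_periodic[OF fr e] by (simp add: periodic_set_def)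
  ultimately show False using c by linarith
qed

lemma half_determined:
  assumes fr: "frame vx ed" and e: "e \<in> E" "f \<in> E" and n: "n = 2 * r + 2"
    and per: "\<And>x. x + n \<in> T \<longleftrightarrow> x \<in> T" and anti: "\<And>x. x + m \<in> T \<longleftrightarrow> x \<notin> T"
    and sub: "pos vx e \<subseteq> T" "pos vx f \<subseteq> T" and u: "u \<in> T" "vx u \<notin> e" "vx u \<notin> f"
  shows "e = f"
proof (rule pos_eq[OF fr e], rule set_eqI)
  fix x
  have "x \<in> T \<Longrightarrow> vx x \<notin> e \<Longrightarrow> vx x = vx u" "x \<in> T \<Longrightarrow> vx x \<notin> f \<Longrightarrow> vx x = vx u"
    using half_missing[OF fr e(1) n per anti sub(1) _ u(1) _ u(2), of x]
      half_missing[OF fr e(2) n per anti sub(2) _ u(1) _ u(3), of x] frame_vx[OF fr, of x u] by blast+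
  then show "x \<in> pos vx e \<longleftrightarrow> x \<in> pos vx f" using sub u(2,3) by (metis pos_iff subsetD)
qed

lemma ed_notin:
  assumes "frame vx ed" "\<And>j. j \<in> J \<Longrightarrow> j \<noteq> k \<and> \<bar>j - k\<bar> < n"
  shows "ed k \<notin> ed ` J"
proof
  assume "ed k \<in> ed ` J"
  then obtain j where j: "j \<in> J" "ed k = ed j" by blast
  then have "k mod n = j mod n" using frame_ed[OF assms(1)] by blast
  then show False using mod_neq[of j k n] assms(2)[OF j(1)] by simp
qed

lemma edge_far:
  assumes fr: "frame vx ed" and X: "X \<in> E" "X \<notin> range ed"
    and q: "vx (q + 1) \<in> X" "q + 1 \<le> x" "x \<le> q + d" "vx (x - d) \<in> X"
  shows "vx x \<notin> ed q"
proof
  assume "vx x \<in> ed q"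
  then have e: "vx (x - d + d) \<in> ed q" by simp
  have f: "X \<notin> ed ` S" for S using X by auto
  have f': "ed q \<notin> ed ` ({x - d..<q + 1 - 1} \<union> {q + 1..<x - d + d})"
    by (rule ed_notin[OF fr]) (use q d_le in auto)
  have "vx (q + 1 - 1) \<notin> ed q"
    by (rule crossing[OF fr X(1) frame_inE[OF fr] _ f f' _ _ q(4) e q(1)]) (use X q in auto)
  then show False using frame_inc[OF fr, of q] by simp
qed

lemma edge_near:
  assumes fr: "frame vx ed" and X: "X \<in> E" "X \<notin> range ed"
    and q: "vx q \<in> X" "q - d + 1 \<le> x" "x \<le> q" "vx (x + d) \<in> X"
  shows "vx x \<notin> ed q"
proof
  assume e: "vx x \<in> ed q"
  have f: "X \<notin> ed ` S" for S using X by auto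
  have f': "ed q \<notin> ed ` ({x..<q + 1 - 1} \<union> {q + 1..<x + d})"
    by (rule ed_notin[OF fr]) (use q d_le in auto)
  have "vx (q + 1 - 1) \<notin> X"
    by (rule crossing[OF fr frame_inE[OF fr] X(1) _ f' f _ _ e q(4)]) (use X q frame_inc[OF fr, of q] in auto)
  then show False using q by simp
qed

end

section \<open>The union of two extra edges as alternating blocks of length m\<close>

locale ideal_pair = no_cycle V E n d r for V :: "'a set" and E n d r +
  fixes vx :: "int \<Rightarrow> 'a" and ed :: "int \<Rightarrow> 'a set" and X Y :: "'a set" and m a :: int
  assumes fr: "frame vx ed" and X: "X \<in> E" "X \<notin> range ed" and Y: "Y \<in> E" "Y \<notin> range ed" and XY: "X \<noteq> Y"
    and m: "m = n - d" and a: "a \<le> 0" "2 \<le> a + m" and dv: "2 * m dvd n" and even: "n = 2 * r + 2" and r3: "3 \<le> r"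
    and union: "vx x \<in> X \<or> vx x \<in> Y \<longleftrightarrow> (x - a) mod (2 * m) < m"
    and common: "vx 0 \<in> X" "vx 0 \<in> Y" "vx 1 \<in> X" "vx 1 \<in> Y"
begin

definition S :: "int set" where "S = {x. (x - a) mod (2 * m) < m}"

lemma S_iff: "x \<in> S \<longleftrightarrow> (x - a) mod (2 * m) < m"
  by (simp add: S_def)

lemma m2: "2 \<le> m" using m d_le by simp

lemma mn: "2 * m \<le> n" using dv n_pos by (rule zdvd_imp_le)

lemma XS: "pos vx X \<subseteq> S" and YS: "pos vx Y \<subseteq> S"
  unfolding S_def pos_def using union by blast+

lemma anti: "x + m \<in> S \<longleftrightarrow> x \<notin> S"
proof -
  let ?t = "(x - a) mod (2 * m)"
  have t: "0 \<le> ?t" "?t < 2 * m" using m2 by simp_all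
  have "x + m - a = (x - a) + m" by simp
  then have "(x + m - a) mod (2 * m) = ((x - a) + m) mod (2 * m)" by (rule arg_cong)
  also have "\<dots> = (?t + m) mod (2 * m)" by (rule mod_add_left_eq[symmetric])
  finally have "(x + m - a) mod (2 * m) = (?t + m) mod (2 * m)" .
  moreover have "(?t + m) mod (2 * m) = ?t + m" if "?t < m"
    using that t by (intro mod_pos_pos_trivial) auto
  moreover have "(?t + m) mod (2 * m) = ?t - m" if "m \<le> ?t"
  proof -
    have "(?t + m) mod (2 * m) = (?t - m + 2 * m) mod (2 * m)" by (simp add: algebra_simps)
    also have "\<dots> = (?t - m) mod (2 * m)" by (rule mod_add_self2)
    also have "\<dots> = ?t - m" using that t by (intro mod_pos_pos_trivial) auto
    finally show ?thesis .
  qed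
  ultimately show ?thesis using t unfolding S_iff by (cases "?t < m") auto
qed

lemma anti_compl: "x + m \<in> - S \<longleftrightarrow> x \<notin> - S" using anti[of x] by auto

lemma per: "x + n \<in> S \<longleftrightarrow> x \<in> S"
proof -
  have "(x + n - a) mod (2 * m) = (x - a) mod (2 * m)" using dv by (auto simp: mod_eq_dvd_iff)
  then show ?thesis by (simp add: S_iff)
qed

lemma per_compl: "x + n \<in> - S \<longleftrightarrow> x \<in> - S" using per[of x] by auto

lemma block: "a \<le> x \<Longrightarrow> x < a + m \<Longrightarrow> x \<in> S"
  by (simp add: S_iff)

lemmas missing = half_missing[OF fr _ even per anti]
lemmas determined = half_determined[OF fr _ _ even per anti]

lemma minus_d: "x - d \<in> S \<longleftrightarrow> x \<notin> S"
proof -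
  have "x - d + n = x + m" using m by simp
  then show ?thesis using per[of "x - d"] anti[of x] by (simp only:)
qed

lemma plus_d: "x + d \<in> S \<longleftrightarrow> x \<notin> S"
  using minus_d[of "x + d"] by auto

text \<open>The translates of a position outside \<open>S\<close> by \<open>d\<close> and
  \<open>- d\<close> are in \<open>S\<close>, hence in \<open>X\<close> or in \<open>Y\<close>. That
  edge also contains 0 and 1, so together with \<open>ed 0\<close> it closes a cycle cut between
  these two.\<close>

lemma zero_inside: "pos vx (ed 0) \<subseteq> S"
proof
  fix y assume y: "y \<in> pos vx (ed 0)"
  define x where "x = 1 + (y - 1) mod n"
  have xb: "1 \<le> x" "x \<le> n"
    using pos_mod_sign[OF n_pos, of "y - 1"] pos_mod_bound[OF n_pos, of "y - 1"] by (simp_all only: x_def)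
  have xy: "x mod n = y mod n" by (simp add: x_def mod_simps)
  then have x: "vx x \<in> ed 0" using y frame_vx[OF fr, of x y] by simp
  have Sx: "x \<in> S \<longleftrightarrow> y \<in> S" by (rule periodic_mod[OF per xy])
  show "y \<in> S"
  proof (rule ccontr)
    assume "y \<notin> S"
    then have nS: "x \<notin> S" using Sx by simp
    show False
    proof (cases "x \<le> d")
      case True
      have "x - d \<in> S" using nS minus_d by simp
      then have "vx (x - d) \<in> X \<or> vx (x - d) \<in> Y" using union S_iff by simp
      then show False
        using edge_far[OF fr X, of 0 x] edge_far[OF fr Y, of 0 x] x common xb True by auto
    next
      case False
      have "x - n \<notin> S" using nS per[of "x - n"] by simp
      then have "x - n + d \<in> S" using plus_d by simp
      then have "vx (x - n + d) \<in> X \<or> vx (x - n + d) \<in> Y" using union S_iff by simp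
      moreover have "vx (x - n) \<in> ed 0" using x frame_period[OF fr, of "x - n"] by simp
      ultimately show False
        using edge_near[OF fr X, of 0 "x - n"] edge_near[OF fr Y, of 0 "x - n"] common xb False mn m by auto
    qed
  qed
qed

text \<open>Of three distinct edges inside \<open>S\<close> at most one misses \<open>u\<close> and
  at most one misses \<open>v\<close>; a third contains both.\<close>

lemma pick:
  assumes "Z \<in> E" "pos vx Z \<subseteq> S" "Z \<noteq> X" "Z \<noteq> Y" "u \<in> S" "v \<in> S"
  shows "vx u \<in> X \<and> vx v \<in> X \<or> vx u \<in> Y \<and> vx v \<in> Y \<or> vx u \<in> Z \<and> vx v \<in> Z"
  using determined[OF X(1) Y(1) XS YS] determined[OF X(1) assms(1) XS assms(2)] determined[OF Y(1) assms(1) YS assms(2)]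
    assms(3-6) XY by metis

lemma ed_ne: "ed k \<noteq> X" "ed k \<noteq> Y" "X \<notin> ed ` J" "Y \<notin> ed ` J" using X Y by auto

text \<open>Exchanging the roles of \<open>X\<close> and \<open>ed 0\<close> makes \<open>ed 0\<close> an edge outside the cycle.\<close>

lemma usable:
  assumes "u \<in> S" "v \<in> S"
  obtains f ed' where "frame vx ed'" "f \<in> E" "f \<notin> range ed'" "\<And>j. j mod n \<noteq> 0 \<Longrightarrow> ed' j = ed j" "vx u \<in> f" "vx v \<in> f"
proof -
  from pick[OF frame_inE[OF fr] zero_inside ed_ne(1,2) assms]
  consider "vx u \<in> X" "vx v \<in> X" | "vx u \<in> Y" "vx v \<in> Y" | "vx u \<in> ed 0" "vx v \<in> ed 0" by blast
  then show thesis
  proof cases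
    case 1
    then show thesis using that[OF fr X] by simp
  next
    case 2
    then show thesis using that[OF fr Y] by simp
  next
    case 3
    have "vx (0 + 1) \<in> X" using common by simp
    note s = frame_swap[OF fr X common(1) this]
    have "ed 0 \<notin> range (swap_edge n ed 0 X)" using s(2) ed_ne(1)[of 0] by auto
    moreover have "swap_edge n ed 0 X j = ed j" if "j mod n \<noteq> 0" for j using that by (simp add: swap_edge_def)
    ultimately show thesis using that[OF s(1) frame_inE[OF fr]] 3 by blast
  qed
qed

text \<open>The argument of \<open>zero_inside\<close> at \<open>q\<close>, with the required pair
  of positions supplied by \<open>usable\<close>. The exchange made there leaves \<open>ed q\<close>
  in place because \<open>q\<close> is not 0 modulo \<open>n\<close>.\<close>

lemma inside:
  assumes q: "q \<in> S" "q + 1 \<in> S"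
  shows "pos vx (ed q) \<subseteq> S"
proof (cases "q mod n = 0")
  case True
  then have "q mod n = 0 mod n" by simp
  then have "ed q = ed 0" using frame_ed[OF fr] by blast
  then show ?thesis using zero_inside by simp
next
  case qn: False
  show ?thesis
  proof
    fix y assume y: "y \<in> pos vx (ed q)"
    define x where "x = q + 1 + (y - q - 1) mod n"
    have xb: "q + 1 \<le> x" "x \<le> q + n"
      using pos_mod_sign[OF n_pos, of "y - q - 1"] pos_mod_bound[OF n_pos, of "y - q - 1"] by (simp_all only: x_def)
    have xy: "x mod n = y mod n" by (simp add: x_def mod_simps)
    then have x: "vx x \<in> ed q" using y frame_vx[OF fr, of x y] by simp
    have Sx: "x \<in> S \<longleftrightarrow> y \<in> S" by (rule periodic_mod[OF per xy])
    show "y \<in> S"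
    proof (rule ccontr)
      assume "y \<notin> S"
      then have nS: "x \<notin> S" using Sx by simp
      show False
      proof (cases "x \<le> q + d")
        case True
        have "x - d \<in> S" using nS minus_d by simp
        then obtain f ed' where f: "frame vx ed'" "f \<in> E" "f \<notin> range ed'" "\<And>j. j mod n \<noteq> 0 \<Longrightarrow> ed' j = ed j"
          "vx (q + 1) \<in> f" "vx (x - d) \<in> f"
          by (rule usable[OF q(2)]) (rule that)
        show False using edge_far[OF f(1-3,5) xb(1) True f(6)] x f(4)[OF qn] by simp
      next
        case False
        have "x - n \<notin> S" using nS per[of "x - n"] by simp
        then have "x - n + d \<in> S" using plus_d by simp
        then obtain f ed' where f: "frame vx ed'" "f \<in> E" "f \<notin> range ed'" "\<And>j. j mod n \<noteq> 0 \<Longrightarrow> ed' j = ed j"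
          "vx q \<in> f" "vx (x - n + d) \<in> f"
          by (rule usable[OF q(1)]) (rule that)
        moreover have "vx (x - n) \<in> ed q" using x frame_period[OF fr, of "x - n"] by simp
        ultimately show False
          using edge_near[OF f(1-3,5) _ _ f(6)] f(4)[OF qn] xb False mn m by simp
      qed
    qed
  qed
qed

text \<open>A single block has \<open>m = r + 1\<close> vertices and thus \<open>m\<close> subsets
  of size \<open>r\<close>, but \<open>X\<close>, \<open>Y\<close> and the \<open>m - 1\<close>
  cycle edges within the block are \<open>m + 1\<close> such subsets.\<close>

lemma one_block: "n \<noteq> 2 * m"
proof
  assume n: "n = 2 * m"
  let ?B = "vx ` {a..a + m - 1}"
  let ?G = "insert X (insert Y (ed ` {a..a + m - 2}))"
  have inj: "inj_on vx {a..a + m - 1}" "inj_on ed {a..a + m - 2}"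
    by (rule frame_inj[OF fr]; use m2 n in auto)+
  have "card ?G = Suc (Suc (card (ed ` {a..a + m - 2})))"
    using ed_ne XY by simp
  then have cG: "int (card ?G) = m + 1" using card_image[OF inj(2)] m2 by simp
  have T: "T \<in> {T. T \<subseteq> ?B \<and> card T = nat r}" if TE: "T \<in> E" and TS: "pos vx T \<subseteq> S" for T
  proof -
    have "T \<subseteq> ?B"
    proof
      fix v assume v: "v \<in> T"
      then obtain i where i: "v = vx i" using edge_sub[OF TE] frame_range[OF fr] by auto
      let ?j = "a + (i - a) mod n"
      have "i \<in> S" using v i TS by auto
      then have "?j \<in> {a..a + m - 1}" using n m2 by (simp add: S_iff)
      moreover have "?j mod n = i mod n" by (simp add: mod_simps)
      then have "v = vx ?j" using i frame_vx[OF fr, of ?j i] by simp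
      ultimately show "v \<in> ?B" by blast
    qed
    then show ?thesis using edge_card[OF TE] by auto
  qed
  have "?G \<subseteq> {T. T \<subseteq> ?B \<and> card T = nat r}"
  proof
    fix T assume "T \<in> ?G"
    moreover have "pos vx (ed q) \<subseteq> S" if "q \<in> {a..a + m - 2}" for q
      by (rule inside; rule block) (use that in auto)
    ultimately show "T \<in> {T. T \<subseteq> ?B \<and> card T = nat r}" using T X(1) Y(1) XS YS frame_inE[OF fr] by blast
  qed
  moreover have "card {T. T \<subseteq> ?B \<and> card T = nat r} = (card ?B choose nat r)" by (rule n_subsets) simp
  moreover have "card ?B = Suc (nat r)" using card_image[OF inj(1)] n even r3 by simp
  moreover have "finite {T. T \<subseteq> ?B \<and> card T = nat r}" by simp
  ultimately have "card ?G \<le> (Suc (nat r) choose nat r)" using card_mono[of "{T. T \<subseteq> ?B \<and> card T = nat r}" ?G] by (simp only:)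
  then show False using cG n even r3 by (simp add: binomial_Suc_n)
qed

lemma many_blocks: "4 * m \<le> n"
proof -
  obtain k where k: "n = 2 * m * k" using dv by blast
  have "0 < k" using k n_pos m2 by (simp add: zero_less_mult_iff)
  moreover have "k \<noteq> 1" using k one_block by auto
  ultimately have "2 \<le> k" by simp
  then have "2 * m * 2 \<le> 2 * m * k" using m2 by (intro mult_left_mono) auto
  then show ?thesis using k by simp
qed

text \<open>A cycle that avoids the inner vertices of one block and a single vertex of the next.\<close>

lemma m_is_two: "m = 2"
proof (rule ccontr)
  assume "m \<noteq> 2"
  then have m3: "3 \<le> m" using m2 by simp
  let ?y = "a + 2 * m"
  have y: "?y + j \<in> S" if "0 \<le> j" "j < m" for j
    using that by (simp add: S_iff mod_add_left_eq)
  have in_S: "a \<in> S" "a + m - 1 \<in> S" "?y \<in> S" "?y + 2 \<in> S"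
    using block[of a] block[of "a + m - 1"] y[of 0] y[of 2] m3 by auto
  let ?J = "{a + m - 1..<?y} \<union> {?y + 2..<a + n}"
  have "ed 0 \<notin> ed ` ?J" by (rule ed_notin[OF fr]) (use a m3 many_blocks in auto)
  then have J: "X \<notin> ed ` ?J" "Y \<notin> ed ` ?J" "ed 0 \<notin> ed ` ?J" using ed_ne(3,4)[of ?J] by blast+
  have in_E: "T \<in> E \<and> T \<notin> ed ` ?J" if "T \<in> {X, Y, ed 0}" for T
    using that X(1) Y(1) J frame_inE[OF fr, of 0] by blast
  have no: False if T: "T \<in> {X, Y, ed 0}" "U \<in> {X, Y, ed 0}" "T \<noteq> U" "vx a \<in> T" "vx (a + m - 1) \<in> T" "vx ?y \<in> U" "vx (?y + 2) \<in> U" for T U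
  proof (rule para[OF fr _ _ T(3)[symmetric], of "a + m - 1" ?y "?y + 2" "a + n"])
    show "vx (a + n) \<in> T" using T frame_period[OF fr, of a] by simp
    show "U \<in> E" "T \<in> E" "U \<notin> ed ` ?J" "T \<notin> ed ` ?J" using in_E[OF T(1)] in_E[OF T(2)] by blast+
    show "vx ?y \<in> U" "vx (?y + 2) \<in> U" "vx (a + m - 1) \<in> T" by (fact T)+
  qed (use m3 many_blocks m in simp_all)
  have ne: "vx u \<in> T \<or> vx v \<in> T" if "T \<in> {X, Y, ed 0}" "u \<in> S" "v \<in> S" "u < v" "v < u + n" for T u v
  proof (rule ccontr)
    assume "\<not> ?thesis"
    then have "u mod n = v mod n"
      using missing[OF _ _ that(2,3), of T] that(1) X Y frame_inE[OF fr] XS YS zero_inside by auto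
    then show False using mod_neq[of u v n] that by simp
  qed
  define Z where "Z = ed 0"
  have Z: "X \<noteq> Z" "Y \<noteq> Z" using ed_ne(1,2) by (auto simp: Z_def)
  \<comment> \<open>An edge misses at most one position of \<open>S\<close>, so each of the three
    satisfies \<open>p\<close> or \<open>s\<close> (\<open>n1\<close>), and each property holds
    somewhere (\<open>n2\<close>). The cycle forbids \<open>p\<close> and \<open>s\<close> for two
    different edges (\<open>n3\<close>).\<close>
  define p where "p T \<longleftrightarrow> vx a \<in> T \<and> vx (a + m - 1) \<in> T" for T
  define s where "s T \<longleftrightarrow> vx ?y \<in> T \<and> vx (?y + 2) \<in> T" for T
  have n1: "p T \<or> s T" if "T \<in> {X, Y, Z}" for T
    using ne[of T a ?y] ne[of T a "?y + 2"] ne[of T "a + m - 1" ?y] ne[of T "a + m - 1" "?y + 2"] that in_S m3 many_blocks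
    unfolding p_def s_def Z_def by auto
  have n2: "p X \<or> p Y \<or> p Z" "s X \<or> s Y \<or> s Z"
    using pick[OF frame_inE[OF fr] zero_inside ed_ne(1,2) in_S(1,2)] pick[OF frame_inE[OF fr] zero_inside ed_ne(1,2) in_S(3,4)]
    unfolding p_def s_def Z_def by blast+
  have n3: "\<not> (p T \<and> s U)" if "T \<in> {X, Y, Z}" "U \<in> {X, Y, Z}" "T \<noteq> U" for T U
    using no[of T U] that unfolding p_def s_def Z_def by blast
  show False
    using n1[of X] n1[of Y] n1[of Z] n2 n3[of X Y] n3[of X Z] n3[of Y X] n3[of Y Z] n3[of Z X] n3[of Z Y] XY Z
    by auto
qed

lemma a_zero: "a = 0" using a m_is_two by simp

lemma S4: "x \<in> S \<longleftrightarrow> x mod 4 = 0 \<or> x mod 4 = 1"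
proof -
  have "x \<in> S \<longleftrightarrow> (x - a) mod (2 * m) < m" by (rule S_iff)
  also have "\<dots> \<longleftrightarrow> x mod 4 < 2" by (simp add: a_zero m_is_two)
  finally have "x \<in> S \<longleftrightarrow> x mod 4 < 2" .
  moreover have "0 \<le> x mod 4" by simp
  ultimately show ?thesis by auto
qed

lemma four: "4 dvd n" using dv m_is_two by simp

lemma outside:
  assumes g: "g mod 4 = 2"
  shows "pos vx (ed g) \<subseteq> - S"
proof
  fix y assume y: "y \<in> pos vx (ed g)"
  define x where "x = g + (y - g) mod n"
  have xb: "g \<le> x" "x < g + n"
    using pos_mod_sign[OF n_pos, of "y - g"] pos_mod_bound[OF n_pos, of "y - g"] by (simp_all only: x_def)
  have xy: "x mod n = y mod n" by (simp add: x_def mod_simps)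
  then have x: "vx x \<in> ed g" using y frame_vx[OF fr, of x y] by simp
  have Sx: "x \<in> S \<longleftrightarrow> y \<in> S" by (rule periodic_mod[OF per xy])
  have n: "n = d + 2" using m m_is_two by simp
  have gs: "g - 1 \<in> S" "g + 2 \<in> S" unfolding S4 using g by presburger+
  have "\<not> x mod 4 = 1"
  proof
    assume x1: "x mod 4 = 1"
    then have o: "g + 3 \<le> x" "x \<le> g + n - 1" using xb g four by presburger+
    have xs: "x - 1 \<in> S" "x - 1 + 1 \<in> S" unfolding S4 using x1 by presburger+
    let ?J = "{g + 1..<x - 1} \<union> {x..<g - 1 + n}"
    have J: "ed g \<notin> ed ` ?J" "ed (x - 1) \<notin> ed ` ?J"
      by (rule ed_notin[OF fr]; use o in auto)+
    have J': "X \<notin> ed ` ?J" "Y \<notin> ed ` ?J" by (rule ed_ne)+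
    have ne: "ed g \<noteq> ed (x - 1)" using ed_notin[OF fr, of "{x - 1}" g] o by auto
    have no: False if f: "f \<in> E" "f \<noteq> ed g" "f \<notin> ed ` ?J" "vx (x - 1) \<in> f" "vx (g - 1) \<in> f" for f
    proof (rule cross[OF fr frame_inE[OF fr] f(1) f(2)[symmetric], of "g + 1" "x - 1" x "g - 1 + n"])
      show "vx (g - 1 + n) \<in> f" using f frame_period[OF fr, of "g - 1"] by simp
    qed (use f o n J x frame_inc[OF fr, of g] in auto)
    from pick[OF frame_inE[OF fr] inside[OF xs] ed_ne(1,2) xs(1) gs(1)]
    show False using no[OF X(1) _ J'(1)] no[OF Y(1) _ J'(2)] no[OF frame_inE[OF fr] _ J(2)] ed_ne(1,2)[of g] ne by metis
  qed
  moreover have "\<not> x mod 4 = 0"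
  proof
    assume x1: "x mod 4 = 0"
    then have o: "g + 2 \<le> x" "x \<le> g + n - 2" using xb g four by presburger+
    have xs: "x \<in> S" "x + 1 \<in> S" unfolding S4 using x1 by presburger+
    let ?J = "{g + 2..<x} \<union> {x + 1..<g + n}"
    have J: "ed g \<notin> ed ` ?J" "ed x \<notin> ed ` ?J"
      by (rule ed_notin[OF fr]; use o in auto)+
    have J': "X \<notin> ed ` ?J" "Y \<notin> ed ` ?J" by (rule ed_ne)+
    have ne: "ed g \<noteq> ed x" using ed_notin[OF fr, of "{x}" g] o by auto
    have no: False if f: "f \<in> E" "f \<noteq> ed g" "f \<notin> ed ` ?J" "vx (x + 1) \<in> f" "vx (g + 2) \<in> f" for f
    proof (rule cross[OF fr f(1) frame_inE[OF fr] f(2), of "g + 2" x "x + 1" "g + n"])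
      show "vx (g + n) \<in> ed g" using frame_inc[OF fr, of g] frame_period[OF fr, of g] by simp
    qed (use f o n J x in auto)
    from pick[OF frame_inE[OF fr] inside[OF xs] ed_ne(1,2) xs(2) gs(2)]
    show False using no[OF X(1) _ J'(1)] no[OF Y(1) _ J'(2)] no[OF frame_inE[OF fr] _ J(2)] ed_ne(1,2)[of g] ne by metis
  qed
  ultimately have "x \<notin> S" unfolding S4 by auto
  then show "y \<in> - S" using Sx by simp
qed

text \<open>The cycle runs from \<open>h + 1\<close> to \<open>g - 1 + n\<close>, along
  \<open>f\<close> to \<open>g + 2\<close>, on to \<open>h\<close>, along \<open>ed g\<close> to
  \<open>g + 1\<close>, and along \<open>ed h\<close> back to \<open>h + 1\<close>. It omits only
  \<open>g\<close>.\<close>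

lemma skip_gap:
  assumes g: "g mod 4 = 2" "h mod 4 = 2" "g < h" "h < g + n" and i: "vx h \<in> ed g" "vx (g + 1) \<in> ed h"
  shows False
proof -
  have n: "n = d + 2" using m m_is_two by simp
  have o: "g + 4 \<le> h" "h + 4 \<le> g + n" using g four by presburger+
  have gs: "g - 1 \<in> S" "g + 2 \<in> S" unfolding S4 using g by presburger+
  obtain f ed' where f: "frame vx ed'" "f \<in> E" "f \<notin> range ed'" "\<And>j. j mod n \<noteq> 0 \<Longrightarrow> ed' j = ed j"
    "vx (g - 1) \<in> f" "vx (g + 2) \<in> f" by (rule usable[OF gs]) (rule that)
  have nz: "x mod n \<noteq> 0" if "x mod 4 = 2" for x
  proof
    assume "x mod n = 0"
    then have "4 dvd x" using four by (meson dvd_eq_mod_eq_0 dvd_trans)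
    then show False using that by simp
  qed
  have e: "vx h \<in> ed' g" "vx (g + 1) \<in> ed' g" "vx (g + 1) \<in> ed' h" "vx (h + 1) \<in> ed' h"
    using f(4)[OF nz] g i frame_inc[OF fr, of g] frame_inc[OF fr, of h] by simp_all
  have inc: "vx i \<in> ed' i \<and> vx (i + 1) \<in> ed' i" for i by (rule frame_inc[OF f(1)])
  let ?us = "arcv vx (h + 1) (g - 1 + n)" and ?fs = "arcv ed' (h + 1) (g - 1 + n - 1)"
  let ?ws = "arcv vx (g + 2) h @ [vx (g + 1)]" and ?gs = "arcv ed' (g + 2) (h - 1) @ [ed' g]"
  have b1: "bpath ?us ?fs" by (rule bpath_arcv[of vx ed', OF inc]) (use o in simp)
  have b2: "bpath (arcv vx (g + 2) h) (arcv ed' (g + 2) (h - 1))" by (rule bpath_arcv[of vx ed', OF inc]) (use o in simp)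
  have b3: "bpath ?ws ?gs" by (rule bpath_append[OF b2]) (use o e in simp_all)
  have wne: "arcv vx (g + 2) h \<noteq> []" using o by (simp add: arcv_Cons)
  have us: "?us @ ?ws = map vx ([h + 1..g - 1 + n] @ [g + 2..h] @ [g + 1])" by (simp add: arcv_def)
  have es: "ed' h # ?fs @ ?gs = map ed' (h # [h + 1..g - 1 + n - 1] @ [g + 2..h - 1] @ [g])" by (simp add: arcv_def)
  have inj: "inj_on vx {g + 1..g + n - 1}" "inj_on ed' {g..g + n - 1}"
    by (rule frame_inj[OF f(1)]; auto)+
  have d1: "distinct (?us @ ?ws)"
    unfolding us distinct_map by (intro conjI inj_on_subset[OF inj(1)]) (use o in auto)
  have "distinct (ed' h # ?fs @ ?gs)"
    unfolding es distinct_map by (intro conjI inj_on_subset[OF inj(2)]) (use o in auto)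
  moreover have "f \<notin> set (ed' h # ?fs @ ?gs)" using f(3) by (auto simp: arcv_def)
  ultimately have d2: "distinct (ed' h # ?fs @ f # ?gs)" by auto
  show False
  proof (rule two_paths[OF b1 b3 _ _ _ _ d1 d2])
    show "last ?us \<in> f" using f(5) o frame_period[OF fr, of "g - 1"] by simp
    show "hd ?ws \<in> f" using f(6) o wne by simp
    show "last ?ws \<in> ed' h" "hd ?us \<in> ed' h" using e o by simp_all
    show "set (?us @ ?ws) \<subseteq> V" using frame_range[OF fr] by auto
    show "set (ed' h # ?fs @ f # ?gs) \<subseteq> E" using f(2) frame_inE[OF f(1)] by auto
    show "int (length ?us + length ?ws) = d + 1" using o n by simp
  qed
qed

text \<open>If \<open>n >= 12\<close> there are three gaps, starting at 2, 6 and 10. The cycle edge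
  in each gap misses at most one position outside \<open>S\<close>, while \<open>skip_gap\<close>
  makes some of them miss two.\<close>

lemma small: "n = 8"
proof (rule ccontr)
  assume "n \<noteq> 8"
  then have n12: "12 \<le> n" using many_blocks m_is_two four by presburger
  have ne: "vx u \<in> ed g \<or> vx v \<in> ed g" if g: "g \<in> {2, 6, 10}" and uv: "u \<noteq> v" "u \<in> {2, 3, 6, 7, 10, 11}" "v \<in> {2, 3, 6, 7, 10, 11}" for g u v
  proof (rule ccontr)
    assume neg: "\<not> ?thesis"
    have S: "u \<in> - S" "v \<in> - S" using uv by (auto simp: S4)
    have "g mod 4 = 2" using g by auto
    from outside[OF this] have "u mod n = v mod n"
      using half_missing[OF fr frame_inE[OF fr] even per_compl anti_compl _ S] neg by blast
    moreover have "\<bar>u - v\<bar> < n" using uv n12 by auto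
    ultimately show False using mod_neq[OF uv(1)] by blast
  qed
  define P where "P g u \<longleftrightarrow> vx u \<in> ed g" for g u
  have pe: "P (g + n) u \<longleftrightarrow> P g u" "P g (u + n) \<longleftrightarrow> P g u" for g u
    using frame_ed[OF fr, of "g + n" g] frame_period[OF fr, of u] by (simp_all add: P_def)
  have sk: "\<not> (P g h \<and> P h (g + 1))" if "g \<in> {2, 6, 10}" "h \<in> {2, 6, 10}" "g \<noteq> h" for g h
  proof
    assume p: "P g h \<and> P h (g + 1)"
    show False
    proof (cases "g < h")
      case True
      then show False using skip_gap[of g h] p that n12 by (auto simp: P_def)
    next
      case False
      have "(h + n) mod 4 = 2" using that(2) four by auto
      then show False using skip_gap[of g "h + n"] p that n12 False pe[of h "g + 1"] pe[of g h] unfolding P_def by auto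
    qed
  qed
  have ne': "P g u \<or> P g v" if "g \<in> {2, 6, 10}" "u \<noteq> v" "u \<in> {2, 3, 6, 7, 10, 11}" "v \<in> {2, 3, 6, 7, 10, 11}" for g u v
    using ne[OF that] by (simp add: P_def)
  have s: "\<not> (P 2 6 \<and> P 6 3)" "\<not> (P 2 10 \<and> P 10 3)" "\<not> (P 6 10 \<and> P 10 7)"
    "\<not> (P 6 2 \<and> P 2 7)" "\<not> (P 10 2 \<and> P 2 11)" "\<not> (P 10 6 \<and> P 6 11)"
    using sk[of 2 6] sk[of 2 10] sk[of 6 10] sk[of 6 2] sk[of 10 2] sk[of 10 6] by simp_all
  have e2: "P 2 6 \<or> P 2 10" "P 2 6 \<or> P 2 7" "P 2 6 \<or> P 2 11" "P 2 10 \<or> P 2 7" "P 2 10 \<or> P 2 11" "P 2 7 \<or> P 2 11"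
    by (rule ne'; simp)+
  have e6: "P 6 3 \<or> P 6 10" "P 6 3 \<or> P 6 2" "P 6 3 \<or> P 6 11" "P 6 10 \<or> P 6 2" "P 6 10 \<or> P 6 11" "P 6 2 \<or> P 6 11"
    by (rule ne'; simp)+
  have e10: "P 10 3 \<or> P 10 7" "P 10 3 \<or> P 10 2" "P 10 3 \<or> P 10 6" "P 10 7 \<or> P 10 2" "P 10 7 \<or> P 10 6" "P 10 2 \<or> P 10 6"
    by (rule ne'; simp)+
  show False
  proof (cases "P 2 6 \<and> P 2 10 \<and> P 2 7")
    case True
    then have "\<not> P 6 3" "\<not> P 6 2" using s by blast+
    then show False using e6 by blast
  next
    case False
    then have t: "P 2 11" using e2 by blast
    then have "\<not> P 10 2" using s by blast
    then have u: "P 10 3" "P 10 7" "P 10 6" using e10 by blast+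
    then have "\<not> P 6 10" "\<not> P 6 11" using s by blast+
    then show False using e6 by blast
  qed
qed

end

section \<open>Two edges that share two consecutive positions\<close>

context qpair
begin

lemma window_form:
  assumes "A \<inter> {s..<s + n} = {s..<s + m}"
  shows "x \<in> A \<longleftrightarrow> (x - s) mod n < m"
proof -
  let ?y = "s + (x - s) mod n"
  have "?y mod n = x mod n" by (simp add: mod_simps)
  then have "x \<in> A \<longleftrightarrow> ?y \<in> A" using A.cong by blast
  also have "\<dots> \<longleftrightarrow> ?y \<in> A \<inter> {s..<s + n}"
    using pos_mod_sign[OF A.n_pos, of "x - s"] pos_mod_bound[OF A.n_pos, of "x - s"] by simp
  also have "\<dots> \<longleftrightarrow> (x - s) mod n < m"
    unfolding assms using pos_mod_sign[OF A.n_pos, of "x - s"] by simp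
  finally show ?thesis .
qed

text \<open>An element that moves within its column must come from an end of the interval: otherwise
  the next position inside the interval violates \<open>stepA\<close> or
  \<open>stepB\<close>.\<close>

lemma interval_neighbours:
  assumes n: "n = 2 * m + 2" and s: "s \<le> 0" "2 \<le> s + m" and A: "A \<inter> {s..<s + n} = {s..<s + m}"
    and z: "z \<in> B" "z \<notin> A"
  shows "z mod n = (s + m) mod n \<or> z mod n = (s - 1) mod n"
proof -
  have near: "x \<in> A \<longleftrightarrow> s \<le> x \<and> x < s + m" if "s - m - 2 \<le> x" "x < s + n" for x
  proof (cases "s \<le> x")
    case True
    then have "x \<in> A \<longleftrightarrow> x \<in> A \<inter> {s..<s + n}" using that by simp
    then show ?thesis unfolding A using True by simp
  next
    case False
    have "x \<in> A \<longleftrightarrow> x + n \<in> A \<inter> {s..<s + n}" using A.per[of x] that False n m2 by simp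
    then show ?thesis unfolding A using that False n by simp
  qed
  from z show ?thesis
  proof (cases rule: kinds)
    case (1 x)
    have "s \<le> x - m" using near[of "x - m"] 1 s n by simp
    moreover have "x - 1 - m \<notin> A" using stepB[of x] 1 by simp
    then have "x - 1 - m < s" using near[of "x - 1 - m"] 1 s n by simp
    ultimately have "x = s + m" by simp
    then show ?thesis using 1(1) by simp
  next
    case (2 x)
    have "x + m < s + m \<and> s \<le> x + m" using near[of "x + m"] 2 s n by simp
    moreover have "x + m + 1 \<notin> A" using stepA[of "x + m + 1"] 2 by auto
    then have "\<not> (s \<le> x + m + 1 \<and> x + m + 1 < s + m)" using near[of "x + m + 1"] 2 s n by simp
    ultimately have "x = s - 1" by simp
    then show ?thesis using 2(1) by simp
  next
    case 3
    define x where "x = s + (z - s) mod n"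
    have xb: "s \<le> x" "x < s + n"
      using pos_mod_sign[OF A.n_pos, of "z - s"] pos_mod_bound[OF A.n_pos, of "z - s"] by (simp_all add: x_def)
    have xz: "x mod n = z mod n" by (simp add: x_def mod_simps)
    have "x \<notin> A" "x - m \<notin> A" "x + m \<notin> A"
      using A.cong[OF xz] A.cong[of "x - m" "z - m"] A.cong[of "x + m" "z + m"] z 3 xz
      by (auto intro: mod_diff_cong mod_add_cong)
    moreover have "x + m - n \<notin> A" using \<open>x + m \<notin> A\<close> A.per[of "x + m - n"] by simp
    ultimately show ?thesis using near[of x] near[of "x - m"] near[of "x + m - n"] xb n m2 by simp
  qed
qed

text \<open>A gained end costs its partner: \<open>s + m\<close> excludes \<open>s\<close>, and
  \<open>s - 1\<close> excludes \<open>s + m - 1\<close>. Equal cardinality allows no further loss,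
  so two truth values determine \<open>B\<close>.\<close>

lemma interval_determined:
  assumes n: "n = 2 * m + 2" and s: "s \<le> 0" "2 \<le> s + m" and A: "A \<inter> {s..<s + n} = {s..<s + m}"
  shows "x \<in> B \<longleftrightarrow> x \<in> A \<and> \<not> (x mod n = s mod n \<and> s + m \<in> B) \<and> \<not> (x mod n = (s + m - 1) mod n \<and> s - 1 \<in> B)
    \<or> x mod n = (s + m) mod n \<and> s + m \<in> B \<or> x mod n = (s - 1) mod n \<and> s - 1 \<in> B"
proof -
  have out: "z mod n = (s + m) mod n \<or> z mod n = (s - 1) mod n" if "z \<in> B" "z \<notin> A" for z
    using interval_neighbours[OF n s A that] .
  have inA: "s \<in> A" "s + m - 1 \<in> A"
  proof -
    have "s \<in> A \<inter> {s..<s + n}" "s + m - 1 \<in> A \<inter> {s..<s + n}"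
      unfolding A using m2 n by simp_all
    then show "s \<in> A" "s + m - 1 \<in> A" by simp_all
  qed
  have f1: "s \<notin> B" if "s + m \<in> B" using freeB[of s] that by blast
  have f2: "s + m - 1 \<notin> B" if "s - 1 \<in> B" using freeB[OF that] by (simp add: algebra_simps)
  have ne: "(s + m) mod n \<noteq> (s - 1) mod n" "s mod n \<noteq> (s + m - 1) mod n"
    by (rule mod_neq; use m2 n in simp)+
  have lost: "x mod n = s mod n \<and> s + m \<in> B \<or> x mod n = (s + m - 1) mod n \<and> s - 1 \<in> B" if x: "x \<in> A" "x \<notin> B" for x
  proof (cases "s + m \<in> B"; cases "s - 1 \<in> B")
    assume h: "s + m \<in> B" "s - 1 \<in> B"
    let ?W = "{0..<0 + n}"
    have u: "y mod n \<in> (A - B) \<inter> ?W" if "y \<in> A - B" for y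
      using that A.n_pos by (simp add: A.mem_mod B.mem_mod)
    have "(B - A) \<inter> ?W \<subseteq> {(s + m) mod n, (s - 1) mod n}"
    proof
      fix y assume y: "y \<in> (B - A) \<inter> ?W"
      then have "y mod n = (s + m) mod n \<or> y mod n = (s - 1) mod n" using out by blast
      then show "y \<in> {(s + m) mod n, (s - 1) mod n}" using y by auto
    qed
    then have "card ((B - A) \<inter> ?W) \<le> card {(s + m) mod n, (s - 1) mod n}" by (intro card_mono) auto
    then have "card ((A - B) \<inter> ?W) \<le> 2" using card_diff[of 0] ne by simp
    moreover have "{s mod n, (s + m - 1) mod n, x mod n} \<subseteq> (A - B) \<inter> ?W"
      using u inA f1 f2 h x by blast
    then have "card {s mod n, (s + m - 1) mod n, x mod n} \<le> card ((A - B) \<inter> ?W)" by (intro card_mono) auto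
    ultimately show ?thesis using ne h by (auto simp: card_insert_if split: if_splits)
  next
    assume h: "s + m \<in> B" "s - 1 \<notin> B"
    have o: "z mod n = (s + m) mod n" if "z \<in> B" "z \<notin> A" for z using out[OF that] B.cong h that by blast
    show ?thesis using diff_single[OF o inA(1) f1[OF h(1)] x] h by blast
  next
    assume h: "s + m \<notin> B" "s - 1 \<in> B"
    have o: "z mod n = (s - 1) mod n" if "z \<in> B" "z \<notin> A" for z using out[OF that] B.cong h that by blast
    show ?thesis using diff_single[OF o inA(2) f2[OF h(2)] x] h by blast
  next
    assume h: "s + m \<notin> B" "s - 1 \<notin> B"
    then have "A = B" using differ out B.cong by metis
    then show ?thesis using x by simp
  qed
  define p1 p2 p3 p4 where p: "p1 \<longleftrightarrow> x mod n = s mod n" "p2 \<longleftrightarrow> x mod n = (s + m - 1) mod n"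
    "p3 \<longleftrightarrow> x mod n = (s + m) mod n" "p4 \<longleftrightarrow> x mod n = (s - 1) mod n"
  have "x \<in> B \<longrightarrow> x \<notin> A \<longrightarrow> p3 \<or> p4" "x \<in> A \<longrightarrow> x \<notin> B \<longrightarrow> p1 \<and> s + m \<in> B \<or> p2 \<and> s - 1 \<in> B"
    using out[of x] lost[of x] unfolding p by blast+
  moreover have "p1 \<longrightarrow> (x \<in> B \<longleftrightarrow> s \<in> B)" "p2 \<longrightarrow> (x \<in> B \<longleftrightarrow> s + m - 1 \<in> B)"
    "p3 \<longrightarrow> (x \<in> B \<longleftrightarrow> s + m \<in> B)" "p4 \<longrightarrow> (x \<in> B \<longleftrightarrow> s - 1 \<in> B)"
    unfolding p using B.cong by blast+
  ultimately show ?thesis unfolding p[symmetric] using f1 f2 by blast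
qed

end

context no_cycle
begin

lemma qpair_extra:
  assumes fr: "frame vx ed" and X: "X \<in> E" "X \<notin> range ed" and Y: "Y \<in> E" "Y \<notin> range ed" and XY: "X \<noteq> Y"
    and common: "vx 0 \<in> X" "vx 0 \<in> Y" "vx 1 \<in> X" "vx 1 \<in> Y" and mn: "2 * (n - d) \<le> n"
  shows "qpair n (n - d) r (pos vx X) (pos vx Y)"
  using fr avail_extra[OF X] avail_extra[OF Y] XY common extra_free(2)[OF fr X] extra_free(2)[OF fr Y] mn
  by (rule qpair_intro)

text \<open>\<open>Y\<close> and the \<open>m - 1\<close> cycle edges along the interval are all
  determined by the same two truth values, and both being false would give \<open>X\<close>. Three
  combinations are too few for \<open>m >= 4\<close> edges.\<close>

lemma interval_edge:
  assumes fr: "frame vx ed" and X: "X \<in> E" "X \<notin> range ed" and Y: "Y \<in> E" "Y \<notin> range ed" and XY: "X \<noteq> Y"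
    and common: "vx 0 \<in> X" "vx 0 \<in> Y" "vx 1 \<in> X" "vx 1 \<in> Y"
    and m: "m = n - d" "n = 2 * m + 2" and m4: "4 \<le> m"
    and I: "pos vx X \<inter> {s..<s + n} = {s..<s + m}" and s: "s \<le> 0" "2 \<le> s + m"
  shows False
proof -
  define P where "P T \<longleftrightarrow> (\<forall>x. vx x \<in> T \<longleftrightarrow> vx x \<in> X \<and> \<not> (x mod n = s mod n \<and> vx (s + m) \<in> T) \<and> \<not> (x mod n = (s + m - 1) mod n \<and> vx (s - 1) \<in> T)
    \<or> x mod n = (s + m) mod n \<and> vx (s + m) \<in> T \<or> x mod n = (s - 1) mod n \<and> vx (s - 1) \<in> T)" for T
  have md: "(x - q) mod n = (y - q) mod n \<longleftrightarrow> x mod n = y mod n" for x y q :: int by (simp add: mod_eq_dvd_iff)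
  have gen: "P T" if q: "s \<le> q" "q + 1 < s + m" and T: "qpair n m r (pos (\<lambda>i. vx (i + q)) X) (pos (\<lambda>i. vx (i + q)) T)" for q T
  proof -
    interpret qpair n m r "pos (\<lambda>i. vx (i + q)) X" "pos (\<lambda>i. vx (i + q)) T" by (rule T)
    have I': "pos (\<lambda>i. vx (i + q)) X \<inter> {s - q..<s - q + n} = {s - q..<s - q + m}"
    proof (rule set_eqI)
      fix x
      have "x \<in> pos (\<lambda>i. vx (i + q)) X \<inter> {s - q..<s - q + n} \<longleftrightarrow> x + q \<in> pos vx X \<inter> {s..<s + n}" by auto
      also have "\<dots> \<longleftrightarrow> x \<in> {s - q..<s - q + m}" unfolding I by auto
      finally show "x \<in> pos (\<lambda>i. vx (i + q)) X \<inter> {s - q..<s - q + n} \<longleftrightarrow> x \<in> {s - q..<s - q + m}" .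
    qed
    have s': "s - q \<le> 0" "2 \<le> s - q + m" using q by simp_all
    have e: "s - q + m = s + m - q" "s - q - 1 = s - 1 - q" "s + m - q - 1 = s + m - 1 - q" by simp_all
    show ?thesis
      unfolding P_def
      by (rule allI, rule interval_determined[OF m(2) s' I', of "x - q" for x, unfolded e pos_iff diff_add_cancel md])
  qed
  have I0: "vx x \<in> X \<longleftrightarrow> s \<le> x \<and> x < s + m" if "s \<le> x" "x < s + n" for x
  proof -
    have "vx x \<in> X \<longleftrightarrow> x \<in> pos vx X \<inter> {s..<s + n}" using that by simp
    then show ?thesis unfolding I by simp
  qed
  have mlen: "m < n" using m(2) m4 by linarith
  have run: "vx x \<in> X" if "s \<le> x" "x < s + m" for x using I0[of x] that mlen by linarith
  let ?G = "insert Y (ed ` {s..s + m - 2})"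
  have ne: "X \<noteq> ed k" "Y \<noteq> ed k" for k using X(2) Y(2) by (metis rangeI)+
  have G: "P T \<and> T \<in> E \<and> T \<noteq> X" if TG: "T \<in> ?G" for T
  proof (cases "T = Y")
    case True
    have "qpair n m r (pos vx X) (pos vx Y)"
    unfolding m(1) by (rule qpair_extra[OF fr X Y XY common]) (use m in simp)
    then have "P Y" using gen[of 0 Y] s by simp
    then show ?thesis using True Y XY by auto
  next
    case False
    then obtain q where q: "T = ed q" "s \<le> q" "q \<le> s + m - 2" using TG by force
    have "qpair n m r (pos (\<lambda>i. vx (i + q)) X) (pos (\<lambda>i. vx (i + q)) (ed q))"
      unfolding m(1) by (rule qpair_edge[OF fr X]) (use m run q in auto)
    then have "P T" using gen[of q T] q by simp
    then show ?thesis using q ne(1)[of q] frame_inE[OF fr, of q] by auto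
  qed
  have same: "T = U" if "T \<in> ?G" "U \<in> ?G" "vx (s + m) \<in> T \<longleftrightarrow> vx (s + m) \<in> U" "vx (s - 1) \<in> T \<longleftrightarrow> vx (s - 1) \<in> U" for T U
  proof -
    have p: "P T" "P U" "T \<in> E" "U \<in> E" using G that(1,2) by blast+
    have "vx x \<in> T \<longleftrightarrow> vx x \<in> U" for x
      using p(1)[unfolded P_def, rule_format, of x] p(2)[unfolded P_def, rule_format, of x] that(3,4) by argo
    then have "pos vx T = pos vx U" by (simp add: pos_def)
    then show ?thesis using pos_eq[OF fr p(3,4)] by blast
  qed
  let ?f = "\<lambda>T. (vx (s + m) \<in> T, vx (s - 1) \<in> T)"
  have inj: "inj_on ?f ?G" by (rule inj_onI) (rule same; simp)
  have "?f T \<noteq> (False, False)" if TG: "T \<in> ?G" for T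
  proof
    assume F: "?f T = (False, False)"
    have p: "P T" "T \<in> E" "T \<noteq> X" using G[OF TG] by blast+
    have "vx x \<in> T \<longleftrightarrow> vx x \<in> X" for x
      using p(1)[unfolded P_def, rule_format, of x] F by simp
    then have "pos vx T = pos vx X" by (simp add: pos_def)
    then show False using pos_eq[OF fr p(2) X(1)] p(3) by blast
  qed
  then have "?f ` ?G \<subseteq> {(True, True), (True, False), (False, True)}" by auto
  then have "card (?f ` ?G) \<le> card {(True, True), (True, False), (False, True)}" by (rule card_mono[rotated]) simp
  moreover have "card {(True, True), (True, False), (False, True)} = 3" by simp
  moreover have "card (?f ` ?G) = card ?G" using inj by (rule card_image)
  moreover have "inj_on ed {s..s + m - 2}" by (rule frame_inj(2)[OF fr]) (use m(2) m4 in auto)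
  then have "card (ed ` {s..s + m - 2}) = nat (m - 1)" by (simp add: card_image)
  then have "card ?G = Suc (nat (m - 1))" using ne(2) by (subst card_insert_disjoint) auto
  ultimately show False using m4 by simp
qed

lemma interval_edge_periodic:
  assumes fr: "frame vx ed" and X: "X \<in> E" "X \<notin> range ed" and Y: "Y \<in> E" "Y \<notin> range ed" and XY: "X \<noteq> Y"
    and common: "vx 0 \<in> X" "vx 0 \<in> Y" "vx 1 \<in> X" "vx 1 \<in> Y"
    and m: "m = n - d" "n = 2 * m + 2" and m4: "4 \<le> m"
    and I: "pos vx X \<inter> {s..<s + n} = {s..<s + m}"
  shows False
proof -
  interpret qpair n m r "pos vx X" "pos vx Y"
    unfolding m(1) by (rule qpair_extra[OF fr X Y XY common]) (use m in simp)
  \<comment> \<open>The representative of \<open>s\<close> with \<open>- n < u <= 0\<close>. As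
    \<open>X\<close> contains 0 and 1, the copy of the interval that starts there contains
    both.\<close>
  define u where "u = - ((- s) mod n)"
  have u: "- n < u" "u \<le> 0" using pos_mod_sign[OF n_pos, of "- s"] pos_mod_bound[OF n_pos, of "- s"] by (simp_all add: u_def)
  have "s - u = n * (- ((- s) div n))" using mult_div_mod_eq[of n "- s"] unfolding u_def mult_minus_right by linarith
  then have "n dvd s - u" by simp
  then have us: "(x - s) mod n = (x - u) mod n" for x by (simp add: mod_eq_dvd_iff dvd_diff_commute)
  have W: "vx x \<in> X \<longleftrightarrow> (x - u) mod n < m" for x using window_form[OF I, of x] us by simp
  have small: "vx x \<in> X \<longleftrightarrow> x < u + m" if "u \<le> x" "x < u + n" for x
  proof -
    have "(x - u) mod n = x - u" by (rule mod_pos_pos_trivial) (use that in auto)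
    then show ?thesis using W[of x] by auto
  qed
  have "pos vx X \<inter> {u..<u + n} = {u..<u + m}"
  proof (rule set_eqI)
    fix x show "x \<in> pos vx X \<inter> {u..<u + n} \<longleftrightarrow> x \<in> {u..<u + m}" using small[of x] m(2) m4 by auto
  qed
  moreover have "2 \<le> u + m"
  proof -
    have "0 < u + m" using small[of 0] common(1) u by simp
    then show ?thesis using small[of 1] common(3) u m(2) m4 by simp
  qed
  ultimately show False using interval_edge[OF assms(1-13), of u] u by blast
qed

text \<open>The third kind of difference leads to alternating blocks and leaves
  \<open>n = 8\<close>, \<open>m = 2\<close>. Otherwise one of the edges is an interval, and
  \<open>interval_edge\<close> leaves only \<open>m = 3\<close>, with
  \<open>n = 2 * m + 2 = 8\<close>.\<close>

lemma consecutive_pair: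
  assumes fr: "frame vx ed" and X: "X \<in> E" "X \<notin> range ed" and Y: "Y \<in> E" "Y \<notin> range ed" and XY: "X \<noteq> Y"
    and common: "vx 0 \<in> X" "vx 0 \<in> Y" "vx 1 \<in> X" "vx 1 \<in> Y"
    and m: "m = n - d" "2 * m \<le> n" and even: "n = 2 * r + 2" and r3: "3 \<le> r"
  shows "n = 8 \<and> m \<le> 3"
proof (cases "\<exists>z. vx z \<in> Y \<and> vx z \<notin> X \<and> vx (z - m) \<notin> X \<and> vx (z + m) \<notin> X")
  case True
  then obtain z where z: "z \<in> pos vx Y" "z \<notin> pos vx X" "z - m \<notin> pos vx X" "z + m \<notin> pos vx X" by auto
  interpret q: qpair n m r "pos vx X" "pos vx Y"
    unfolding m(1) by (rule qpair_extra[OF fr X Y XY common]) (use m in simp)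
  obtain a where a: "a \<le> 0" "2 \<le> a + m" "2 * m dvd n" "\<And>x. x \<in> pos vx X \<union> pos vx Y \<longleftrightarrow> (x - a) mod (2 * m) < m"
    by (rule q.ideal_block[OF even z]) (rule that)
  interpret ideal_pair V E n d r vx ed X Y m a
    by unfold_locales (use fr X Y XY m a(1-3) a(4)[simplified] even r3 common in blast)+
  show ?thesis using small m_is_two by simp
next
  case F: False
  interpret q: qpair n m r "pos vx X" "pos vx Y"
    unfolding m(1) by (rule qpair_extra[OF fr X Y XY common]) (use m in simp)
  have ne: "pos vx X \<noteq> pos vx Y" using pos_eq[OF fr X(1) Y(1)] XY by blast
  have sh: "vx (y - m) = vx (y + d)" for y
  proof -
    have "y - m + n = y + d" using m by simp
    then show ?thesis using frame_period[OF fr, of "y - m"] by (simp only:)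
  qed
  have cr: "vx (z - 1) \<notin> U" if T: "T \<in> E" "T \<notin> range ed" and U: "U \<in> E" "U \<notin> range ed" and TU: "T \<noteq> U"
    and "vx y \<in> T" "vx (y - m) \<in> U" "y < z" "z \<le> y + n - m" "vx z \<in> T" for T U y z
    by (rule crossing[OF fr T(1) U(1) TU, of y z]) (use T U that sh m in auto)
  \<comment> \<open>For \<open>n = 2 * m\<close> the positions \<open>x - m\<close> and
    \<open>x + m\<close> coincide modulo \<open>n\<close>, which contradicts the first two
    kinds.\<close>
  have m_lt: "2 * m < n"
  proof (rule ccontr)
    assume "\<not> ?thesis"
    then have n: "n = 2 * m" using m by simp
    have "d = m" using n m(1) by linarith
    then have pm: "vx (z - m) = vx (z + m)" for z using sh[of z] by (simp only:)
    obtain z where z: "z \<in> pos vx Y" "z \<notin> pos vx X" using q.differ[OF ne] .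
    then show False
    proof (cases rule: q.kinds)
      case (1 x) then show False using pm[of x] by simp
    next
      case (2 x) then show False using pm[of x] by simp
    next
      case 3 then show False using F z by auto
    qed
  qed
  interpret qpair_full n m r "pos vx X" "pos vx Y"
    by unfold_locales (use cr[OF X Y XY] cr[OF Y X XY[symmetric]] even m_lt ne in auto)
  have "flips" using F by (auto simp: flips_def)
  from flips_interval[OF this] obtain s where s: "n = 2 * m + 2"
    "pos vx Y \<inter> {s..<s + n} = {s..<s + m} \<or> pos vx X \<inter> {s..<s + n} = {s..<s + m}" by blast
  have "\<not> 4 \<le> m"
    using s(2) interval_edge_periodic[OF fr X Y XY common m(1) s(1)] interval_edge_periodic[OF fr Y X XY[symmetric] common(2,1,4,3) m(1) s(1)] by blast
  then show ?thesis using s(1) even r3 by simp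
qed

end

section \<open>Long cycles for even $n$\<close>

text \<open>Membership obeys the recursion that \<open>x\<close> is in the set exactly when
  \<open>x - m\<close> is not and column \<open>x\<close> is not empty; \<open>m\<close> consecutive
  positions start it.\<close>

lemma free_set_eqI:
  assumes A: "free_set n m r A" and B: "free_set n m r B" and m: "0 < m"
    and D: "\<And>x. x \<in> free_set.defect m A \<longleftrightarrow> x \<in> free_set.defect m B"
    and ag: "\<And>x. c \<le> x \<Longrightarrow> x < c + m \<Longrightarrow> x \<in> A \<longleftrightarrow> x \<in> B"
  shows "A = B"
proof (rule set_eqI)
  interpret A: free_set n m r A by (rule A)
  interpret B: free_set n m r B by (rule B)
  have eq: "x \<in> A \<longleftrightarrow> x - m \<notin> A \<and> x \<notin> A.defect" "x \<in> B \<longleftrightarrow> x - m \<notin> B \<and> x \<notin> B.defect" for x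
    using A.free'[of x] B.free'[of x] by (auto simp: A.defect_iff B.defect_iff)
  have up: "c + int k \<in> A \<longleftrightarrow> c + int k \<in> B" for k
  proof (induction k rule: less_induct)
    case (less k)
    show ?case
    proof (cases "int k < m")
      case True
      then show ?thesis using ag[of "c + int k"] by simp
    next
      case False
      have e: "c + int k - m = c + int (k - nat m)" using False m by simp
      have "c + int k - m \<in> A \<longleftrightarrow> c + int k - m \<in> B" unfolding e by (rule less.IH) (use False m in simp)
      then show ?thesis using eq[of "c + int k"] D by blast
    qed
  qed
  fix x
  let ?y = "c + (x - c) mod n"
  have y: "?y mod n = x mod n" by (simp add: mod_simps)
  have "?y = c + int (nat ((x - c) mod n))" using A.n_pos by simp
  then have "?y \<in> A \<longleftrightarrow> ?y \<in> B" using up by metis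
  then show "x \<in> A \<longleftrightarrow> x \<in> B" using A.cong[OF y] B.cong[OF y] by blast
qed

lemma (in no_cycle) shared_edge:
  assumes fr: "frame vx ed" and X: "X \<in> E" "X \<notin> range ed" and Y: "Y \<in> E" "Y \<notin> range ed" and XY: "X \<noteq> Y"
    and q: "vx q \<in> X" "vx q \<in> Y" "vx (q + 1) \<in> X" "vx (q + 1) \<in> Y"
    and m: "2 * (n - d) \<le> n" and even: "n = 2 * r + 2" and r3: "3 \<le> r"
  shows "n = 8 \<and> n - d \<le> 3"
proof -
  note s = frame_shift[OF fr, of q]
  have e: "vx (0 + q) \<in> X" "vx (0 + q) \<in> Y" "vx (1 + q) \<in> X" "vx (1 + q) \<in> Y" using q by (simp_all add: add.commute)
  show ?thesis
    by (rule consecutive_pair[OF s(1) X(1) _ Y(1) _ XY e refl m even r3]) (use s(2) X Y in auto)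
qed

context six_extra
begin

definition empty_cols :: "'a set \<Rightarrow> int set" where
  "empty_cols X = {x. vx x \<notin> X \<and> vx (x - (n - d)) \<notin> X}"

lemma empty_cols_iff: "x \<in> empty_cols X \<longleftrightarrow> vx x \<notin> X \<and> vx (x - (n - d)) \<notin> X"
  by (simp add: empty_cols_def)

lemma empty_cols_defect: "X \<in> F \<Longrightarrow> free_set.defect (n - d) (pos vx X) = empty_cols X"
  using free_set.defect_iff[OF F_free_m] by (auto simp: empty_cols_def)

lemma empty_two:
  assumes "n = 2 * r + 2" "X \<in> F" "x \<in> empty_cols X" "y \<in> empty_cols X" "z \<in> empty_cols X" "x mod n \<noteq> y mod n"
  shows "z mod n = x mod n \<or> z mod n = y mod n"
  using free_set.defect_two[OF F_free_m[OF assms(2)] assms(1), of x y z] assms empty_cols_defect by simp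

lemma empty_three:
  assumes "n = 2 * r + 2" "X \<in> F" "x \<in> empty_cols X" "y \<in> empty_cols X" "x < y" "y < x + n" "x < z" "z < x + n" "z \<noteq> y"
  shows "z \<notin> empty_cols X"
proof
  assume z: "z \<in> empty_cols X"
  have "x mod n \<noteq> y mod n" "z mod n \<noteq> x mod n" "z mod n \<noteq> y mod n"
    by (rule mod_neq; use assms in simp)+
  then show False using empty_two[OF assms(1-4) z] by blast
qed

lemma empty_determined:
  assumes n: "n = 2 * r + 2" and XY: "X \<in> F" "Y \<in> F" and x: "x \<in> empty_cols X" "x \<in> empty_cols Y"
    and y: "y \<in> empty_cols X" "y \<in> empty_cols Y" and xy: "x < y" "y < x + n"
    and ag: "\<And>t. 0 \<le> t \<Longrightarrow> t < n - d \<Longrightarrow> vx t \<in> X \<longleftrightarrow> vx t \<in> Y"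
  shows "X = Y"
proof -
  have ne: "x mod n \<noteq> y mod n" by (rule mod_neq) (use xy in auto)
  have D: "z \<in> empty_cols T \<longleftrightarrow> z mod n = x mod n \<or> z mod n = y mod n"
    if T: "T \<in> F" "x \<in> empty_cols T" "y \<in> empty_cols T" for z T
  proof -
    have c: "z mod n = t mod n \<Longrightarrow> t \<in> empty_cols T \<Longrightarrow> z \<in> empty_cols T" for t
      using free_set.defect_cong[OF F_free_m[OF T(1)], of z t] empty_cols_defect[OF T(1)] by simp
    show ?thesis using empty_two[OF n T _ ne, of z] c[of x] c[of y] T by blast
  qed
  have "pos vx X = pos vx Y"
  proof (rule free_set_eqI[OF F_free_m[OF XY(1)] F_free_m[OF XY(2)], of 0])
    show "z \<in> free_set.defect (n - d) (pos vx X) \<longleftrightarrow> z \<in> free_set.defect (n - d) (pos vx Y)" for z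
      unfolding empty_cols_defect[OF XY(1)] empty_cols_defect[OF XY(2)]
      using D[OF XY(1) x(1) y(1)] D[OF XY(2) x(2) y(2)] by blast
  qed (use ag d_le in auto)
  then show ?thesis using pos_eq[OF fr FE FE] XY by blast
qed

lemma step:
  assumes "X \<in> F" "Y \<in> F" "X \<noteq> Y" "1 \<le> x" "x \<le> n - d" "vx x \<in> X"
  shows "vx (x - 1 - (n - d)) \<notin> Y"
  by (rule common_step[OF fr avail_extra[OF FE FR] avail_extra[OF FE FR]]) (use assms F0 in auto)

text \<open>If no two of the sets share two consecutive positions, at least four of them miss the
  neighbours of position 0. The first empty column \<open>w\<close> is common to three of them.\<close>

lemma no_shared_edge:
  assumes n: "n = 2 * r + 2" and m: "m = n - d" "2 * m \<le> n"
    and np: "\<And>X Y q. X \<in> F \<Longrightarrow> Y \<in> F \<Longrightarrow> X \<noteq> Y \<Longrightarrow> vx q \<in> X \<Longrightarrow> vx (q + 1) \<in> X \<Longrightarrow> vx q \<in> Y \<Longrightarrow> vx (q + 1) \<in> Y \<Longrightarrow> False"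
  shows False
proof -
  have n8: "8 \<le> n" using n r3 by simp
  have m2: "2 \<le> m" using m d_le by simp
  define N where "N = {X \<in> F. vx 1 \<notin> X \<and> vx (- 1) \<notin> X}"
  have NF: "X \<in> F" and N1: "vx 1 \<notin> X" "vx (- 1) \<notin> X" if "X \<in> N" for X using that by (auto simp: N_def)
  have cN: "4 \<le> card N"
  proof -
    have "card {X \<in> F. vx 1 \<in> X} \<le> Suc 0"
      by (subst card_le_Suc0_iff_eq) (use finF np[of _ _ 0] F0 in auto)
    moreover have "card {X \<in> F. vx (- 1) \<in> X} \<le> Suc 0"
      by (subst card_le_Suc0_iff_eq) (use finF np[of _ _ "- 1"] F0 in auto)
    moreover have "F = {X \<in> F. vx 1 \<in> X} \<union> {X \<in> F. vx (- 1) \<in> X} \<union> N" by (auto simp: N_def)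
    then have "card F \<le> card ({X \<in> F. vx 1 \<in> X} \<union> {X \<in> F. vx (- 1) \<in> X} \<union> N)" by (rule arg_cong[THEN eq_refl])
    then have "card F \<le> card {X \<in> F. vx 1 \<in> X} + card {X \<in> F. vx (- 1) \<in> X} + card N"
      using card_Un_le[of "{X \<in> F. vx 1 \<in> X} \<union> {X \<in> F. vx (- 1) \<in> X}" N]
        card_Un_le[of "{X \<in> F. vx 1 \<in> X}" "{X \<in> F. vx (- 1) \<in> X}"] by linarith
    ultimately show ?thesis using cF by linarith
  qed
  have finN: "finite N" using cN by (metis card.infinite not_numeral_le_zero)
  have NE: "x \<in> empty_cols X \<longleftrightarrow> vx x \<notin> X \<and> vx (x - m) \<notin> X" for x X unfolding m(1) by (rule empty_cols_iff)
  have per: "vx (x - n) = vx x" for x using frame_period[OF fr, of "x - n"] by simp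
  have fre: "vx (x + m) \<notin> X \<and> vx (x - m) \<notin> X" if "X \<in> N" "vx x \<in> X" for X x
    using extra_free(2)[OF fr FE FR, of X x] extra_free(2)[OF fr FE FR, of X "x - m"] that NF unfolding m(1) by auto
  have N0: "vx 0 \<in> X" "vx m \<notin> X" "vx (- m) \<notin> X" if "X \<in> N" for X
    using fre[OF that, of 0] F0[OF NF[OF that]] by auto
  have st: "vx (x - 1 - m) \<notin> Y" if "X \<in> N" "Y \<in> N" "X \<noteq> Y" "1 \<le> x" "x \<le> m" "vx x \<in> X" for X Y x
    using step[OF NF[OF that(1)] NF[OF that(2)] that(3,4)] that(5,6) unfolding m(1) by simp
  have npN: False if "X \<in> N" "Y \<in> N" "X \<noteq> Y" "vx q \<in> X" "vx (q + 1) \<in> X" "vx q \<in> Y" "vx (q + 1) \<in> Y" for X Y q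
    using np[OF NF NF] that by blast
  have three: "z \<notin> empty_cols X" if "X \<in> N" "x \<in> empty_cols X" "y \<in> empty_cols X" "x < y" "y < x + n" "x < z" "z < x + n" "z \<noteq> y" for X x y z
    using empty_three[OF n NF[OF that(1)] that(2-)] .
  have three': "z \<notin> empty_cols X" if "X \<in> N" "x \<in> empty_cols X" "y \<in> empty_cols X" "x < y" "y < z" "z < x + n" for X x y z
    using three[OF that(1-4)] that by simp
  have eqI: "X = Y" if "X \<in> N" "Y \<in> N" "x \<in> empty_cols X" "x \<in> empty_cols Y" "y \<in> empty_cols X" "y \<in> empty_cols Y" "x < y" "y < x + n"
    "\<And>t. 0 \<le> t \<Longrightarrow> t < m \<Longrightarrow> vx t \<in> X \<longleftrightarrow> vx t \<in> Y" for X Y x y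
    using empty_determined[OF n NF[OF that(1)] NF[OF that(2)] that(3-8)] that(9) m(1) by blast
  have "N \<noteq> {}" using cN by auto
  \<comment> \<open>Let \<open>y\<close> be the least position in \<open>1..m - 1\<close> occupied
    by a member \<open>a\<close>: by \<open>step\<close>, column \<open>y - 1\<close> is empty in
    all the others. If none is occupied, column \<open>m - 1\<close> is empty in all, since they
    miss \<open>- 1\<close>.\<close>
  obtain w a where w: "1 \<le> w" "w \<le> m - 1" and miss: "\<And>X x. X \<in> N \<Longrightarrow> 1 \<le> x \<Longrightarrow> x \<le> w \<Longrightarrow> vx x \<notin> X"
    and wE: "\<And>X. X \<in> N - {a} \<Longrightarrow> w \<in> empty_cols X"
  proof (cases "\<exists>y\<in>{1..m - 1}. \<exists>X\<in>N. vx y \<in> X")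
    case False
    obtain a where "a \<in> N" using \<open>N \<noteq> {}\<close> by blast
    show thesis
    proof (rule that[of "m - 1" a])
      show "m - 1 \<in> empty_cols X" if "X \<in> N - {a}" for X
        using False that N1(2)[of X] m2 by (auto simp: NE)
    qed (use False m2 in auto)
  next
    case True
    define P where "P = {y \<in> {1..m - 1}. \<exists>X\<in>N. vx y \<in> X}"
    have fP: "finite P" by (rule finite_subset[of _ "{1..m - 1}"]) (auto simp: P_def)
    define y where "y = Min P"
    have "y \<in> P" unfolding y_def by (rule Min_in[OF fP]) (use True in \<open>auto simp: P_def\<close>)
    then obtain a where y: "1 \<le> y" "y \<le> m - 1" "a \<in> N" "vx y \<in> a" by (auto simp: P_def)
    have least: "y \<le> x" if "x \<in> P" for x unfolding y_def by (rule Min_le[OF fP that])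
    have y1: "y \<noteq> 1" using y N1(1) by auto
    have mi: "vx x \<notin> X" if "X \<in> N" "1 \<le> x" "x \<le> y - 1" for X x using least[of x] that y by (auto simp: P_def)
    show thesis
    proof (rule that[of "y - 1" a])
      show "y - 1 \<in> empty_cols X" if "X \<in> N - {a}" for X
        using mi[of X "y - 1"] st[OF y(3), of X y] that y y1 by (auto simp: NE)
    qed (use y y1 mi in auto)
  qed
  \<comment> \<open>In the columns \<open>e1\<close> and \<open>e1 + 1\<close> one position each is
    known to be missing; the other ones are \<open>u\<close> and \<open>u + 1\<close>. Only one edge
    may contain both, so two of three edges have their second empty column here.\<close>
  define u where "u = (if w = 1 then - 2 * m else w - 1 + m)"
  define e1 where "e1 = (if w = 1 then - m else w - 1 + m)"
  have Q: "vx u \<in> X \<and> vx (u + 1) \<in> X \<or> e1 \<in> empty_cols X \<or> e1 + 1 \<in> empty_cols X" if X: "X \<in> N - {a}" for X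
  proof (cases "w = 1")
    case True
    have "vx (1 - m) \<notin> X" "vx (- m) \<notin> X" using wE[OF X] N0(3)[of X] X True by (auto simp: NE)
    then show ?thesis using True by (auto simp: NE u_def e1_def algebra_simps)
  next
    case False
    have "vx (w - 1) \<notin> X" "vx w \<notin> X" using miss[of X "w - 1"] miss[of X w] X w False by auto
    then show ?thesis using False by (auto simp: NE u_def e1_def algebra_simps)
  qed
  have "3 \<le> card (N - {a})" using cN finN by (auto simp: card_Diff_singleton_if)
  then obtain b c where bc: "b \<in> N - {a}" "c \<in> N - {a}" "b \<noteq> c"
    "e1 \<in> empty_cols b \<or> e1 + 1 \<in> empty_cols b" "e1 \<in> empty_cols c \<or> e1 + 1 \<in> empty_cols c"
  proof (rule three_elements)
    fix x y z assume "x \<in> N - {a}" "y \<in> N - {a}" "z \<in> N - {a}" "x \<noteq> y" "y \<noteq> z" "x \<noteq> z"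
    then show thesis using that Q npN[of _ _ u] by (metis DiffD1)
  qed
  have bN: "b \<in> N" "c \<in> N" using bc by auto
  have full: "x \<notin> empty_cols X" if X: "X \<in> {b, c}" and x: "1 \<le> x" "x \<le> m - 1" "x \<noteq> w" for X x
  proof -
    obtain e where e: "e \<in> empty_cols X" "e = e1 \<or> e = e1 + 1" using X bc by blast
    have X': "X \<in> N" "w \<in> empty_cols X" using X bc wE by auto
    show ?thesis
    proof (cases "w = 1")
      case True
      then have "e = - m \<or> e = 1 - m" using e(2) by (auto simp: e1_def)
      then show ?thesis using three[OF X'(1) e(1) X'(2), of x] True x m2 m(2) by auto
    next
      case False
      then have ew: "e = w - 1 + m \<or> e = w + m" using e(2) by (auto simp: e1_def)
      show ?thesis
      proof (cases "x < w")
        case True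
        show ?thesis
        proof
          assume "x \<in> empty_cols X"
          then have "e \<notin> empty_cols X" using three'[OF X'(1) _ X'(2), of x e] True x ew w m(2) m2 False by auto
          then show False using e(1) by simp
        qed
      next
        case F: False
        show ?thesis using three[OF X'(1) X'(2) e(1), of x] F x ew w m(2) m2 False by auto
      qed
    qed
  qed
  have right: "vx (m - 1 - int j) \<in> b \<and> vx (m - 1 - int j) \<in> c" if "w < m - 1 - int j" for j
    using that
  proof (induction j)
    case 0
    then show ?case using full[of b "m - 1"] full[of c "m - 1"] N1(2)[OF bN(1)] N1(2)[OF bN(2)] w by (auto simp: NE)
  next
    case (Suc j)
    let ?x = "m - 1 - int j"
    have "vx ?x \<in> b" "vx ?x \<in> c" using Suc by auto
    then have "vx (?x - 1 - m) \<notin> c" "vx (?x - 1 - m) \<notin> b" using st[OF bN bc(3), of ?x] st[OF bN(2,1) bc(3)[symmetric], of ?x] Suc.prems w by auto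
    then have "vx (?x - 1) \<in> b" "vx (?x - 1) \<in> c" using full[of b "?x - 1"] full[of c "?x - 1"] Suc.prems w by (auto simp: NE)
    moreover have "m - 1 - int (Suc j) = ?x - 1" by simp
    ultimately show ?case by (simp only:)
  qed
  have R: "vx x \<in> b" "vx x \<in> c" if "w < x" "x \<le> m - 1" for x
    using right[of "nat (m - 1 - x)"] that by auto
  \<comment> \<open>The four members of \<open>N\<close> fall into three classes, each allowing at
    most one member.\<close>
  have pigeon: False
    if alt: "\<And>X. X \<in> N \<Longrightarrow> vx q \<in> X \<and> vx (q + 1) \<in> X \<or> vx (q + 1) \<in> X \<and> vx (q + 2) \<in> X \<or> M X"
      and M: "\<And>X Y. X \<in> N \<Longrightarrow> Y \<in> N \<Longrightarrow> M X \<Longrightarrow> M Y \<Longrightarrow> X = Y" for q M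
  proof -
    define t where "t X = (if vx q \<in> X \<and> vx (q + 1) \<in> X then 1 else if vx (q + 1) \<in> X \<and> vx (q + 2) \<in> X then 2 else 3 :: nat)" for X
    have "X = Y" if XY: "X \<in> N" "Y \<in> N" "t X = t Y" for X Y
    proof (rule ccontr)
      assume ne: "X \<noteq> Y"
      have e: "q + 1 + 1 = q + 2" by simp
      show False
        using npN[OF XY(1,2) ne, of q] npN[OF XY(1,2) ne, of "q + 1", unfolded e] alt[OF XY(1)] alt[OF XY(2)] M[OF XY(1,2)] XY(3) ne
        by (auto simp: t_def split: if_splits)
    qed
    then have "inj_on t N" by (rule inj_onI)
    moreover have "t ` N \<subseteq> {1, 2, 3}" by (auto simp: t_def)
    ultimately have "card N \<le> card {1, 2, 3 :: nat}" by (rule card_inj_on_le) simp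
    then show False using cN by simp
  qed
  \<comment> \<open>Apart from \<open>w\<close> the columns \<open>1..m - 1\<close> are full in
    \<open>b\<close> and \<open>c\<close>, with tops above \<open>w\<close> and bottoms below it.
    Two neighbouring such columns on one side would give the two edges consecutive common
    positions.\<close>
  have "m \<le> w + 2"
  proof (rule ccontr)
    assume "\<not> ?thesis"
    then show False using npN[OF bN bc(3), of "w + 1"] R[of "w + 1"] R[of "w + 2"] by (simp add: add.assoc)
  qed
  moreover have "w \<le> 2"
  proof (rule ccontr)
    assume g: "\<not> ?thesis"
    have l: "vx (x - m) \<in> X" if "X \<in> {b, c}" "1 \<le> x" "x \<le> 2" for x X
      using full[OF that(1,2)] miss[of X x] that g w bN by (auto simp: NE)
    show False using npN[OF bN bc(3), of "1 - m"] l[of b 1] l[of b 2] l[of c 1] l[of c 2] by simp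
  qed
  ultimately consider "m = 2" "w = 1" | "m = 4" "w = 2" | "m = 3" "w = 1" | "m = 3" "w = 2" using w m2 by linarith
  then show False
  proof cases
    case 1
    have h: "vx 3 \<in> X" "vx 4 \<in> X" if X: "X \<in> {b, c}" for X
    proof -
      obtain e where e: "e \<in> empty_cols X" "e = - 2 \<or> e = - 1" using X bc 1 by (auto simp: e1_def)
      have X': "X \<in> N" "1 \<in> empty_cols X" using X bc wE 1 by auto
      have "3 \<notin> empty_cols X" "4 \<notin> empty_cols X"
        using three'[OF X'(1) e(1) X'(2), of 3] three'[OF X'(1) e(1) X'(2), of 4] e(2) n8 by auto
      then show "vx 3 \<in> X" "vx 4 \<in> X" using N1(1)[OF X'(1)] N0(2)[OF X'(1)] 1 by (auto simp: NE)
    qed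
    show False using npN[OF bN bc(3), of 3] h by auto
  next
    case 2
    have h: "2 \<in> empty_cols X" "vx (- 2) \<notin> X" "vx (- 1) \<notin> X" "vx 1 \<notin> X" "X \<in> N" if X: "X \<in> {b, c}" for X
      using X bc wE[of X] N1[of X] 2 by (auto simp: NE)
    show False
    proof (cases "n = 8")
      case True
      \<comment> \<open>Columns 2 and 6 are then the empty ones of both edges, and together with the
        positions \<open>0..3\<close> they determine an edge.\<close>
      have "6 \<in> empty_cols X" if X: "X \<in> {b, c}" for X
      proof -
        have "5 \<in> empty_cols X \<or> 6 \<in> empty_cols X" using X bc 2 by (auto simp: e1_def)
        moreover have "1 \<notin> empty_cols X" using full[OF X, of 1] 2 by simp
        then have "vx (- 3) \<in> X" using h(4)[OF X] 2 by (simp add: NE)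
        then have "vx 5 \<in> X" using per[of 5] True by simp
        then have "5 \<notin> empty_cols X" by (simp add: NE)
        ultimately show ?thesis by blast
      qed
      then have "b = c"
      proof (intro eqI[OF bN, of 2 6])
        fix t assume "0 \<le> t" "t < m"
        then have "t = 0 \<or> t = 1 \<or> t = 2 \<or> t = 3" using 2 by auto
        then show "vx t \<in> b \<longleftrightarrow> vx t \<in> c" using N0(1) bN h(4) h(1) R[of 3] 2 by (auto simp: NE)
      qed (use h n8 in auto)
      then show False using bc by simp
    next
      case False
      then have n10: "10 \<le> n" using n n8 by presburger
      have k: "vx (- 6) \<in> X" "vx (- 5) \<in> X" if X: "X \<in> {b, c}" for X
      proof -
        obtain e where e: "e \<in> empty_cols X" "e = 5 \<or> e = 6" using X bc 2 by (auto simp: e1_def)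
        have "z \<notin> empty_cols X" if "z = - 2 \<or> z = - 1" for z
        proof
          assume z: "z \<in> empty_cols X"
          then have "e \<notin> empty_cols X" using three'[OF h(5)[OF X] z h(1)[OF X], of e] that e(2) n10 by auto
          then show False using e by simp
        qed
        from this[of "- 2"] this[of "- 1"] show "vx (- 6) \<in> X" "vx (- 5) \<in> X" using h[OF X] 2 by (auto simp: NE)
      qed
      show False using npN[OF bN bc(3), of "- 6"] k by auto
    qed
  next
    case 3
    have h: "1 \<in> empty_cols X" "vx (- 3) \<notin> X" "vx (- 2) \<notin> X" "vx (- 1) \<notin> X" if X: "X \<in> N" for X
    proof -
      obtain Y where Y: "Y \<in> {b, c}" "Y \<noteq> X" using bc(3) by blast
      have "vx 2 \<in> Y" using R[of 2] Y(1) 3 by auto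
      then show "vx (- 2) \<notin> X" using st[OF _ X Y(2), of 2] Y(1) bN 3 by auto
      then show "1 \<in> empty_cols X" using N1[OF X] 3 by (simp add: NE)
    qed (use N0(3) N1(2) 3 that in auto)
    \<comment> \<open>Each member contains \<open>- 6, - 5\<close> or \<open>- 5, - 4\<close>, or
      else column \<open>- 2\<close> is empty. In the last case the empty columns \<open>- 2\<close>
      and 1, with the forced positions \<open>0..2\<close>, determine it.\<close>
    show False
    proof (rule pigeon[of "- 6" "\<lambda>X. - 2 \<in> empty_cols X"])
      fix X assume X: "X \<in> N"
      have "- 2 \<notin> empty_cols X \<Longrightarrow> vx (- 5) \<in> X" "- 1 \<in> empty_cols X \<or> vx (- 4) \<in> X" "- 3 \<in> empty_cols X \<or> vx (- 6) \<in> X"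
        using h[OF X] 3 by (auto simp: NE)
      moreover have "\<not> (- 1 \<in> empty_cols X \<and> - 3 \<in> empty_cols X)"
        using three'[OF X, of "- 3" "- 1" 1] h(1)[OF X] n8 by auto
      ultimately show "vx (- 6) \<in> X \<and> vx (- 6 + 1) \<in> X \<or> vx (- 6 + 1) \<in> X \<and> vx (- 6 + 2) \<in> X \<or> - 2 \<in> empty_cols X"
        by auto
    next
      fix X Y assume XY: "X \<in> N" "Y \<in> N" and e: "- 2 \<in> empty_cols X" "- 2 \<in> empty_cols Y"
      have v2: "vx 2 \<in> Z" if "Z \<in> N" "- 2 \<in> empty_cols Z" for Z
      proof -
        have "2 \<notin> empty_cols Z" using three'[OF that h(1)[OF that(1)], of 2] n8 by simp
        then show ?thesis using N1[OF that(1)] 3 by (simp add: NE)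
      qed
      show "X = Y"
      proof (rule eqI[OF XY e h(1)[OF XY(1)] h(1)[OF XY(2)]])
        fix s assume "0 \<le> s" "s < m"
        then have "s = 0 \<or> s = 1 \<or> s = 2" using 3 by auto
        then show "vx s \<in> X \<longleftrightarrow> vx s \<in> Y" using N0(1) N1(1) v2 XY e by auto
      qed (use n8 in auto)
    qed
  next
    case 4
    have h: "2 \<in> empty_cols X" "vx 1 \<notin> X" "vx 2 \<notin> X" "vx 3 \<notin> X" if X: "X \<in> N" for X
      using miss[OF X, of 2] N1[OF X] N0(2)[OF X] 4 by (auto simp: NE)
    show False
    proof (rule pigeon[of 4 "\<lambda>X. 5 \<in> empty_cols X"])
      fix X assume X: "X \<in> N"
      have "5 \<notin> empty_cols X \<Longrightarrow> vx 5 \<in> X" "4 \<in> empty_cols X \<or> vx 4 \<in> X" "6 \<in> empty_cols X \<or> vx 6 \<in> X"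
        using h[OF X] 4 by (auto simp: NE)
      moreover have "\<not> (4 \<in> empty_cols X \<and> 6 \<in> empty_cols X)"
        using three'[OF X, of 2 4 6] h(1)[OF X] n8 by auto
      ultimately show "vx 4 \<in> X \<and> vx (4 + 1) \<in> X \<or> vx (4 + 1) \<in> X \<and> vx (4 + 2) \<in> X \<or> 5 \<in> empty_cols X"
        by auto
    next
      fix X Y assume XY: "X \<in> N" "Y \<in> N" and e: "5 \<in> empty_cols X" "5 \<in> empty_cols Y"
      show "X = Y"
      proof (rule eqI[OF XY h(1)[OF XY(1)] h(1)[OF XY(2)] e])
        fix s assume "0 \<le> s" "s < m"
        then have "s = 0 \<or> s = 1 \<or> s = 2" using 4 by auto
        then show "vx s \<in> X \<longleftrightarrow> vx s \<in> Y" using N0(1) h XY by auto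
      qed (use n8 in auto)
    qed
  qed
qed

end

section \<open>Triples on eight vertices, and the end of the proof\<close>

context six_extra
begin

lemma eight_form:
  assumes n: "n = 8" "r = 3" and X: "X \<in> F"
  obtains p q where "1 \<le> p" "p < q" "q \<le> 7" "X = {vx 0, vx p, vx q}"
proof -
  have c: "card X = 3" using edge_card[OF FE[OF X]] n by simp
  then have "finite X" by (metis card.infinite zero_neq_numeral)
  then have "card (X - {vx 0}) = 2" using c F0[OF X] by simp
  then obtain u v where uv: "X - {vx 0} = {u, v}" "u \<noteq> v" by (auto simp: card_2_iff)
  have idx: "\<exists>p. 1 \<le> p \<and> p \<le> 7 \<and> y = vx p" if "y \<in> X - {vx 0}" for y
  proof -
    obtain i where i: "y = vx i" using edge_sub[OF FE[OF X]] frame_range[OF fr] \<open>y \<in> X - {vx 0}\<close> by auto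
    have vi: "vx (i mod n) = vx i" using frame_vx[OF fr, of "i mod n" i] by simp
    then have "i mod n \<noteq> 0" using i that by auto
    moreover have "0 \<le> i mod n" "i mod n < 8" using n by simp_all
    ultimately show ?thesis using vi i by (intro exI[of _ "i mod n"]) auto
  qed
  obtain p q where pq: "1 \<le> p" "p \<le> 7" "u = vx p" "1 \<le> q" "q \<le> 7" "v = vx q"
    using idx[of u] idx[of v] uv(1) by auto
  have X': "X = {vx 0, vx p, vx q}" using uv(1) F0[OF X] pq by auto
  show thesis
  proof (cases p q rule: linorder_cases)
    case less
    then show thesis using that[of p q] pq X' by simp
  next
    case equal
    then show thesis using uv(2) pq by simp
  next
    case greater
    then show thesis using that[of q p] pq X' by (simp add: insert_commute)
  qed
qed

text \<open>\<open>L\<close> lists six pairs, among them all that the forbidden distances permit.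
  Six edges must then realise the whole list, which makes two explicit edges available for a
  cycle.\<close>

lemma eight_all:
  assumes n: "n = 8" "r = 3"
    and L: "length L = 6" "\<And>p q. 1 \<le> p \<Longrightarrow> p < q \<Longrightarrow> q \<le> 7 \<Longrightarrow> p \<noteq> d \<Longrightarrow> q \<noteq> d \<Longrightarrow> p \<noteq> 8 - d \<Longrightarrow> q \<noteq> 8 - d \<Longrightarrow>
      q \<noteq> p + d \<Longrightarrow> q \<noteq> p + (8 - d) \<Longrightarrow> (p, q) \<in> set L"
    and pq: "(p, q) \<in> set L"
  shows "{vx 0, vx p, vx q} \<in> F"
proof -
  let ?L = "map (\<lambda>(p, q). {vx 0, vx p, vx q}) L"
  have "F \<subseteq> set ?L"
  proof
    fix X assume X: "X \<in> F"
    obtain p q where f: "1 \<le> p" "p < q" "q \<le> 7" "X = {vx 0, vx p, vx q}" by (rule eight_form[OF n X])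
    have no: "vx i \<in> X \<Longrightarrow> vx j \<in> X \<Longrightarrow> j \<noteq> i + d \<and> j \<noteq> i + (8 - d)" for i j
      using extra_free[OF fr FE[OF X] FR[OF X], of i] n(1) by auto
    have "(p, q) \<in> set L"
      by (rule L(2)[OF f(1-3)]) (use no[of 0 p] no[of 0 q] no[of p q] f(4) in simp_all)
    then show "X \<in> set ?L" using f(4) by force
  qed
  moreover have "card (set ?L) \<le> card F" using card_length[of ?L] L(1) cF by simp
  ultimately have "F = set ?L" by (intro card_seteq) auto
  then show ?thesis using pq by force
qed

lemma eight_neq:
  assumes "n = 8" "i \<noteq> j" "i \<in> {0..7}" "j \<in> {0..7}"
  shows "vx i \<noteq> vx j"
  using mod_neq[of i j n] frame_vx[OF fr, of i j] assms by auto

lemma eight_five: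
  assumes n: "n = 8" "r = 3" and d: "d = 5"
  shows False
proof -
  have "{vx 0, vx p, vx q} \<in> F" if "(p, q) \<in> set [(1, 2), (1, 7), (2, 4), (2, 6), (4, 6), (6, 7)]" for p q
  proof (rule eight_all[OF n _ _ that])
    fix p q :: int
    assume h: "1 \<le> p" "p < q" "q \<le> 7" "p \<noteq> d" "q \<noteq> d" "p \<noteq> 8 - d" "q \<noteq> 8 - d" "q \<noteq> p + d" "q \<noteq> p + (8 - d)"
    then have "p \<in> {1, 2, 4, 6}" "q \<in> {2, 4, 6, 7}" using d by auto
    then show "(p, q) \<in> set [(1, 2), (1, 7), (2, 4), (2, 6), (4, 6), (6, 7)]" using h d by auto
  qed simp
  then have F: "{vx 0, vx 1, vx 2} \<in> F" "{vx 0, vx 4, vx 6} \<in> F" by simp_all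
  have "{vx 0, vx 1, vx 2} \<noteq> {vx 0, vx 4, vx 6}"
    using eight_neq[OF n(1), of 1 0] eight_neq[OF n(1), of 1 4] eight_neq[OF n(1), of 1 6] by auto
  from common_vertex[OF fr FE[OF F(1)] FE[OF F(2)] this F_notin[OF F(1)] F_notin[OF F(2)], of 0 2]
  show False using n d by simp
qed

lemma eight_six:
  assumes n: "n = 8" "r = 3" and d: "d = 6"
  shows False
proof -
  have "{vx 0, vx p, vx q} \<in> F" if "(p, q) \<in> set [(1, 4), (1, 5), (3, 4), (3, 7), (4, 5), (4, 7)]" for p q
  proof (rule eight_all[OF n _ _ that])
    fix p q :: int
    assume h: "1 \<le> p" "p < q" "q \<le> 7" "p \<noteq> d" "q \<noteq> d" "p \<noteq> 8 - d" "q \<noteq> 8 - d" "q \<noteq> p + d" "q \<noteq> p + (8 - d)"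
    then have "p \<in> {1, 3, 4, 5}" "q \<in> {3, 4, 5, 7}" using d by auto
    then show "(p, q) \<in> set [(1, 4), (1, 5), (3, 4), (3, 7), (4, 5), (4, 7)]" using h d by auto
  qed simp
  then have F: "{vx 0, vx 1, vx 4} \<in> F" "{vx 0, vx 3, vx 7} \<in> F" by simp_all
  have "{vx 0, vx 1, vx 4} \<noteq> {vx 0, vx 3, vx 7}"
    using eight_neq[OF n(1), of 1 0] eight_neq[OF n(1), of 1 3] eight_neq[OF n(1), of 1 7] by auto
  from crossing[OF fr FE[OF F(1)] FE[OF F(2)] this F_notin[OF F(1)] F_notin[OF F(2)], of 1 4]
  show False using d by simp
qed

lemma long_even:
  assumes n: "n = 2 * r + 2" and d: "r < d"
  shows False
proof -
  have m: "2 * (n - d) \<le> n" using n d by simp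
  have *: "n = 8 \<and> n - d \<le> 3"
  proof (rule ccontr)
    assume neg: "\<not> ?thesis"
    show False
    proof (rule no_shared_edge[OF n refl m])
      fix X Y q
      assume "X \<in> F" "Y \<in> F" "X \<noteq> Y" "vx q \<in> X" "vx (q + 1) \<in> X" "vx q \<in> Y" "vx (q + 1) \<in> Y"
      then show False using shared_edge[OF fr FE FR FE FR, of X Y q] m n r3 neg by blast
    qed
  qed
  then have "r = 3" "d = 5 \<or> d = 6" using n d_le by auto
  then show False using eight_five eight_six * by blast
qed

lemma contradiction:
  assumes "n = 2 * r + 1 \<or> n = 2 * r + 2"
  shows False
  using assms short_cycles middle_odd middle_even long_odd long_even by (cases d r rule: linorder_cases) auto

end

text \<open>For \<open>r = 2\<close> there are at most six vertices, and hence at most five edges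
  through \<open>v\<close>.\<close>

lemma uniformity_ge_three:
  assumes V: "finite V" "card V \<le> 2 * r + 2" and F: "\<And>e. e \<in> F \<Longrightarrow> e \<subseteq> V \<and> card e = r \<and> v \<in> e" and cF: "6 \<le> card F"
    and v: "v \<in> V"
  shows "3 \<le> r"
proof (rule ccontr)
  assume less: "\<not> 3 \<le> r"
  have fin: "finite e" if "e \<in> F" for e using F[OF that] V finite_subset by blast
  have "r \<noteq> 0"
  proof
    assume "r = 0"
    then have "F = {}" using F fin by auto
    then show False using cF by simp
  qed
  then consider "r = 1" | "r = 2" using less by linarith
  then show False
  proof cases
    case 1
    have "F \<subseteq> {{v}}" using F 1 by (auto simp: card_1_singleton_iff)
    then have "card F \<le> card {{v}}" by (intro card_mono) auto
    then show False using cF by simp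
  next
    case 2
    have "F \<subseteq> (\<lambda>u. {v, u}) ` (V - {v})"
    proof
      fix e assume e: "e \<in> F"
      have "card (e - {v}) = 1" using F[OF e] fin[OF e] 2 by simp
      then obtain u where "e - {v} = {u}" by (auto simp: card_1_singleton_iff)
      then have "e = {v, u}" "u \<in> V - {v}" using F[OF e] by auto
      then show "e \<in> (\<lambda>u. {v, u}) ` (V - {v})" by blast
    qed
    then have "card F \<le> card ((\<lambda>u. {v, u}) ` (V - {v}))" by (intro card_mono) (use V in auto)
    also have "\<dots> \<le> card (V - {v})" by (rule card_image_le) (use V in auto)
    also have "\<dots> \<le> 5" using V v 2 by simp
    finally show False using cF by simp
  qed
qed

theorem theorem2p4:
  fixes V :: "'a set" and E :: "'a set set" and n r :: nat
    and vs :: "'a list" and es :: "'a set list" and v :: 'a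
  assumes "int r \<ge> \<lfloor>(real n - 1) / 2\<rfloor>"
    and "\<not> (n = 4 \<and> r = 2)"
    and "hypergraph V E" and "card V = n" and "uniform r E"
    and "hamiltonian_berge_cycle V E vs es"
    and "v \<in> V"
    and "card {e \<in> E - set es. v \<in> e} \<ge> extra_edges n r"
  shows "pancyclic V E"
  unfolding pancyclic_def
proof (intro ballI, rule ccontr)
  fix k assume k: "k \<in> {2..card V}" and no: "\<not> (\<exists>vs es. berge_cycle V E vs es \<and> length vs = k)"
  let ?F = "{e \<in> E - set es. v \<in> e}"
  have finV: "finite V" and sub: "\<And>e. e \<in> E \<Longrightarrow> e \<subseteq> V" and card: "\<And>e. e \<in> E \<Longrightarrow> card e = r"
    using assms(3,5) by (auto simp: hypergraph_def uniform_def)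
  have "k \<noteq> n" using no assms(4,6) by (auto simp: hamiltonian_berge_cycle_def)
  then have kn: "2 \<le> k" "k \<le> n - 1" "2 \<le> n" using k assms(4) by auto
  interpret no_cycle V E "int n" "int k - 1" "int r"
    by unfold_locales (use no kn sub card in auto)
  obtain vx ed where fr: "cyc_frame V E (int n) vx ed" and vx0: "vx 0 = v" and red: "range ed = set es"
    using frame_of_hamiltonian[OF assms(6) finV assms(7)] assms(4) by metis
  have "(real n - 1) / 2 = real_of_int (int n - 1) / real_of_int 2" by simp
  then have fl: "\<lfloor>(real n - 1) / 2\<rfloor> = (int n - 1) div 2" by (simp only: floor_divide_of_int_eq)
  show False
  proof (cases "int r = (int n - 1) div 2")
    case True
    have cF: "6 \<le> card ?F" using assms(8) True fl by (simp add: extra_edges_def)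
    have nr: "int n = 2 * int r + 1 \<or> int n = 2 * int r + 2" using True kn(3) by presburger
    then have "card V \<le> 2 * r + 2" using assms(4) by auto
    then have r3: "3 \<le> r"
      by (rule uniformity_ge_three[OF finV _ _ cF assms(7)]) (use sub card in auto)
    interpret six_extra V E "int n" "int k - 1" "int r" vx ed ?F
      by unfold_locales (use fr cF r3 red vx0 in auto)
    show False using contradiction nr by blast
  next
    case False
    then have nr: "int n \<le> 2 * int r" using assms(1) fl by linarith
    have "1 \<le> card ?F" using assms(8) False fl by (simp add: extra_edges_def)
    then obtain X where X: "X \<in> E" "X \<notin> range ed"
      using red by (metis (no_types, lifting) DiffE card.empty empty_Collect_eq not_one_le_zero)
    have "int n = 2 * int r" using edge_bound[OF fr X] nr by simp
    \<comment> \<open>\<open>r = 1\<close> would give \<open>n = 2\<close> and leave no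
      \<open>k\<close> with \<open>2 <= k <= n - 1\<close>; \<open>r = 2\<close> is the excluded
      case \<open>n = 4\<close>.\<close>
    moreover have "3 \<le> int r" using calculation assms(2) kn by (cases "r = 2") auto
    ultimately show False using half_case[OF fr X] by blast
  qed
qed

end
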